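(* Let $\mathfrak g$ be a complex simple Lie algebra with Cartan subalgebra $\mathfrak h$, let $U\subset\mathfrak h^*$ be a connected open subset, and let $\mu\in U$ be any fixed point. Let $W_0$ be a Lagrangian subalgebra of $\mathfrak g\oplus\mathfrak g$ such that $W_0\cap\mathfrak g=\mathfrak h$. Then $W_0$ extends uniquely to a family of Lagrangian subalgebras $W(\lambda)$ with $W(\mu)=W_0$ which is governed by a dynamical $r$-matrix.
   Context: $\Delta$ is the root system of $(\mathfrak g,\mathfrak h)$, $\Delta_+$ a choice of positive roots, $\alpha_1,\dots,\alpha_n$ the simple roots, $\mathfrak g=\mathfrak n_+\oplus\mathfrak h\oplus\mathfrak n_-$ with $\mathfrak n_\pm=\sum_{\alpha\in\Delta_+}\mathfrak g_{\pm\alpha}$. $\langle\cdot,\cdot\rangle$ is the Killing form. Root vectors $E_\alpha\in\mathfrak g_\alpha$ satisfy $\langle E_\alpha,E_{-\alpha}\rangle=1$. Put $h_i=[E_{\alpha_i},E_{-\alpha_i}]$ (a basis of $\mathfrak h$), $h_i^*$ the dual basis of $\mathfrak h^*$, $\lambda=\sum\lambda_ih_i^*$ the corresponding coordinates, and $r_0=\sum_{\alpha\in\Delta_+}E_\alpha\wedge E_{-\alpha}$. A dynamical $r$-matrix on $U$ is a meromorphic function $r:U\to\wedge^2\mathfrak g$ with (i) $[h,r(\lambda)]=0$ for all $h\in\mathfrak h$, and (ii) $\mathrm{Alt}(dr)+\frac12[r,r]=[\Omega^{12},\Omega^{23}]$, where $\mathrm{Alt}(dr)=\sum_ih_i\wedge\frac{\partial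 r}{\partial\lambda_i}$, $[\cdot,\cdot]$ is the Schouten bracket on $\wedge^*\mathfrak g$, and $\Omega\in(S^2\mathfrak g)^{\mathfrak g}$ is the Casimir element of the Killing form (coupling constant $2$; with the normalization used, $[\Omega^{12},\Omega^{23}]=\frac12[r_0,r_0]$). $\mathfrak g\oplus\mathfrak g$ is the direct sum Lie algebra with invariant form $((X_1,Y_1),(X_2,Y_2))=\frac12(\langle Y_1,Y_2\rangle-\langle X_1,X_2\rangle)$. A Lagrangian subalgebra is a Lie subalgebra that is maximal isotropic. $\mathfrak g$ and $\mathfrak h$ are identified with their images under the diagonal embedding. $\mathfrak g\oplus\mathfrak g$ is the double of the Lie bialgebra $(\mathfrak g,\mathfrak g^*,r_0)$, with $\mathfrak g^*$ identified with $\{(X_-+k,X_+-k):X_\pm\in\mathfrak n_\pm,k\in\mathfrak h\}$; the element $(X_-+k,X_+-k)$ is the functional $X\mapsto\frac12\langle X_+-X_--2k,X\rangle$. Given a dynamical $r$-matrix $r=r_0+\tau$, the family of Lagrangian subalgebras governed by $r$ is $W(\lambda)=\{X+\tau^\#(\lambda)\xi+\xi:X\in\mathfrak h,\ \xi\in\mathfrak h^\perp\}$, for $\lambda\in U$ at which $r$ is holomorphic, where $\mathfrak h^\perp\subset\mathfrak g^*$ is the annihilator of $\mathfrak h$ and $\tau^\#$ is given by $(a\wedge b)^\#\xi=\xi(b)a-\xi(a)b$. Explicitly, viewing $\tau^\#(\lambda)$ as an operator on $\mathfrak g$ via the Killing form, $$W(\lambda)=\{(h+Z+X_-,\,h+Z+X_+):h\in\mathfrak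 h,\ X_\pm\in\mathfrak n_\pm,\ Z=\tfrac12\tau^\#(\lambda)(X_+-X_-)\}.$$ A family of Lagrangian subalgebras is governed by a dynamical $r$-matrix if it is of this form for some dynamical $r$-matrix on $U$. *)

theory Defs
  imports "HOL-Analysis.Analysis"
begin

section \<open>Finite-dimensional complex Lie algebras\<close>

class complex_lie_algebra = ab_group_add +
  fixes scaleC :: "complex \<Rightarrow> 'a \<Rightarrow> 'a" (infixr "*\<^sub>C" 75)
    and lie :: "'a \<Rightarrow> 'a \<Rightarrow> 'a"
  assumes scaleC_add_right: "a *\<^sub>C (x + y) = a *\<^sub>C x + a *\<^sub>C y"
    and scaleC_add_left: "(a + b) *\<^sub>C x = a *\<^sub>C x + b *\<^sub>C x"
    and scaleC_scaleC: "a *\<^sub>C (b *\<^sub>C x) = (a * b) *\<^sub>C x"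
    and scaleC_one: "1 *\<^sub>C x = x"
    and finite_dimensional: "\<exists>B. finite B \<and> (\<forall>x. \<exists>c. x = (\<Sum>b\<in>B. c b *\<^sub>C b))"
    and lie_add_left: "lie (x + y) z = lie x z + lie y z"
    and lie_add_right: "lie z (x + y) = lie z x + lie z y"
    and lie_scaleC_left: "lie (a *\<^sub>C x) y = a *\<^sub>C lie x y"
    and lie_scaleC_right: "lie x (a *\<^sub>C y) = a *\<^sub>C lie x y"
    and lie_self: "lie x x = 0"
    and jacobi: "lie x (lie y z) + lie y (lie z x) + lie z (lie x y) = 0"

global_interpretation cvs: vector_space "scaleC :: complex \<Rightarrow> 'g \<Rightarrow> 'g::complex_lie_algebra"
  by unfold_locales
    (simp_all add: scaleC_add_right scaleC_add_left scaleC_scaleC scaleC_one)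

instantiation prod :: (complex_lie_algebra, complex_lie_algebra) complex_lie_algebra
begin

definition scaleC_prod :: "complex \<Rightarrow> 'a \<times> 'b \<Rightarrow> 'a \<times> 'b"
  where "scaleC_prod c p = (c *\<^sub>C fst p, c *\<^sub>C snd p)"

definition lie_prod :: "'a \<times> 'b \<Rightarrow> 'a \<times> 'b \<Rightarrow> 'a \<times> 'b"
  where "lie_prod p q = (lie (fst p) (fst q), lie (snd p) (snd q))"

instance
proof
  obtain A :: "'a set" where A: "finite A" "\<forall>x. \<exists>c. x = (\<Sum>b\<in>A. c b *\<^sub>C b)"
    using finite_dimensional by blast
  obtain B :: "'b set" where B: "finite B" "\<forall>x. \<exists>c. x = (\<Sum>b\<in>B. c b *\<^sub>C b)"
    using finite_dimensional by blast
  let ?A = "(\<lambda>a. (a, 0::'b)) ` A" and ?B = "(\<lambda>b. (0::'a, b)) ` (B - {0})"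
  have fin: "finite (?A \<union> ?B)" using A B by simp
  have disj: "?A \<inter> ?B = {}" by auto
  have "\<exists>c. p = (\<Sum>b\<in>?A \<union> ?B. c b *\<^sub>C b)" for p :: "'a \<times> 'b"
  proof -
    obtain f where f: "fst p = (\<Sum>b\<in>A. f b *\<^sub>C b)" using A(2) by blast
    obtain g where g: "snd p = (\<Sum>b\<in>B. g b *\<^sub>C b)" using B(2) by blast
    have g': "snd p = (\<Sum>b\<in>B - {0}. g b *\<^sub>C b)"
      unfolding g by (rule sum.mono_neutral_right) (auto simp: B(1))
    define c where "c q = (if snd q = 0 then f (fst q) else g (snd q))" for q
    have 1: "(\<Sum>q\<in>?A. c q *\<^sub>C q) = (fst p, 0)"
      by (subst sum.reindex)
        (simp_all add: inj_on_def c_def scaleC_prod_def prod_eq_iff fst_sum snd_sum flip: f)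
    have "(\<Sum>q\<in>?B. c q *\<^sub>C q) = (\<Sum>b\<in>B - {0}. c (0, b) *\<^sub>C (0, b))"
      by (subst sum.reindex) (simp_all add: inj_on_def)
    also have "\<dots> = (\<Sum>b\<in>B - {0}. (0, g b *\<^sub>C b))"
      by (rule sum.cong) (simp_all add: c_def scaleC_prod_def)
    also have "\<dots> = (0, snd p)"
      by (simp add: prod_eq_iff fst_sum snd_sum g')
    finally have 2: "(\<Sum>q\<in>?B. c q *\<^sub>C q) = (0, snd p)" .
    have "p = (\<Sum>q\<in>?A \<union> ?B. c q *\<^sub>C q)"
      using A(1) B(1) by (simp only: sum.union_disjoint[OF _ _ disj] finite_imageI finite_Diff 1 2) simp
    then show ?thesis by blast
  qed
  with fin show "\<exists>B. finite B \<and> (\<forall>p::'a \<times> 'b. \<exists>c. p = (\<Sum>b\<in>B. c b *\<^sub>C b))"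
    by blast
qed (auto simp: scaleC_prod_def lie_prod_def prod_eq_iff scaleC_add_right scaleC_add_left
  scaleC_scaleC scaleC_one lie_add_left lie_add_right lie_scaleC_left lie_scaleC_right
  lie_self jacobi)

end

definition lie_basis :: "'g::complex_lie_algebra set"
  where "lie_basis = (SOME B. finite B \<and> cvs.independent B \<and> cvs.span B = UNIV)"

lemma lie_basis:
  "finite (lie_basis :: 'g::complex_lie_algebra set)"
  "cvs.independent (lie_basis :: 'g set)"
  "cvs.span (lie_basis :: 'g set) = UNIV"
proof -
  obtain B :: "'g set" where B: "finite B" "\<forall>x. \<exists>c. x = (\<Sum>b\<in>B. c b *\<^sub>C b)"
    using finite_dimensional by blast
  have span: "cvs.span B = UNIV"
  proof (rule UNIV_eq_I[symmetric])
    fix x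
    obtain c where "x = (\<Sum>b\<in>B. c b *\<^sub>C b)" using B(2) by blast
    moreover have "(\<Sum>b\<in>B. c b *\<^sub>C b) \<in> cvs.span B"
      by (intro cvs.span_sum cvs.span_scale cvs.span_base)
    ultimately show "x \<in> cvs.span B" by simp
  qed
  obtain C where C: "C \<subseteq> B" "cvs.independent C" "B \<subseteq> cvs.span C"
    using cvs.maximal_independent_subset[of B] by blast
  have "cvs.span B \<subseteq> cvs.span C"
    using C(3) cvs.span_minimal cvs.subspace_span by blast
  then have "finite C \<and> cvs.independent C \<and> cvs.span C = UNIV"
    using C(1,2) finite_subset[OF C(1) B(1)] span by auto
  then have "finite (lie_basis :: 'g set) \<and> cvs.independent (lie_basis :: 'g set)
      \<and> cvs.span (lie_basis :: 'g set) = UNIV"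
    unfolding lie_basis_def by (rule someI)
  then show "finite (lie_basis :: 'g set)" "cvs.independent (lie_basis :: 'g set)"
    "cvs.span (lie_basis :: 'g set) = UNIV" by auto
qed

definition lie_subalgebra :: "'g::complex_lie_algebra set \<Rightarrow> bool"
  where "lie_subalgebra k \<longleftrightarrow> cvs.subspace k \<and> (\<forall>x\<in>k. \<forall>y\<in>k. lie x y \<in> k)"

definition lie_ideal :: "'g::complex_lie_algebra set \<Rightarrow> bool"
  where "lie_ideal I \<longleftrightarrow> cvs.subspace I \<and> (\<forall>x. \<forall>y\<in>I. lie x y \<in> I)"

definition simple_lie_algebra :: "'g::complex_lie_algebra itself \<Rightarrow> bool"
  where "simple_lie_algebra _ \<longleftrightarrow>
    (\<exists>x y :: 'g. lie x y \<noteq> 0) \<and> (\<forall>I :: 'g set. lie_ideal I \<longrightarrow> I = {0} \<or> I = UNIV)"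

definition lie_trace :: "('g::complex_lie_algebra \<Rightarrow> 'g) \<Rightarrow> complex"
  where "lie_trace f = (\<Sum>b\<in>lie_basis. cvs.representation lie_basis (f b) b)"

definition killing :: "'g::complex_lie_algebra \<Rightarrow> 'g \<Rightarrow> complex"
  where "killing x y = lie_trace (\<lambda>z. lie x (lie y z))"

text \<open>Cartan subalgebras of a complex semisimple Lie algebra, as in Helgason: maximal abelian
  subalgebras all of whose elements are ad-semisimple (i.e. ad-diagonalizable).\<close>

definition abelian_subalgebra :: "'g::complex_lie_algebra set \<Rightarrow> bool"
  where "abelian_subalgebra k \<longleftrightarrow> lie_subalgebra k \<and> (\<forall>x\<in>k. \<forall>y\<in>k. lie x y = 0)"

definition ad_semisimple :: "'g::complex_lie_algebra \<Rightarrow> bool"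
  where "ad_semisimple x \<longleftrightarrow> cvs.span {y. \<exists>c. lie x y = c *\<^sub>C y} = UNIV"

definition cartan_subalgebra :: "'g::complex_lie_algebra set \<Rightarrow> bool"
  where "cartan_subalgebra h \<longleftrightarrow>
    abelian_subalgebra h \<and> (\<forall>k. abelian_subalgebra k \<and> h \<subseteq> k \<longrightarrow> k = h) \<and>
    (\<forall>x\<in>h. ad_semisimple x)"

section \<open>Roots\<close>

text \<open>A linear functional on the subspace \<open>h\<close> is encoded as a function on the whole Lie algebra
  that vanishes off \<open>h\<close>, so that equality of functionals is equality of functions.\<close>

definition hstar :: "'g::complex_lie_algebra set \<Rightarrow> ('g \<Rightarrow> complex) set"
  where "hstar h = {\<phi>. (\<forall>x\<in>h. \<forall>y\<in>h. \<phi> (x + y) = \<phi> x + \<phi> y) \<and>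
    (\<forall>c. \<forall>x\<in>h. \<phi> (c *\<^sub>C x) = c * \<phi> x) \<and> (\<forall>x. x \<notin> h \<longrightarrow> \<phi> x = 0)}"

definition root_space :: "'g::complex_lie_algebra set \<Rightarrow> ('g \<Rightarrow> complex) \<Rightarrow> 'g set"
  where "root_space h \<beta> = {x. \<forall>H\<in>h. lie H x = \<beta> H *\<^sub>C x}"

definition roots :: "'g::complex_lie_algebra set \<Rightarrow> ('g \<Rightarrow> complex) set"
  where "roots h = {\<beta> \<in> hstar h. \<beta> \<noteq> (\<lambda>_. 0) \<and> root_space h \<beta> \<noteq> {0}}"

text \<open>A choice of positive roots is given by its simple roots \<open>\<alpha>\<close>: a basis of \<open>h\<^sup>*\<close>
  consisting of roots, such that every root is a combination of simple roots with
  integer coefficients all nonnegative or all nonpositive.\<close>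

definition positive_roots ::
    "'g::complex_lie_algebra set \<Rightarrow> ('n::finite \<Rightarrow> 'g \<Rightarrow> complex) \<Rightarrow> ('g \<Rightarrow> complex) set"
  where "positive_roots h \<alpha> =
    {\<beta> \<in> roots h. \<exists>k :: 'n \<Rightarrow> nat. \<beta> = (\<lambda>x. \<Sum>i\<in>UNIV. of_nat (k i) * \<alpha> i x)}"

definition simple_roots ::
    "'g::complex_lie_algebra set \<Rightarrow> ('n::finite \<Rightarrow> 'g \<Rightarrow> complex) \<Rightarrow> bool"
  where "simple_roots h \<alpha> \<longleftrightarrow> range \<alpha> \<subseteq> roots h \<and>
    (\<forall>\<phi>\<in>hstar h. \<exists>!c. \<phi> = (\<lambda>x. \<Sum>i\<in>UNIV. c i * \<alpha> i x)) \<and>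
    roots h = positive_roots h \<alpha> \<union> uminus ` positive_roots h \<alpha>"

definition root_vectors ::
    "'g::complex_lie_algebra set \<Rightarrow> (('g \<Rightarrow> complex) \<Rightarrow> 'g) \<Rightarrow> bool"
  where "root_vectors h E \<longleftrightarrow>
    (\<forall>\<beta>\<in>roots h. E \<beta> \<in> root_space h \<beta> \<and> killing (E \<beta>) (E (- \<beta>)) = 1)"

section \<open>Tensors\<close>

typedef (overloaded) 'g ldual =
    "{\<xi> :: 'g::complex_lie_algebra \<Rightarrow> complex. Vector_Spaces.linear scaleC (*) \<xi>}"
  morphisms pairing ldual_of
proof
  have "Vector_Spaces.linear (scaleC :: complex \<Rightarrow> 'g \<Rightarrow> 'g) (*) (\<lambda>_. 0)"
    by unfold_locales (simp_all add: algebra_simps)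
  then show "(\<lambda>_. 0) \<in> {\<xi> :: 'g \<Rightarrow> complex. Vector_Spaces.linear scaleC (*) \<xi>}" by simp
qed

text \<open>Elements of the tensor powers of the Lie algebra \<open>g\<close> are encoded as multilinear functions
  on its dual space: \<open>a \<otimes> b\<close> is the function taking \<open>\<xi>, \<eta>\<close> to \<open>\<xi>(a) \<eta>(b)\<close>. As \<open>g\<close> is
  finite-dimensional this loses nothing. Wedge products are the antisymmetrizations without
  factorial factors, e.g. \<open>a \<and> b = a \<otimes> b - b \<otimes> a\<close>.\<close>

type_synonym 'g tensor2 = "'g ldual \<Rightarrow> 'g ldual \<Rightarrow> complex"
type_synonym 'g tensor3 = "'g ldual \<Rightarrow> 'g ldual \<Rightarrow> 'g ldual \<Rightarrow> complex"

definition tensor2 :: "'g::complex_lie_algebra \<Rightarrow> 'g \<Rightarrow> 'g tensor2"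
  where "tensor2 a b = (\<lambda>\<xi> \<eta>. pairing \<xi> a * pairing \<eta> b)"

definition tensor3 :: "'g::complex_lie_algebra \<Rightarrow> 'g \<Rightarrow> 'g \<Rightarrow> 'g tensor3"
  where "tensor3 a b c = (\<lambda>\<xi> \<eta> \<zeta>. pairing \<xi> a * pairing \<eta> b * pairing \<zeta> c)"

definition wedge2 :: "'g::complex_lie_algebra \<Rightarrow> 'g \<Rightarrow> 'g tensor2"
  where "wedge2 a b = (\<lambda>\<xi> \<eta>. tensor2 a b \<xi> \<eta> - tensor2 b a \<xi> \<eta>)"

definition wedge3 :: "'g::complex_lie_algebra \<Rightarrow> 'g \<Rightarrow> 'g \<Rightarrow> 'g tensor3"
  where "wedge3 a b c = (\<lambda>\<xi> \<eta> \<zeta>.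
    tensor3 a b c \<xi> \<eta> \<zeta> + tensor3 b c a \<xi> \<eta> \<zeta> + tensor3 c a b \<xi> \<eta> \<zeta>
    - tensor3 b a c \<xi> \<eta> \<zeta> - tensor3 a c b \<xi> \<eta> \<zeta> - tensor3 c b a \<xi> \<eta> \<zeta>)"

definition bivectors :: "'g::complex_lie_algebra tensor2 set"
  where "bivectors = {T. \<exists>(m::nat) a b. T = (\<lambda>\<xi> \<eta>. \<Sum>j<m. wedge2 (a j) (b j) \<xi> \<eta>)}"

text \<open>\<open>coef T b c\<close> is the coefficient of \<open>b \<otimes> c\<close> in the expansion of \<open>T\<close> in the fixed basis.
  The operations below are given on decomposable tensors and extended (bi)linearly; note that
  a bivector \<open>T\<close> is \<open>1/2\<close> times the sum of all \<open>coef T b c\<close> times \<open>b \<and> c\<close>.\<close>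

definition coord :: "'g::complex_lie_algebra \<Rightarrow> 'g ldual"
  where "coord b = ldual_of (\<lambda>x. cvs.representation lie_basis x b)"

definition coef :: "'g::complex_lie_algebra tensor2 \<Rightarrow> 'g \<Rightarrow> 'g \<Rightarrow> complex"
  where "coef T b c = T (coord b) (coord c)"

definition ad_tensor2 :: "'g::complex_lie_algebra \<Rightarrow> 'g tensor2 \<Rightarrow> 'g tensor2"
  where "ad_tensor2 x T = (\<lambda>\<xi> \<eta>. \<Sum>b\<in>lie_basis. \<Sum>c\<in>lie_basis.
    coef T b c * (tensor2 (lie x b) c \<xi> \<eta> + tensor2 b (lie x c) \<xi> \<eta>))"

definition wedge12 :: "'g::complex_lie_algebra \<Rightarrow> 'g tensor2 \<Rightarrow> 'g tensor3"
  where "wedge12 x T = (\<lambda>\<xi> \<eta> \<zeta>. \<Sum>b\<in>lie_basis. \<Sum>c\<in>lie_basis.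
    1/2 * coef T b c * wedge3 x b c \<xi> \<eta> \<zeta>)"

text \<open>Sign and factor of the Schouten bracket are those for which
  \<open>1/2 [r, r] = [r\<^sup>1\<^sup>2, r\<^sup>1\<^sup>3] + [r\<^sup>1\<^sup>2, r\<^sup>2\<^sup>3] + [r\<^sup>1\<^sup>3, r\<^sup>2\<^sup>3]\<close>; in particular
  \<open>1/2 [r\<^sub>0, r\<^sub>0] = [\<Omega>\<^sup>1\<^sup>2, \<Omega>\<^sup>2\<^sup>3]\<close> for \<open>r\<^sub>0\<close> the sum of all \<open>E\<^sub>\<beta> \<and> E\<^bsub>-\<beta>\<^esub>\<close>.\<close>

definition schouten_decomposable ::
    "'g::complex_lie_algebra \<Rightarrow> 'g \<Rightarrow> 'g \<Rightarrow> 'g \<Rightarrow> 'g tensor3"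
  where "schouten_decomposable a b c d = (\<lambda>\<xi> \<eta> \<zeta>.
    wedge3 (lie a c) b d \<xi> \<eta> \<zeta> - wedge3 (lie a d) b c \<xi> \<eta> \<zeta>
    - wedge3 (lie b c) a d \<xi> \<eta> \<zeta> + wedge3 (lie b d) a c \<xi> \<eta> \<zeta>)"

definition schouten :: "'g::complex_lie_algebra tensor2 \<Rightarrow> 'g tensor2 \<Rightarrow> 'g tensor3"
  where "schouten S T = (\<lambda>\<xi> \<eta> \<zeta>.
    \<Sum>a\<in>lie_basis. \<Sum>b\<in>lie_basis. \<Sum>c\<in>lie_basis. \<Sum>d\<in>lie_basis.
      1/4 * coef S a b * coef T c d * schouten_decomposable a b c d \<xi> \<eta> \<zeta>)"

text \<open>\<open>[S\<^sup>1\<^sup>2, T\<^sup>2\<^sup>3]\<close>: the commutator acts in the common second tensor slot.\<close>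

definition bracket_12_23 :: "'g::complex_lie_algebra tensor2 \<Rightarrow> 'g tensor2 \<Rightarrow> 'g tensor3"
  where "bracket_12_23 S T = (\<lambda>\<xi> \<eta> \<zeta>.
    \<Sum>a\<in>lie_basis. \<Sum>b\<in>lie_basis. \<Sum>c\<in>lie_basis. \<Sum>d\<in>lie_basis.
      coef S a b * coef T c d * tensor3 a (lie b c) d \<xi> \<eta> \<zeta>)"

definition killing_dual :: "'g::complex_lie_algebra \<Rightarrow> 'g"
  where "killing_dual b =
    (THE x. \<forall>c\<in>lie_basis. killing x c = (if c = b then 1 else 0))"

definition casimir :: "'g::complex_lie_algebra tensor2"
  where "casimir = (\<lambda>\<xi> \<eta>. \<Sum>b\<in>lie_basis. tensor2 b (killing_dual b) \<xi> \<eta>)"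

text \<open>\<open>(a \<otimes> b)\<^sup># \<xi> = \<xi>(b) a\<close>, hence \<open>(a \<and> b)\<^sup># \<xi> = \<xi>(b) a - \<xi>(a) b\<close>.\<close>

definition sharp :: "'g::complex_lie_algebra tensor2 \<Rightarrow> 'g ldual \<Rightarrow> 'g"
  where "sharp T \<xi> = (\<Sum>b\<in>lie_basis. T (coord b) \<xi> *\<^sub>C b)"

section \<open>Holomorphic and meromorphic functions of several variables\<close>

definition holomorphic_mv :: "(complex ^ 'n::finite \<Rightarrow> complex) \<Rightarrow> (complex ^ 'n) set \<Rightarrow> bool"
  where "holomorphic_mv f V \<longleftrightarrow> open V \<and>
    (\<forall>v\<in>V. \<exists>D. (f has_derivative D) (at v) \<and> (\<forall>c w. D (c *s w) = c * D w))"

text \<open>Locally a quotient of holomorphic functions with denominator not identically zero. The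
  values at zeros of the denominator are unconstrained; being meromorphic thus only concerns
  the function off a thin set.\<close>

definition meromorphic_mv :: "(complex ^ 'n::finite \<Rightarrow> complex) \<Rightarrow> (complex ^ 'n) set \<Rightarrow> bool"
  where "meromorphic_mv f U \<longleftrightarrow>
    (\<forall>p\<in>U. \<exists>V a b. p \<in> V \<and> V \<subseteq> U \<and> connected V \<and> holomorphic_mv a V \<and> holomorphic_mv b V \<and>
      (\<exists>v\<in>V. b v \<noteq> 0) \<and> (\<forall>v\<in>V. b v \<noteq> 0 \<longrightarrow> f v = a v / b v))"

section \<open>Lagrangian subalgebras of the double\<close>

definition double_form :: "'g::complex_lie_algebra \<times> 'g \<Rightarrow> 'g \<times> 'g \<Rightarrow> complex"
  where "double_form p q = 1/2 * (killing (snd p) (snd q) - killing (fst p) (fst q))"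

definition isotropic :: "('g::complex_lie_algebra \<times> 'g) set \<Rightarrow> bool"
  where "isotropic L \<longleftrightarrow> cvs.subspace L \<and> (\<forall>p\<in>L. \<forall>q\<in>L. double_form p q = 0)"

definition lagrangian_subalgebra :: "('g::complex_lie_algebra \<times> 'g) set \<Rightarrow> bool"
  where "lagrangian_subalgebra L \<longleftrightarrow>
    lie_subalgebra L \<and> isotropic L \<and> (\<forall>M. isotropic M \<and> L \<subseteq> M \<longrightarrow> M = L)"

definition diagonal :: "'g \<Rightarrow> 'g \<times> 'g"
  where "diagonal x = (x, x)"

section \<open>Dynamical r-matrices\<close>

context
  fixes h :: "'g::complex_lie_algebra set"
    and \<alpha> :: "'n::finite \<Rightarrow> 'g \<Rightarrow> complex"
    and E :: "('g \<Rightarrow> complex) \<Rightarrow> 'g"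
begin

definition hvec :: "'n \<Rightarrow> 'g"
  where "hvec i = lie (E (\<alpha> i)) (E (- \<alpha> i))"

definition hvec_dual :: "'n \<Rightarrow> 'g \<Rightarrow> complex"
  where "hvec_dual i = (THE \<phi>. \<phi> \<in> hstar h \<and> (\<forall>j. \<phi> (hvec j) = (if j = i then 1 else 0)))"

text \<open>Topology and complex structure of \<open>h\<^sup>*\<close> are taken from the coordinates with respect to
  the dual basis of the \<open>hvec i\<close>.\<close>

definition hstar_point :: "complex ^ 'n \<Rightarrow> 'g \<Rightarrow> complex"
  where "hstar_point v = (\<lambda>x. \<Sum>i\<in>UNIV. v $ i * hvec_dual i x)"

definition coordinate_image :: "('g \<Rightarrow> complex) set \<Rightarrow> (complex ^ 'n) set"
  where "coordinate_image U = {v. hstar_point v \<in> U}"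

definition open_in_hstar :: "('g \<Rightarrow> complex) set \<Rightarrow> bool"
  where "open_in_hstar U \<longleftrightarrow> U \<subseteq> hstar h \<and> open (coordinate_image U)"

definition connected_in_hstar :: "('g \<Rightarrow> complex) set \<Rightarrow> bool"
  where "connected_in_hstar U \<longleftrightarrow> U \<subseteq> hstar h \<and> connected (coordinate_image U)"

definition r_zero :: "'g tensor2"
  where "r_zero = (\<lambda>\<xi> \<eta>. \<Sum>\<beta>\<in>positive_roots h \<alpha>. wedge2 (E \<beta>) (E (- \<beta>)) \<xi> \<eta>)"

definition partial_deriv ::
    "'n \<Rightarrow> (('g \<Rightarrow> complex) \<Rightarrow> 'g tensor2) \<Rightarrow> ('g \<Rightarrow> complex) \<Rightarrow> 'g tensor2"
  where "partial_deriv i r l =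
    (\<lambda>\<xi> \<eta>. deriv (\<lambda>t. r (\<lambda>x. l x + t * hvec_dual i x) \<xi> \<eta>) 0)"

definition alt_d :: "(('g \<Rightarrow> complex) \<Rightarrow> 'g tensor2) \<Rightarrow> ('g \<Rightarrow> complex) \<Rightarrow> 'g tensor3"
  where "alt_d r l = (\<lambda>\<xi> \<eta> \<zeta>. \<Sum>i\<in>UNIV. wedge12 (hvec i) (partial_deriv i r l) \<xi> \<eta> \<zeta>)"

definition meromorphic_tensor ::
    "('g \<Rightarrow> complex) set \<Rightarrow> (('g \<Rightarrow> complex) \<Rightarrow> 'g tensor2) \<Rightarrow> bool"
  where "meromorphic_tensor U r \<longleftrightarrow>
    (\<forall>\<xi> \<eta>. meromorphic_mv (\<lambda>v. r (hstar_point v) \<xi> \<eta>) (coordinate_image U))"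

definition holomorphic_locus ::
    "('g \<Rightarrow> complex) set \<Rightarrow> (('g \<Rightarrow> complex) \<Rightarrow> 'g tensor2) \<Rightarrow> ('g \<Rightarrow> complex) set"
  where "holomorphic_locus U r = {l \<in> U. \<exists>V. l \<in> V \<and> V \<subseteq> U \<and> open_in_hstar V \<and>
    (\<forall>\<xi> \<eta>. holomorphic_mv (\<lambda>v. r (hstar_point v) \<xi> \<eta>) (coordinate_image V))}"

definition dynamical_r_matrix ::
    "('g \<Rightarrow> complex) set \<Rightarrow> (('g \<Rightarrow> complex) \<Rightarrow> 'g tensor2) \<Rightarrow> bool"
  where "dynamical_r_matrix U r \<longleftrightarrow>
    (\<forall>l\<in>U. r l \<in> bivectors) \<and> meromorphic_tensor U r \<and>
    (\<forall>l\<in>holomorphic_locus U r.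
      (\<forall>H\<in>h. ad_tensor2 H (r l) = (\<lambda>\<xi> \<eta>. 0)) \<and>
      (\<forall>\<xi> \<eta> \<zeta>. alt_d r l \<xi> \<eta> \<zeta> + 1/2 * schouten (r l) (r l) \<xi> \<eta> \<zeta>
        = bracket_12_23 casimir casimir \<xi> \<eta> \<zeta>))"

definition n_plus :: "'g set"
  where "n_plus = cvs.span (\<Union>\<beta>\<in>positive_roots h \<alpha>. root_space h \<beta>)"

definition n_minus :: "'g set"
  where "n_minus = cvs.span (\<Union>\<beta>\<in>positive_roots h \<alpha>. root_space h (- \<beta>))"

text \<open>The dual space realized inside the double. The functional attached to \<open>p\<close> is the
  pairing with the diagonal; on \<open>(X\<^sub>- + k, X\<^sub>+ - k)\<close> it is \<open>1/2\<close> times the Killing product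
  with \<open>X\<^sub>+ - X\<^sub>- - 2k\<close>.\<close>

definition dual_in_double :: "('g \<times> 'g) set"
  where "dual_in_double =
    {(Xm + k, Xp - k) | Xm Xp k. Xm \<in> n_minus \<and> Xp \<in> n_plus \<and> k \<in> h}"

definition functional_of :: "'g \<times> 'g \<Rightarrow> 'g ldual"
  where "functional_of p = ldual_of (\<lambda>x. double_form (diagonal x) p)"

definition governed_space :: "(('g \<Rightarrow> complex) \<Rightarrow> 'g tensor2) \<Rightarrow> ('g \<Rightarrow> complex) \<Rightarrow> ('g \<times> 'g) set"
  where "governed_space r l =
    (let \<tau> = (\<lambda>\<xi> \<eta>. r l \<xi> \<eta> - r_zero \<xi> \<eta>) in
      {diagonal (X + sharp \<tau> (functional_of p)) + p | X p.
        X \<in> h \<and> p \<in> dual_in_double \<and> (\<forall>H\<in>h. pairing (functional_of p) H = 0)})"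

text \<open>A family is a partial function, defined exactly where the governing dynamical r-matrix
  is holomorphic.\<close>

definition governed_family ::
    "('g \<Rightarrow> complex) set \<Rightarrow> (('g \<Rightarrow> complex) \<rightharpoonup> ('g \<times> 'g) set) \<Rightarrow> bool"
  where "governed_family U W \<longleftrightarrow>
    (\<forall>L\<in>ran W. lagrangian_subalgebra L) \<and>
    (\<exists>r. dynamical_r_matrix U r \<and>
      W = (\<lambda>l. if l \<in> holomorphic_locus U r then Some (governed_space r l) else None))"

end

end

theory Submission
  imports Defs "HOL-Complex_Analysis.Complex_Analysis"
begin

text \<open>Through the Killing form a bivector becomes a skew operator on the Lie algebra. If it has weight
  zero, root spaces being one-dimensional, the operator acts on the root space of \<open>\<beta>\<close> by a scalar
  \<open>\<psi> \<beta>\<close>, odd in \<open>\<beta>\<close>, and \<open>W(\<lambda>)\<close> is spanned by the diagonal of \<open>h\<close> and the lines through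
  \<open>((\<psi> \<beta> - 1) / 2 * E \<beta>, (\<psi> \<beta> + 1) / 2 * E \<beta>)\<close>. Conversely a Lagrangian subalgebra meeting the
  diagonal in \<open>h\<close> splits into weight spaces, so it is of this form, with \<open>\<psi>\<close> satisfying an addition
  law of the hyperbolic cotangent. Evaluated on \<open>h\<close> and two opposite root vectors, the dynamical
  equation is the Riccati equation \<open>d\<psi> = (1 - \<psi>\<^sup>2) d\<lambda>(t)\<close>, with \<open>t\<close> the element of \<open>h\<close>
  dual to \<open>\<beta>\<close>; on three root vectors it is the addition law. The explicit solution of the
  Riccati equation is a quotient of entire functions and preserves the addition law, which gives
  existence. Any other solution with the same value at \<open>\<mu>\<close> agrees with it near \<open>\<mu>\<close>, hence
  wherever it is holomorphic, by the identity theorem.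
  The part of the bivector in the second exterior power of \<open>h\<close> is not determined, but does not
  influence \<open>W(\<lambda>)\<close>.\<close>

section \<open>Holomorphic functions of several variables\<close>

text \<open>The structure theory of \<open>h\<close> is derived from the definitions: simplicity and
  the normalization of the root vectors make the Killing form nondegenerate, and string arguments as
  for sl(2) make the root spaces one-dimensional.

  The Casimir element corresponds to the identity operator; this is the source of the constant 1 in
  both the Riccati equation and the addition law. In terms of the halves (\<psi> + 1) / 2 and
  (\<psi> - 1) / 2 the addition law equates two products, one for each half. The flow multiplies the
  two halves by inverse exponentials over a common denominator, and for three roots with sum zero
  the exponentials multiply to 1, so the law survives.

  The obstacle is that a meromorphic function is unconstrained on the zeros of its local
  denominators, and that division by zero gives the explicit solution a value at its poles. Hence
  the comparison uses \<psi> * denominator - numerator, which vanishes near \<mu> and is continuous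
  wherever r is holomorphic. Numerator and denominator have no common zero, so this equation also
  keeps the poles out of the holomorphic locus.\<close>

lemma holomorphic_mv_open: "holomorphic_mv f V \<Longrightarrow> open V"
  by (simp add: holomorphic_mv_def)

lemma holomorphic_mvE:
  assumes "holomorphic_mv f V" "v \<in> V"
  obtains D where "(f has_derivative D) (at v)" "\<And>c w. D (c *s w) = c * D w"
  using assms unfolding holomorphic_mv_def by blast

lemma holomorphic_mvI:
  assumes "open V"
    and "\<And>v. v \<in> V \<Longrightarrow> \<exists>D. (f has_derivative D) (at v) \<and> (\<forall>c w. D (c *s w) = c * D w)"
  shows "holomorphic_mv f V"
  using assms unfolding holomorphic_mv_def by blast

lemma holomorphic_mv_subset:
  "holomorphic_mv f V \<Longrightarrow> open W \<Longrightarrow> W \<subseteq> V \<Longrightarrow> holomorphic_mv f W"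
  unfolding holomorphic_mv_def by blast

lemma holomorphic_mv_continuous_on: "holomorphic_mv f V \<Longrightarrow> continuous_on V f"
  by (rule continuous_at_imp_continuous_on) (blast elim: holomorphic_mvE intro: has_derivative_continuous)

lemma holomorphic_mv_const: "open V \<Longrightarrow> holomorphic_mv (\<lambda>_. c) V"
  by (rule holomorphic_mvI) (auto intro!: exI[of _ "\<lambda>_. 0"] derivative_eq_intros)

lemma holomorphic_mv_component: "open V \<Longrightarrow> holomorphic_mv (\<lambda>v. v $ i) V"
  by (rule holomorphic_mvI)
    (auto intro!: exI[of _ "\<lambda>w. w $ i"] bounded_linear_imp_has_derivative bounded_linear_vec_nth)

lemma holomorphic_mv_add:
  assumes "holomorphic_mv f V" "holomorphic_mv g V"
  shows "holomorphic_mv (\<lambda>v. f v + g v) V"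
proof (rule holomorphic_mvI)
  show "open V" using assms(1) by (rule holomorphic_mv_open)
  fix v assume v: "v \<in> V"
  obtain D where D: "(f has_derivative D) (at v)" "\<And>c w. D (c *s w) = c * D w"
    using holomorphic_mvE[OF assms(1) v] by blast
  obtain D' where D': "(g has_derivative D') (at v)" "\<And>c w. D' (c *s w) = c * D' w"
    using holomorphic_mvE[OF assms(2) v] by blast
  show "\<exists>D. ((\<lambda>v. f v + g v) has_derivative D) (at v) \<and> (\<forall>c w. D (c *s w) = c * D w)"
    by (rule exI[of _ "\<lambda>w. D w + D' w"])
      (use has_derivative_add[OF D(1) D'(1)] in \<open>simp add: D(2) D'(2) distrib_left\<close>)
qed

lemma holomorphic_mv_mult:
  assumes "holomorphic_mv f V" "holomorphic_mv g V"
  shows "holomorphic_mv (\<lambda>v. f v * g v) V"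
proof (rule holomorphic_mvI)
  show "open V" using assms(1) by (rule holomorphic_mv_open)
  fix v assume v: "v \<in> V"
  obtain D where D: "(f has_derivative D) (at v)" "\<And>c w. D (c *s w) = c * D w"
    using holomorphic_mvE[OF assms(1) v] by blast
  obtain D' where D': "(g has_derivative D') (at v)" "\<And>c w. D' (c *s w) = c * D' w"
    using holomorphic_mvE[OF assms(2) v] by blast
  show "\<exists>D. ((\<lambda>v. f v * g v) has_derivative D) (at v) \<and> (\<forall>c w. D (c *s w) = c * D w)"
    by (rule exI[of _ "\<lambda>w. f v * D' w + D w * g v"])
      (use has_derivative_mult[OF D(1) D'(1)] in \<open>simp add: D(2) D'(2) distrib_left mult_ac\<close>)
qed

lemma holomorphic_mv_compose:
  assumes f: "holomorphic_mv f V" and g: "g holomorphic_on S" "open S" and sub: "f ` V \<subseteq> S"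
  shows "holomorphic_mv (\<lambda>v. g (f v)) V"
proof (rule holomorphic_mvI)
  show "open V" using f by (rule holomorphic_mv_open)
  fix v assume v: "v \<in> V"
  obtain D where D: "(f has_derivative D) (at v)" "\<And>c w. D (c *s w) = c * D w"
    using holomorphic_mvE[OF f v] by blast
  have "(g has_field_derivative deriv g (f v)) (at (f v))"
    using g sub v by (intro holomorphic_derivI[of g S]) auto
  then have "(g has_derivative (\<lambda>h. deriv g (f v) * h)) (at (f v))"
    by (rule has_field_derivative_imp_has_derivative)
  from diff_chain_at[OF D(1) this]
  show "\<exists>D. ((\<lambda>v. g (f v)) has_derivative D) (at v) \<and> (\<forall>c w. D (c *s w) = c * D w)"
    by (intro exI[of _ "\<lambda>w. deriv g (f v) * D w"]) (simp add: o_def D(2))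
qed

lemma holomorphic_mv_uminus: "holomorphic_mv f V \<Longrightarrow> holomorphic_mv (\<lambda>v. - f v) V"
  by (rule holomorphic_mv_compose[where S = UNIV]) (auto intro!: holomorphic_intros)

lemma holomorphic_mv_diff:
  "holomorphic_mv f V \<Longrightarrow> holomorphic_mv g V \<Longrightarrow> holomorphic_mv (\<lambda>v. f v - g v) V"
  using holomorphic_mv_add[OF _ holomorphic_mv_uminus] by fastforce

lemma holomorphic_mv_exp: "holomorphic_mv f V \<Longrightarrow> holomorphic_mv (\<lambda>v. exp (f v)) V"
  by (rule holomorphic_mv_compose[where S = UNIV]) (auto intro!: holomorphic_intros)

lemma holomorphic_mv_divide:
  assumes "holomorphic_mv f V" "holomorphic_mv g V" "\<And>v. v \<in> V \<Longrightarrow> g v \<noteq> 0"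
  shows "holomorphic_mv (\<lambda>v. f v / g v) V"
proof -
  have "holomorphic_mv (\<lambda>v. inverse (g v)) V"
    using assms(2,3)
    by (intro holomorphic_mv_compose[where S = "- {0}" and g = inverse]) (auto intro!: holomorphic_intros)
  from holomorphic_mv_mult[OF assms(1) this] show ?thesis by (simp add: divide_inverse)
qed

lemma holomorphic_mv_sum:
  assumes "open V" "\<And>i. i \<in> I \<Longrightarrow> holomorphic_mv (f i) V"
  shows "holomorphic_mv (\<lambda>v. \<Sum>i\<in>I. f i v) V"
  using assms(2)
  by (induction I rule: infinite_finite_induct)
    (auto intro: holomorphic_mv_const holomorphic_mv_add assms(1))

lemma holomorphic_mv_prod:
  assumes "open V" "\<And>i. i \<in> I \<Longrightarrow> holomorphic_mv (f i) V"
  shows "holomorphic_mv (\<lambda>v. \<Prod>i\<in>I. f i v) V"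
  using assms(2)
  by (induction I rule: infinite_finite_induct)
    (auto intro: holomorphic_mv_const holomorphic_mv_mult assms(1))

section \<open>Restriction to complex lines and the identity theorems\<close>

lemma bounded_linear_vector_smult: "bounded_linear (\<lambda>t::complex. t *s (w :: complex ^ 'n::finite))"
  by (intro linear_conv_bounded_linear[THEN iffD1] linearI) (simp_all add: vec_eq_iff algebra_simps)

text \<open>Complex homogeneity of \<open>D\<close> turns the real derivative into multiplication by
  \<open>D w\<close> along the line, which gives access to one-variable complex analysis.\<close>

lemma has_field_derivative_along_line:
  fixes w :: "complex ^ 'n::finite"
  assumes D: "(f has_derivative D) (at (v + t *s w))" "\<And>c u. D (c *s u) = c * D u"
  shows "((\<lambda>t. f (v + t *s w)) has_field_derivative D w) (at t)"
proof -
  have "((\<lambda>t. v + t *s w) has_derivative (\<lambda>s. s *s w)) (at t)"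
    using bounded_linear_imp_has_derivative[OF bounded_linear_vector_smult, of w "at t"]
    by (auto intro!: derivative_eq_intros)
  from diff_chain_at[OF this D(1)]
  have "((\<lambda>t. f (v + t *s w)) has_derivative (\<lambda>s. D (s *s w))) (at t)" by (simp add: o_def)
  moreover have "(\<lambda>s. D (s *s w)) = (*) (D w)" by (auto simp: D(2))
  ultimately show ?thesis by (simp add: has_field_derivative_def)
qed

lemma holomorphic_on_along_line:
  fixes w :: "complex ^ 'n::finite"
  assumes "holomorphic_mv f V" "\<And>t. t \<in> T \<Longrightarrow> v + t *s w \<in> V"
  shows "(\<lambda>t. f (v + t *s w)) holomorphic_on T"
  unfolding holomorphic_on_def
proof
  fix t assume "t \<in> T"
  then obtain D where "(f has_derivative D) (at (v + t *s w))" "\<And>c u. D (c *s u) = c * D u"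
    using holomorphic_mvE[OF assms(1)] assms(2) by metis
  from has_field_derivative_along_line[OF this]
  show "(\<lambda>t. f (v + t *s w)) field_differentiable at t within T"
    unfolding field_differentiable_def using has_field_derivative_at_within by blast
qed

lemma open_line_preimage:
  fixes w :: "complex ^ 'n::finite"
  assumes B: "open B"
  shows "open {t. v + t *s w \<in> B}"
proof -
  have "continuous_on UNIV (\<lambda>t. v + t *s w)"
    by (intro continuous_intros linear_continuous_on bounded_linear_vector_smult)
  from open_vimage[OF B this] show ?thesis by (simp add: vimage_def)
qed

lemma convex_line_preimage:
  fixes w :: "complex ^ 'n::finite"
  assumes "convex B" shows "convex {t. v + t *s w \<in> B}"
  unfolding convex_def
proof (intro ballI allI impI)
  fix x y and a b :: real
  assume *: "x \<in> {t. v + t *s w \<in> B}" "y \<in> {t. v + t *s w \<in> B}" "0 \<le> a" "0 \<le> b" "a + b = 1"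
  have "a *\<^sub>R (v + x *s w) + b *\<^sub>R (v + y *s w) = (a + b) *\<^sub>R v + (a *\<^sub>R x + b *\<^sub>R y) *s w"
    by (simp add: vec_eq_iff algebra_simps)
  moreover have "a *\<^sub>R (v + x *s w) + b *\<^sub>R (v + y *s w) \<in> B"
    using assms * by (auto intro: convexD)
  ultimately show "a *\<^sub>R x + b *\<^sub>R y \<in> {t. v + t *s w \<in> B}" using * by simp
qed

text \<open>The interior \<open>Z\<close> of the zero set is closed relative to \<open>V\<close>: in
  a ball around a limit point \<open>p\<close>, every point is joined by a complex line to some
  \<open>q\<close> of \<open>Z\<close>, the line meets the ball in a convex set, and the
  one-variable identity theorem applies there.\<close>

theorem holomorphic_mv_identity:
  assumes f: "holomorphic_mv f V" and conn: "connected V"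
    and W: "open W" "W \<subseteq> V" "W \<noteq> {}" "\<And>v. v \<in> W \<Longrightarrow> f v = 0" and v: "v \<in> V"
  shows "f v = 0"
proof -
  define Z where "Z = interior {v \<in> V. f v = 0}"
  have Z: "open Z" "Z \<subseteq> V" "\<And>z. z \<in> Z \<Longrightarrow> f z = 0"
    using interior_subset[of "{v \<in> V. f v = 0}"] by (auto simp: Z_def)
  have closed: "p \<in> Z" if p: "p \<in> V" "p \<in> closure Z" for p
  proof -
    obtain e where e: "e > 0" "ball p e \<subseteq> V"
      using holomorphic_mv_open[OF f] p(1) open_contains_ball by blast
    obtain q where q: "q \<in> Z" "q \<in> ball p e"
      using p(2) e(1) by (auto simp: closure_approachable dist_commute)
    have "f z = 0" if z: "z \<in> ball p e" for z
    proof -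
      let ?w = "z - q"
      have "f (q + 1 *s ?w) = 0"
      proof (rule analytic_continuation_open[where f = "\<lambda>t. f (q + t *s ?w)" and g = "\<lambda>_. 0" and z = 1
            and s = "{t. q + t *s ?w \<in> Z \<inter> ball p e}" and s' = "{t. q + t *s ?w \<in> ball p e}"])
        show "open {t. q + t *s ?w \<in> Z \<inter> ball p e}" "open {t. q + t *s ?w \<in> ball p e}"
          using Z(1) by (intro open_line_preimage open_Int; simp)+
        show "{t. q + t *s ?w \<in> Z \<inter> ball p e} \<noteq> {}"
          using q by (auto intro!: exI[of _ 0])
        show "connected {t. q + t *s ?w \<in> ball p e}"
          by (intro convex_connected convex_line_preimage) simp
        show "(\<lambda>t. f (q + t *s ?w)) holomorphic_on {t. q + t *s ?w \<in> ball p e}"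
          using e(2) by (intro holomorphic_on_along_line[OF f]) auto
      qed (use z Z(3) in auto)
      then show ?thesis by simp
    qed
    then have "ball p e \<subseteq> Z"
      unfolding Z_def using e by (intro interior_maximal) auto
    then show ?thesis using e(1) by auto
  qed
  have "W \<subseteq> Z" unfolding Z_def using W by (intro interior_maximal) auto
  \<comment> \<open>\<open>Z\<close> and the complement of its closure are disjoint open sets that
    cover \<open>V\<close> by \<open>closed\<close>; the second must miss \<open>V\<close>, because
    \<open>Z\<close> contains \<open>W\<close>.\<close>
  moreover have "Z \<inter> V = {} \<or> (- closure Z) \<inter> V = {}"
    using closed closure_subset[of Z] by (intro connectedD[OF conn Z(1)]) auto
  ultimately have "V \<subseteq> closure Z" using W(2,3) by blast
  then show ?thesis using closed v Z(3) by blast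
qed

lemma holomorphic_mv_nonzero_dense:
  assumes f: "holomorphic_mv f V" "connected V" "v0 \<in> V" "f v0 \<noteq> 0"
    and W: "open W" "W \<subseteq> V" "W \<noteq> {}"
  obtains w where "w \<in> W" "f w \<noteq> 0"
  using holomorphic_mv_identity[OF f(1,2) W _ f(3)] f(4) by blast

lemma meromorphic_mvE:
  assumes "meromorphic_mv f U" "p \<in> U"
  obtains V a b where "p \<in> V" "V \<subseteq> U" "connected V" "holomorphic_mv a V" "holomorphic_mv b V"
    "\<exists>v\<in>V. b v \<noteq> 0" "\<forall>v\<in>V. b v \<noteq> 0 \<longrightarrow> f v = a v / b v"
proof -
  define Q where "Q V a b \<longleftrightarrow> p \<in> V \<and> V \<subseteq> U \<and> connected V \<and> holomorphic_mv a V \<and> holomorphic_mv b V \<and>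
      (\<exists>v\<in>V. b v \<noteq> 0) \<and> (\<forall>v\<in>V. b v \<noteq> 0 \<longrightarrow> f v = a v / b v)" for V a b
  have "\<exists>V a b. Q V a b" using assms by (simp add: meromorphic_mv_def Q_def)
  then obtain V a b where "Q V a b" by blast
  with that[of V a b] show thesis by (simp add: Q_def)
qed

text \<open>The function may take any value on the zeros of its local denominators, so vanishing is
  propagated through the local numerators (\<open>good\<close>), which are holomorphic. Continuity
  at \<open>v\<close> finally gives the value there, since the denominator is nonzero arbitrarily
  close to \<open>v\<close>.\<close>

theorem meromorphic_mv_identity:
  fixes f :: "complex ^ 'n::finite \<Rightarrow> complex"
  assumes f: "meromorphic_mv f U" and conn: "connected U"
    and W: "open W" "W \<subseteq> U" "W \<noteq> {}" "\<And>v. v \<in> W \<Longrightarrow> f v = 0"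
    and v: "v \<in> U" "isCont f v"
  shows "f v = 0"
proof -
  define Q where "Q p V a b \<longleftrightarrow> p \<in> V \<and> V \<subseteq> U \<and> connected V \<and> holomorphic_mv a V \<and> holomorphic_mv b V \<and>
      (\<exists>v\<in>V. b v \<noteq> 0) \<and> (\<forall>v\<in>V. b v \<noteq> 0 \<longrightarrow> f v = a v / b v)" for p V a b
  have "\<forall>p\<in>U. \<exists>V a b. Q p V a b"
    using f by (simp add: meromorphic_mv_def Q_def)
  then obtain V a b where Q: "\<And>p. p \<in> U \<Longrightarrow> Q p (V p) (a p) (b p)"
    by metis
  note Vab = Q[unfolded Q_def]
  have op: "open (V p)" if "p \<in> U" for p using Vab[OF that] holomorphic_mv_open by blast
  define good where "good p \<longleftrightarrow> (\<forall>v\<in>V p. a p v = 0)" for p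
  \<comment> \<open>A small open set of zeros of \<open>f\<close> suffices: the numerator vanishes
    where the denominator does not, and the identity theorem spreads this over
    \<open>V q\<close>.\<close>
  have goodI: "good q"
    if q: "q \<in> U" and G: "open G" "G \<noteq> {}" "G \<subseteq> V q" "\<And>v. v \<in> G \<Longrightarrow> f v = 0" for q G
  proof -
    obtain w where w: "w \<in> G" "b q w \<noteq> 0"
      using holomorphic_mv_nonzero_dense[of "b q" "V q"] Vab[OF q] G by blast
    define G' where "G' = {v \<in> G. b q v \<noteq> 0}"
    have "continuous_on G (b q)"
      using Vab[OF q] G(3) holomorphic_mv_continuous_on continuous_on_subset by blast
    from continuous_open_preimage[OF this G(1), of "- {0}"]
    have "open G'" by (auto simp: G'_def vimage_def Int_def)
    moreover have "a q v = 0" if "v \<in> G'" for v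
    proof -
      have "v \<in> V q" "b q v \<noteq> 0" "f v = 0" using that G by (auto simp: G'_def)
      then show ?thesis using Vab[OF q] by auto
    qed
    ultimately show ?thesis
      unfolding good_def using holomorphic_mv_identity[of "a q" "V q" G'] Vab[OF q] w G(3)
      by (auto simp: G'_def)
  qed
  have step: "good q" if pq: "p \<in> U" "q \<in> U" "good p" "V p \<inter> V q \<noteq> {}" for p q
  proof -
    obtain w where w: "w \<in> V p \<inter> V q" "b p w \<noteq> 0"
      using holomorphic_mv_nonzero_dense[of "b p" "V p" _ "V p \<inter> V q"] Vab[OF pq(1)] op pq
      by (metis inf_le1 open_Int)
    define G where "G = {v \<in> V p \<inter> V q. b p v \<noteq> 0}"
    have "continuous_on (V p \<inter> V q) (b p)"
      using Vab[OF pq(1)] holomorphic_mv_continuous_on continuous_on_subset by blast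
    from continuous_open_preimage[OF this, of "- {0}"] op pq
    have "open (V p \<inter> V q \<inter> b p -` (- {0}))" by (simp add: open_Int open_Compl)
    moreover have "V p \<inter> V q \<inter> b p -` (- {0}) = G" by (auto simp: G_def)
    ultimately have "open G" by simp
    moreover have "f v = 0" if "v \<in> G" for v
      using that Vab[OF pq(1)] pq(3) by (auto simp: G_def good_def)
    ultimately show ?thesis using goodI[of q G] pq w by (auto simp: G_def)
  qed
  \<comment> \<open>By \<open>step\<close> the neighbourhoods of good points and those of the other
    points form two disjoint open sets, so connectedness leaves only one kind.\<close>
  define A where "A = \<Union> (V ` {p \<in> U. good p})"
  define B where "B = \<Union> (V ` {p \<in> U. \<not> good p})"
  have "A \<inter> U = {} \<or> B \<inter> U = {}"
  proof (rule connectedD[OF conn])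
    show "open A" "open B" using op by (auto simp: A_def B_def)
    have False if x: "x \<in> A" "x \<in> B" for x
    proof -
      obtain p q where "p \<in> U" "good p" "x \<in> V p" "q \<in> U" "\<not> good q" "x \<in> V q"
        using x unfolding A_def B_def by blast
      then show False using step[of p q] by blast
    qed
    then show "A \<inter> B \<inter> U = {}" by blast
    have "p \<in> V p" if "p \<in> U" for p using Vab[OF that] by blast
    then show "U \<subseteq> A \<union> B" unfolding A_def B_def by blast
  qed
  moreover obtain p where p: "p \<in> W" using W(3) by blast
  then have pU: "p \<in> U" using W(2) by blast
  have "good p"
    by (rule goodI[OF pU, of "W \<inter> V p"]) (use W p Vab[OF pU] op[OF pU] in auto)
  then have "A \<inter> U \<noteq> {}" using p W(2) Vab[of p] unfolding A_def by blast
  ultimately have "good v" using v(1) Vab[OF v(1)] unfolding B_def by blast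
  have zero: "f w = 0" if "w \<in> V v" "b v w \<noteq> 0" for w
    using that \<open>good v\<close> Vab[OF v(1)] by (auto simp: good_def)
  show ?thesis
  proof (rule ccontr)
    assume "f v \<noteq> 0"
    then have "eventually (\<lambda>w. f w \<noteq> 0) (nhds v)"
      using v(2) by (simp add: isCont_def eventually_nhds_conv_at tendsto_imp_eventually_ne)
    then obtain S where S: "open S" "v \<in> S" "\<And>w. w \<in> S \<Longrightarrow> f w \<noteq> 0"
      unfolding eventually_nhds by blast
    obtain w where "w \<in> S \<inter> V v" "b v w \<noteq> 0"
      using holomorphic_mv_nonzero_dense[of "b v" "V v" _ "S \<inter> V v"] Vab[OF v(1)] op[OF v(1)] S
      by (metis IntI empty_iff inf_le2 open_Int)
    then show False using S(3) zero by blast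
  qed
qed

text \<open>For comparing \<open>f\<close> with the quotient \<open>N / D\<close> without removing
  the zeros of \<open>D\<close> from the domain.\<close>

lemma meromorphic_mv_affine:
  assumes f: "meromorphic_mv f U" and DN: "holomorphic_mv D UNIV" "holomorphic_mv N UNIV"
  shows "meromorphic_mv (\<lambda>v. f v * D v - N v) U"
  unfolding meromorphic_mv_def
proof
  fix p assume "p \<in> U"
  then obtain V a b where V: "p \<in> V" "V \<subseteq> U" "connected V" "holomorphic_mv a V" "holomorphic_mv b V"
      "\<exists>v\<in>V. b v \<noteq> 0" "\<forall>v\<in>V. b v \<noteq> 0 \<longrightarrow> f v = a v / b v"
    by (rule meromorphic_mvE[OF f])
  have "holomorphic_mv D V" "holomorphic_mv N V"
    using DN holomorphic_mv_subset holomorphic_mv_open[OF V(4)] by blast+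
  then have "holomorphic_mv (\<lambda>v. a v * D v - N v * b v) V"
    by (intro holomorphic_mv_diff holomorphic_mv_mult V)
  then show "\<exists>V a b. p \<in> V \<and> V \<subseteq> U \<and> connected V \<and> holomorphic_mv a V \<and> holomorphic_mv b V \<and>
      (\<exists>v\<in>V. b v \<noteq> 0) \<and> (\<forall>v\<in>V. b v \<noteq> 0 \<longrightarrow> f v * D v - N v = a v / b v)"
    using V by (intro exI[of _ V] exI[of _ "\<lambda>v. a v * D v - N v * b v"] exI[of _ b])
      (auto simp: field_simps)
qed

text \<open>On the line from \<open>p\<close> to \<open>v\<close> the system becomes the scalar
  equation \<open>g' = L * (1 - g\<^sup>2)\<close>. The conclusion is cleared of denominators, so no
  nonvanishing has to be checked along the line.\<close>

theorem riccati_unique_solution: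
  fixes f :: "complex ^ 'n::finite \<Rightarrow> complex" and k :: "'n \<Rightarrow> complex"
  assumes f: "holomorphic_mv f (ball p e)"
    and ric: "\<And>v i. v \<in> ball p e \<Longrightarrow> deriv (\<lambda>t. f (v + t *s axis i 1)) 0 = k i * (1 - (f v)\<^sup>2)"
    and init: "f p * (b - a) = b + a"
    and v: "v \<in> ball p e"
  defines "L \<equiv> (\<Sum>i\<in>UNIV. k i * (v $ i - p $ i))"
  shows "f v * (b * exp L - a * exp (- L)) = b * exp L + a * exp (- L)"
proof -
  define w where "w = v - p"
  define T where "T = {t. p + t *s w \<in> ball p e}"
  define g where "g t = f (p + t *s w)" for t
  define u where "u t = g t * (b * exp (L * t) - a * exp (- (L * t))) - (b * exp (L * t) + a * exp (- (L * t)))" for t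
  have "e > 0" using v by (metis dist_not_less_zero mem_ball not_less_iff_gr_or_eq order_less_trans)
  then have T: "0 \<in> T" "1 \<in> T" "open T" "convex T"
    using v unfolding T_def by (auto simp: w_def)[2] (intro open_line_preimage convex_line_preimage; simp)+
  have g': "(g has_field_derivative L * (1 - (g t)\<^sup>2)) (at t)" if t: "t \<in> T" for t
  proof -
    let ?x = "p + t *s w"
    have x: "?x \<in> ball p e" using t by (simp add: T_def)
    obtain D where D: "(f has_derivative D) (at ?x)" "\<And>c u. D (c *s u) = c * D u"
      using holomorphic_mvE[OF f x] by metis
    have Di: "D (axis i 1) = k i * (1 - (f ?x)\<^sup>2)" for i
      using DERIV_imp_deriv[OF has_field_derivative_along_line[of f D ?x 0 "axis i 1"]] D ric[OF x]
      by simp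
    have "w = (\<Sum>i\<in>UNIV. w $ i *s axis i 1)" by (simp add: basis_expansion)
    then have "D w = D (\<Sum>i\<in>UNIV. w $ i *s axis i 1)" by simp
    also have "\<dots> = (\<Sum>i\<in>UNIV. w $ i * D (axis i 1))"
      by (subst linear_sum[OF has_derivative_linear[OF D(1)]]) (simp only: D(2))
    also have "\<dots> = L * (1 - (f ?x)\<^sup>2)"
      by (simp add: Di L_def w_def sum_distrib_right mult_ac)
    finally show ?thesis
      using has_field_derivative_along_line[OF D] by (simp add: g_def[abs_def])
  qed
  have "g holomorphic_on T"
    using g' unfolding holomorphic_on_def field_differentiable_def
    by (blast intro: has_field_derivative_at_within)
  then obtain P where P: "\<And>t. t \<in> T \<Longrightarrow> (P has_field_derivative g t) (at t within T)"
    using holomorphic_convex_primitive'[OF T(4,3)] by blast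
  \<comment> \<open>The defect \<open>u\<close> satisfies the linear equation
    \<open>u' = - L * g * u\<close>; as \<open>P\<close> is a primitive of \<open>g\<close>, its
    integrating factor is \<open>exp (L * P t)\<close>.\<close>
  have "((\<lambda>t. u t * exp (L * P t)) has_field_derivative 0) (at t within T)" if t: "t \<in> T" for t
  proof -
    note [derivative_intros] = has_field_derivative_at_within[OF g'[OF t]] P[OF t]
    show ?thesis
      unfolding u_def
      by (rule derivative_eq_intros refl)+ (simp add: algebra_simps power2_eq_square)
  qed
  from has_field_derivative_zero_constant[OF T(4) this]
  obtain c where c: "\<And>t. t \<in> T \<Longrightarrow> u t * exp (L * P t) = c" by blast
  have "u 0 = 0" using init by (simp add: u_def g_def)
  then have "c = 0" using c[OF T(1)] by simp
  then have "u 1 = 0" using c[OF T(2)] by simp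
  then show ?thesis by (simp add: u_def g_def w_def)
qed

section \<open>Weight vectors and the Killing form\<close>

lemma lie_zero_left [simp]: "lie 0 x = (0::'g::complex_lie_algebra)"
  using lie_scaleC_left[of 0 x x] by (metis cvs.scale_zero_left)

lemma lie_zero_right [simp]: "lie x 0 = (0::'g::complex_lie_algebra)"
  using lie_scaleC_right[of x 0 x] by (metis cvs.scale_zero_left)

lemma lie_minus_left: "lie (- x) y = - lie x (y::'g::complex_lie_algebra)"
  using lie_add_left[of x "- x" y] by (simp add: eq_neg_iff_add_eq_0 add.commute)

lemma lie_minus_right: "lie x (- y) = - lie x (y::'g::complex_lie_algebra)"
  using lie_add_right[of x y "- y"] by (simp add: eq_neg_iff_add_eq_0 add.commute)

lemma lie_diff_left: "lie (x - y) z = lie x z - lie y (z::'g::complex_lie_algebra)"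
  using lie_add_left[of x "- y" z] by (simp add: lie_minus_left)

lemma lie_diff_right: "lie z (x - y) = lie z x - lie z (y::'g::complex_lie_algebra)"
  using lie_add_right[of z x "- y"] by (simp add: lie_minus_right)

lemma lie_sum_right: "lie x (\<Sum>i\<in>I. f i) = (\<Sum>i\<in>I. lie x (f i :: 'g::complex_lie_algebra))"
  by (induction I rule: infinite_finite_induct) (simp_all add: lie_add_right)

lemma lie_sum_left: "lie (\<Sum>i\<in>I. f i) x = (\<Sum>i\<in>I. lie (f i :: 'g::complex_lie_algebra) x)"
  by (induction I rule: infinite_finite_induct) (simp_all add: lie_add_left)

lemma lie_anticommute: "lie y x = - lie x (y::'g::complex_lie_algebra)"
proof -
  have "lie x y + lie y x = 0"
    using lie_self[of "x + y"] unfolding lie_add_left lie_add_right by (simp add: lie_self add.commute)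
  then show ?thesis by (metis minus_unique)
qed

lemma lie_derivation:
  "lie x (lie y z) = lie (lie x y) z + lie y (lie x (z::'g::complex_lie_algebra))"
  using jacobi[of x y z] unfolding lie_anticommute[of z "lie x y"] lie_anticommute[of z x] lie_minus_right
  by (simp add: algebra_simps)

lemma fst_scaleC [simp]: "fst (c *\<^sub>C p) = c *\<^sub>C fst p"
  and snd_scaleC [simp]: "snd (c *\<^sub>C p) = c *\<^sub>C snd p"
  by (simp_all add: scaleC_prod_def)

lemma scaleC_Pair [simp]: "c *\<^sub>C (x, y) = (c *\<^sub>C x, c *\<^sub>C y)"
  by (simp add: scaleC_prod_def)

lemma lie_Pair [simp]: "lie (x, y) (x', y') = (lie x x', lie y y')"
  by (simp add: lie_prod_def)

text \<open>Acting by \<open>u i\<close> and subtracting the multiple by \<open>wt \<psi> i\<close>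
  stays in \<open>V\<close>, removes the \<open>\<psi>\<close> term and rescales the others. For
  each \<open>\<phi>\<close> an index separating it from \<open>\<psi>\<close> is chosen; other
  terms may drop out too, but only \<open>y \<phi>\<close> is recovered from that choice. The acting
  elements are indexed so that the lemma serves both for \<open>h\<close> and for its diagonal copy
  in the double.\<close>

lemma weight_components_in_stable_subspace:
  fixes y :: "'b \<Rightarrow> 'g::complex_lie_algebra"
  assumes "finite \<Phi>" and V: "cvs.subspace V" "\<And>i v. i \<in> I \<Longrightarrow> v \<in> V \<Longrightarrow> lie (u i) v \<in> V"
    and "\<And>\<phi> i. \<phi> \<in> \<Phi> \<Longrightarrow> i \<in> I \<Longrightarrow> lie (u i) (y \<phi>) = wt \<phi> i *\<^sub>C y \<phi>"
    and "\<And>\<phi> \<psi>. \<phi> \<in> \<Phi> \<Longrightarrow> \<psi> \<in> \<Phi> \<Longrightarrow> \<phi> \<noteq> \<psi> \<Longrightarrow> \<exists>i\<in>I. wt \<phi> i \<noteq> wt \<psi> i"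
    and "(\<Sum>\<phi>\<in>\<Phi>. y \<phi>) \<in> V" and "\<phi> \<in> \<Phi>"
  shows "y \<phi> \<in> V"
  using assms(1,4-)
proof (induction \<Phi> arbitrary: y \<phi> rule: finite_induct)
  case empty
  then show ?case by simp
next
  case (insert \<psi> \<Phi>)
  note eig = insert.prems(1) and dist = insert.prems(2) and sum = insert.prems(3)
  have old: "y \<phi> \<in> V" if \<phi>: "\<phi> \<in> \<Phi>" for \<phi>
  proof -
    obtain i where i: "i \<in> I" "wt \<phi> i \<noteq> wt \<psi> i"
      using dist[of \<phi> \<psi>] \<phi> insert.hyps(2) by auto
    let ?S = "\<Sum>\<theta>\<in>insert \<psi> \<Phi>. y \<theta>"
    have "lie (u i) ?S - wt \<psi> i *\<^sub>C ?S
        = (\<Sum>\<theta>\<in>insert \<psi> \<Phi>. lie (u i) (y \<theta>) - wt \<psi> i *\<^sub>C y \<theta>)"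
      by (simp only: lie_sum_right cvs.scale_sum_right sum_subtractf)
    also have "\<dots> = (\<Sum>\<theta>\<in>insert \<psi> \<Phi>. (wt \<theta> i - wt \<psi> i) *\<^sub>C y \<theta>)"
      by (intro sum.cong refl) (simp add: eig i(1) cvs.scale_left_diff_distrib)
    also have "\<dots> = (\<Sum>\<theta>\<in>\<Phi>. (wt \<theta> i - wt \<psi> i) *\<^sub>C y \<theta>)"
      using insert.hyps by simp
    finally have "(\<Sum>\<theta>\<in>\<Phi>. (wt \<theta> i - wt \<psi> i) *\<^sub>C y \<theta>) \<in> V"
      using sum i(1) V by (metis cvs.subspace_diff cvs.subspace_scale)
    then have "(wt \<phi> i - wt \<psi> i) *\<^sub>C y \<phi> \<in> V"
      by (intro insert.IH[of "\<lambda>\<theta>. (wt \<theta> i - wt \<psi> i) *\<^sub>C y \<theta>"])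
        (use \<phi> dist in \<open>auto simp: eig lie_scaleC_right scaleC_scaleC mult.commute\<close>)
    then have "inverse (wt \<phi> i - wt \<psi> i) *\<^sub>C (wt \<phi> i - wt \<psi> i) *\<^sub>C y \<phi> \<in> V"
      using V(1) cvs.subspace_scale by blast
    then show ?thesis using i(2) by (simp add: scaleC_scaleC scaleC_one)
  qed
  have "y \<psi> = (\<Sum>\<theta>\<in>insert \<psi> \<Phi>. y \<theta>) - (\<Sum>\<theta>\<in>\<Phi>. y \<theta>)"
    using insert.hyps by simp
  then have "y \<psi> \<in> V"
    using sum old V(1) by (metis cvs.subspace_diff cvs.subspace_sum)
  then show ?case using old insert.prems(4) by blast
qed

text \<open>Eigenvectors with distinct weights are independent, by the preceding lemma with stable
  subspace \<open>{0}\<close>, and the algebra is finite-dimensional.\<close>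

lemma finite_weights:
  fixes y :: "'b \<Rightarrow> 'g::complex_lie_algebra"
  assumes eig: "\<And>\<phi> i. \<phi> \<in> \<Phi> \<Longrightarrow> i \<in> I \<Longrightarrow> lie (u i) (y \<phi>) = wt \<phi> i *\<^sub>C y \<phi>"
    and dist: "\<And>\<phi> \<psi>. \<phi> \<in> \<Phi> \<Longrightarrow> \<psi> \<in> \<Phi> \<Longrightarrow> \<phi> \<noteq> \<psi> \<Longrightarrow> \<exists>i\<in>I. wt \<phi> i \<noteq> wt \<psi> i"
    and nz: "\<And>\<phi>. \<phi> \<in> \<Phi> \<Longrightarrow> y \<phi> \<noteq> 0"
  shows "finite \<Phi>"
proof -
  have inj: "inj_on y \<Phi>"
  proof (rule inj_onI, rule ccontr)
    fix \<phi> \<psi> assume *: "\<phi> \<in> \<Phi>" "\<psi> \<in> \<Phi>" "y \<phi> = y \<psi>" "\<phi> \<noteq> \<psi>"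
    obtain i where "i \<in> I" "wt \<phi> i \<noteq> wt \<psi> i" using dist * by blast
    then have "(wt \<phi> i - wt \<psi> i) *\<^sub>C y \<phi> = 0"
      using eig[OF *(1), of i] eig[OF *(2), of i] *(3)
      by (simp only: cvs.scale_left_diff_distrib) simp
    then show False using nz[OF *(1)] \<open>wt \<phi> i \<noteq> wt \<psi> i\<close> by simp
  qed
  have "cvs.independent (y ` \<Phi>)"
    unfolding cvs.independent_explicit_finite_subsets
  proof (intro allI impI ballI)
    fix S c v assume S: "S \<subseteq> y ` \<Phi>" "finite S" "(\<Sum>v\<in>S. c v *\<^sub>C v) = 0" "v \<in> S"
    obtain \<Psi> where \<Psi>: "\<Psi> \<subseteq> \<Phi>" "S = y ` \<Psi>" using S(1) by (meson subset_imageE)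
    have inj': "inj_on y \<Psi>" using inj \<Psi>(1) inj_on_subset by blast
    then have fin: "finite \<Psi>" using S(2) \<Psi>(2) finite_imageD by blast
    obtain \<phi> where \<phi>: "\<phi> \<in> \<Psi>" "v = y \<phi>" using S(4) \<Psi>(2) by blast
    have "(\<Sum>\<phi>\<in>\<Psi>. c (y \<phi>) *\<^sub>C y \<phi>) \<in> {0}"
      using S(3) sum.reindex[OF inj', of "\<lambda>v. c v *\<^sub>C v"] \<Psi>(2) by (simp add: o_def)
    then have "c (y \<phi>) *\<^sub>C y \<phi> \<in> {0}"
      by (intro weight_components_in_stable_subspace[OF fin cvs.subspace_single_0, of I u
            "\<lambda>\<phi>. c (y \<phi>) *\<^sub>C y \<phi>" wt])
        (use \<phi> subsetD[OF \<Psi>(1)] dist in \<open>auto simp: eig lie_scaleC_right scaleC_scaleC mult.commute\<close>)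
    then show "c v = 0" using nz[of \<phi>] \<phi> \<Psi>(1) by auto
  qed
  then have "finite (y ` \<Phi>)"
    using cvs.independent_span_bound[of lie_basis] lie_basis by (metis subset_UNIV)
  then show ?thesis using inj finite_imageD by blast
qed

lemma span_Union_subspaces:
  assumes y: "y \<in> cvs.span (\<Union>\<phi>\<in>P. S \<phi>)" and S: "\<And>\<phi>. \<phi> \<in> P \<Longrightarrow> cvs.subspace (S \<phi>)"
  obtains \<Phi> z where "finite \<Phi>" "\<Phi> \<subseteq> P" "\<And>\<phi>. \<phi> \<in> \<Phi> \<Longrightarrow> z \<phi> \<in> S \<phi>" "y = (\<Sum>\<phi>\<in>\<Phi>. z \<phi>)"
proof -
  have "\<exists>\<Phi> z. finite \<Phi> \<and> \<Phi> \<subseteq> P \<and> (\<forall>\<phi>\<in>P. z \<phi> \<in> S \<phi>) \<and> (\<forall>\<phi>. \<phi> \<notin> \<Phi> \<longrightarrow> z \<phi> = 0) \<and> y = (\<Sum>\<phi>\<in>\<Phi>. z \<phi>)"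
    using y
  proof (induction rule: cvs.span_induct_alt)
    case base
    show ?case by (rule exI[of _ "{}"], rule exI[of _ "\<lambda>_. 0"]) (use S cvs.subspace_0 in auto)
  next
    case (step c x y)
    then obtain \<Phi> z where z: "finite \<Phi>" "\<Phi> \<subseteq> P" "\<And>\<phi>. \<phi> \<in> P \<Longrightarrow> z \<phi> \<in> S \<phi>"
        "\<And>\<phi>. \<phi> \<notin> \<Phi> \<Longrightarrow> z \<phi> = 0" "y = (\<Sum>\<phi>\<in>\<Phi>. z \<phi>)" by blast
    obtain \<psi> where \<psi>: "\<psi> \<in> P" "x \<in> S \<psi>" using step by blast
    define z' where "z' \<phi> = (if \<phi> = \<psi> then c *\<^sub>C x else 0) + z \<phi>" for \<phi>
    have "(\<Sum>\<phi>\<in>insert \<psi> \<Phi>. z' \<phi>) = c *\<^sub>C x + (\<Sum>\<phi>\<in>insert \<psi> \<Phi>. z \<phi>)"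
      unfolding z'_def sum.distrib using z(1) by simp
    also have "(\<Sum>\<phi>\<in>insert \<psi> \<Phi>. z \<phi>) = y"
      unfolding z(5) by (intro sum.mono_neutral_right) (use z in auto)
    finally have "c *\<^sub>C x + y = (\<Sum>\<phi>\<in>insert \<psi> \<Phi>. z' \<phi>)" by simp
    moreover have "\<forall>\<phi>\<in>P. z' \<phi> \<in> S \<phi>"
      unfolding z'_def using z(3) \<psi> S by (auto intro!: cvs.subspace_add cvs.subspace_scale)
    ultimately show ?case
      using z(1,2,4) \<psi>(1) by (intro exI[of _ "insert \<psi> \<Phi>"] exI[of _ z']) (auto simp: z'_def)
  qed
  then obtain \<Phi> z where "finite \<Phi>" "\<Phi> \<subseteq> P" "\<forall>\<phi>\<in>P. z \<phi> \<in> S \<phi>" "y = (\<Sum>\<phi>\<in>\<Phi>. z \<phi>)" by blast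
  with that[of \<Phi> z] show thesis by blast
qed

text \<open>The common eigenspace \<open>V\<close> of \<open>F\<close> through \<open>y\<close> is
  stable under \<open>x\<close>, as \<open>x\<close> commutes with \<open>F\<close>. So the
  eigencomponents of \<open>y\<close> under \<open>x\<close> stay in \<open>V\<close> and are
  eigenvectors of the enlarged family.\<close>

lemma simultaneous_eigenvectors_span:
  fixes F :: "'g::complex_lie_algebra set"
  assumes "finite F" "\<And>x. x \<in> F \<Longrightarrow> ad_semisimple x" "\<And>x y. x \<in> F \<Longrightarrow> y \<in> F \<Longrightarrow> lie x y = 0"
  shows "cvs.span {y. \<forall>x\<in>F. \<exists>c. lie x y = c *\<^sub>C y} = UNIV"
  using assms
proof (induction F rule: finite_induct)
  case empty
  then show ?case by simp
next
  case (insert x F)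
  let ?S = "{y. \<forall>x\<in>F. \<exists>c. lie x y = c *\<^sub>C y}" and ?S' = "{y. \<forall>x\<in>insert x F. \<exists>c. lie x y = c *\<^sub>C y}"
  have "y \<in> cvs.span ?S'" if y: "y \<in> ?S" for y
  proof -
    have "\<forall>a\<in>F. \<exists>c. lie a y = c *\<^sub>C y" using y by blast
    then obtain c where c: "\<And>a. a \<in> F \<Longrightarrow> lie a y = c a *\<^sub>C y" by metis
    define V where "V = {z. \<forall>a\<in>F. lie a z = c a *\<^sub>C z}"
    have V: "cvs.subspace V"
      by (rule cvs.subspaceI) (simp_all add: V_def lie_add_right scaleC_add_right lie_scaleC_right scaleC_scaleC mult.commute)
    have stable: "lie x v \<in> V" if "v \<in> V" for v
    proof -
      have "lie a (lie x v) = c a *\<^sub>C lie x v" if "a \<in> F" for a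
        using lie_derivation[of a x v] insert.prems(2)[of a x] that \<open>v \<in> V\<close>
        by (simp add: V_def lie_scaleC_right)
      then show ?thesis by (simp add: V_def)
    qed
    have eq: "{y. \<exists>c. lie x y = c *\<^sub>C y} = (\<Union>c\<in>UNIV. {y. lie x y = c *\<^sub>C y})" by auto
    have span: "y \<in> cvs.span (\<Union>c\<in>UNIV. {y. lie x y = c *\<^sub>C y})"
      using insert.prems(1)[of x] by (simp add: ad_semisimple_def eq)
    have sub: "cvs.subspace {y. lie x y = c *\<^sub>C y}" for c
      by (rule cvs.subspaceI) (simp_all add: lie_add_right scaleC_add_right lie_scaleC_right scaleC_scaleC mult.commute)
    obtain C z where Cz: "finite C" "C \<subseteq> UNIV"
        "\<And>c. c \<in> C \<Longrightarrow> z c \<in> {y. lie x y = c *\<^sub>C y}" "y = (\<Sum>c\<in>C. z c)"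
      by (rule span_Union_subspaces[OF span sub]) (rule that, assumption+)
    then have z: "finite C" "\<And>c. c \<in> C \<Longrightarrow> lie x (z c) = c *\<^sub>C z c" "y = (\<Sum>c\<in>C. z c)" by auto
    have "z d \<in> V" if "d \<in> C" for d
      by (rule weight_components_in_stable_subspace[OF z(1) V, of "{()}" "\<lambda>_. x" z "\<lambda>c _. c"])
        (use that z stable c in \<open>auto simp: V_def\<close>)
    then have "z d \<in> ?S'" if "d \<in> C" for d
      using that z(2) by (auto simp: V_def)
    then show ?thesis unfolding z(3) by (intro cvs.span_sum cvs.span_base) blast
  qed
  then have "cvs.span ?S \<subseteq> cvs.span ?S'"
    by (intro cvs.span_minimal cvs.subspace_span) blast
  with insert show ?case by auto
qed

section \<open>Trace, Killing form and its invariance\<close>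

abbreviation coordinate :: "'g::complex_lie_algebra \<Rightarrow> 'g \<Rightarrow> complex"
  where "coordinate x b \<equiv> cvs.representation lie_basis x b"

lemma coordinate_add: "coordinate (x + y) b = coordinate x b + coordinate (y::'g::complex_lie_algebra) b"
  by (subst cvs.representation_add) (simp_all add: lie_basis)

lemma coordinate_diff: "coordinate (x - y) b = coordinate x b - coordinate (y::'g::complex_lie_algebra) b"
  by (subst cvs.representation_diff) (simp_all add: lie_basis)

lemma coordinate_scale: "coordinate (c *\<^sub>C x) b = c * coordinate (x::'g::complex_lie_algebra) b"
  by (subst cvs.representation_scale) (simp_all add: lie_basis)

lemma coordinate_sum: "coordinate (\<Sum>i\<in>I. f i) b = (\<Sum>i\<in>I. coordinate (f i :: 'g::complex_lie_algebra) b)"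
  by (subst cvs.representation_sum) (simp_all add: lie_basis)

lemma coordinate_basis:
  "b \<in> lie_basis \<Longrightarrow> coordinate (b::'g::complex_lie_algebra) c = (if c = b then 1 else 0)"
  by (subst cvs.representation_basis) (simp_all add: lie_basis)

lemma sum_coordinate: "(\<Sum>b\<in>lie_basis. coordinate x b *\<^sub>C b) = (x::'g::complex_lie_algebra)"
  by (rule cvs.sum_representation_eq) (simp_all add: lie_basis)

lemma lie_trace_commute:
  fixes f g :: "'g::complex_lie_algebra \<Rightarrow> 'g"
  assumes f: "\<And>x y. f (x + y) = f x + f y" "\<And>c x. f (c *\<^sub>C x) = c *\<^sub>C f x"
    and g: "\<And>x y. g (x + y) = g x + g y" "\<And>c x. g (c *\<^sub>C x) = c *\<^sub>C g x"
  shows "lie_trace (\<lambda>x. f (g x)) = lie_trace (\<lambda>x. g (f x))"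
proof -
  have main: "lie_trace (\<lambda>x. f (g x)) = (\<Sum>b\<in>lie_basis. \<Sum>c\<in>lie_basis. coordinate (g b) c * coordinate (f c) b)"
    if f: "\<And>x y. f (x + y) = f x + f y" "\<And>c x. f (c *\<^sub>C x) = c *\<^sub>C f x" for f g :: "'g \<Rightarrow> 'g"
  proof -
    have f0: "f 0 = 0" using f(2)[of 0 0] by simp
    have fsum: "f (\<Sum>i\<in>I. y i) = (\<Sum>i\<in>I. f (y i))" for I and y :: "'g \<Rightarrow> 'g"
      by (induction I rule: infinite_finite_induct) (simp_all add: f f0)
    have "coordinate (f (g b)) b = (\<Sum>c\<in>lie_basis. coordinate (g b) c * coordinate (f c) b)" for b
    proof -
      have "f (g b) = f (\<Sum>c\<in>lie_basis. coordinate (g b) c *\<^sub>C c)" by (simp only: sum_coordinate)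
      also have "\<dots> = (\<Sum>c\<in>lie_basis. coordinate (g b) c *\<^sub>C f c)" by (simp only: fsum f(2))
      finally show ?thesis by (simp only: coordinate_sum coordinate_scale)
    qed
    then show ?thesis by (simp only: lie_trace_def)
  qed
  show ?thesis
    unfolding main[of f g, OF f] main[of g f, OF g] by (subst sum.swap) (simp add: mult.commute)
qed

lemma lie_trace_add: "lie_trace (\<lambda>x. f x + g x) = lie_trace f + lie_trace g"
  by (simp add: lie_trace_def coordinate_add sum.distrib)

lemma lie_trace_diff: "lie_trace (\<lambda>x. f x - g x) = lie_trace f - lie_trace g"
  by (simp add: lie_trace_def coordinate_diff sum_subtractf)

lemma lie_trace_scale: "lie_trace (\<lambda>x. c *\<^sub>C f x) = c * lie_trace f"
  by (simp add: lie_trace_def coordinate_scale sum_distrib_left)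

lemma killing_commute: "killing x y = killing y x"
  unfolding killing_def by (rule lie_trace_commute) (simp_all add: lie_add_right lie_scaleC_right)

lemma killing_add_left: "killing (x + y) z = killing x z + killing y z"
  by (simp add: killing_def lie_add_left lie_trace_add)

lemma killing_scale_left: "killing (c *\<^sub>C x) z = c * killing x z"
  by (simp add: killing_def lie_scaleC_left lie_trace_scale)

lemma killing_add_right: "killing z (x + y) = killing z x + killing z y"
  by (metis killing_commute killing_add_left)

lemma killing_scale_right: "killing z (c *\<^sub>C x) = c * killing z x"
  by (metis killing_commute killing_scale_left)

lemma killing_zero_left [simp]: "killing 0 x = 0"
  using killing_scale_left[of 0 x x] by simp

lemma killing_zero_right [simp]: "killing x 0 = 0"
  by (metis killing_commute killing_zero_left)

lemma killing_minus_left: "killing (- x) z = - killing x z"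
  using killing_add_left[of x "- x" z] by (simp add: eq_neg_iff_add_eq_0 add.commute)

lemma killing_minus_right: "killing z (- x) = - killing z x"
  by (metis killing_commute killing_minus_left)

lemma killing_diff_left: "killing (x - y) z = killing x z - killing y z"
  using killing_add_left[of x "- y" z] by (simp add: killing_minus_left)

lemma killing_diff_right: "killing z (x - y) = killing z x - killing z y"
  by (metis killing_commute killing_diff_left)

lemma killing_sum_left: "killing (\<Sum>i\<in>I. f i) z = (\<Sum>i\<in>I. killing (f i) z)"
  by (induction I rule: infinite_finite_induct) (simp_all add: killing_add_left)

lemma killing_sum_right: "killing z (\<Sum>i\<in>I. f i) = (\<Sum>i\<in>I. killing z (f i))"
  by (induction I rule: infinite_finite_induct) (simp_all add: killing_add_right)

lemmas killing_bilinear = killing_add_left killing_add_right killing_scale_left killing_scale_right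
  killing_minus_left killing_minus_right killing_diff_left killing_diff_right

lemmas lie_bilinear = lie_add_left lie_add_right lie_scaleC_left lie_scaleC_right
  lie_minus_left lie_minus_right lie_diff_left lie_diff_right

text \<open>After expanding the brackets in the adjoint action by the Jacobi identity, the two sides
  differ by the trace of a commutator.\<close>

lemma killing_invariant: "killing (lie x y) z = killing x (lie y z)"
proof -
  have 1: "lie (lie x y) (lie z w) = lie x (lie y (lie z w)) - lie y (lie x (lie z w))" for w
    using lie_derivation[of x y "lie z w"] by simp
  have 2: "lie x (lie (lie y z) w) = lie x (lie y (lie z w)) - lie x (lie z (lie y w))" for w
    using lie_derivation[of y z w] by (simp add: lie_bilinear algebra_simps)
  have "lie_trace (\<lambda>w. lie y (lie x (lie z w))) = lie_trace (\<lambda>w. lie x (lie z (lie y w)))"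
    by (rule lie_trace_commute) (simp_all add: lie_bilinear)
  then show ?thesis by (simp add: killing_def 1 2 lie_trace_diff)
qed

lemma killing_lie_cyclic: "killing x (lie y z) = killing y (lie z x)"
  by (metis killing_commute killing_invariant)

lemma killing_lie_swap: "killing x (lie y z) = - killing x (lie z y)"
  by (metis killing_minus_right lie_anticommute)

text \<open>The vectors of the ladder have the pairwise distinct weights
  \<open>p + of_nat j * q\<close> under \<open>H\<close>, so they cannot all be nonzero.\<close>

lemma ladder_reaches_zero:
  fixes a :: "'g::complex_lie_algebra"
  assumes w: "lie H w = p *\<^sub>C w" and a: "lie H a = q *\<^sub>C a" "q \<noteq> 0"
  shows "\<exists>j. (lie a ^^ j) w = 0"
proof (rule ccontr)
  assume nz: "\<nexists>j. (lie a ^^ j) w = 0"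
  have eig: "lie H ((lie a ^^ j) w) = (p + of_nat j * q) *\<^sub>C (lie a ^^ j) w" for j
  proof (induction j)
    case (Suc j)
    have "lie H ((lie a ^^ Suc j) w) = (q + (p + of_nat j * q)) *\<^sub>C (lie a ^^ Suc j) w"
      using Suc lie_derivation[of H a "(lie a ^^ j) w"]
      by (simp add: a lie_scaleC_left lie_scaleC_right lie_add_right scaleC_add_left)
    then show ?case by (simp add: algebra_simps)
  qed (simp add: w)
  have "finite (UNIV :: nat set)"
    by (rule finite_weights[of UNIV "{()}" "\<lambda>_. H" "\<lambda>j. (lie a ^^ j) w" "\<lambda>j _. p + of_nat j * q"])
      (use nz a(2) eig in auto)
  then show False by simp
qed

text \<open>A string as in sl(2) theory: applying \<open>b\<close> and then \<open>a\<close> returns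
  the previous vector times a partial sum of the eigenvalues of \<open>t\<close>. If these sums
  never vanish, neither does the string, against \<open>ladder_reaches_zero\<close>. A separate
  \<open>H\<close> measures the steps because \<open>t\<close> itself may act on \<open>b\<close> by
  zero.\<close>

lemma no_infinite_ladder:
  fixes a b :: "'g::complex_lie_algebra"
  assumes ab: "lie a b = t" and w: "w \<noteq> 0" "lie a w = 0" "lie t w = m *\<^sub>C w" "lie t b = (- n) *\<^sub>C b"
    and H: "lie H w = p *\<^sub>C w" "lie H b = q *\<^sub>C b" "q \<noteq> 0"
    and nz: "\<And>j. (\<Sum>i\<le>j. m - of_nat i * n) \<noteq> 0"
  shows False
proof -
  let ?v = "\<lambda>j. (lie b ^^ j) w"
  have t: "lie t (?v j) = (m - of_nat j * n) *\<^sub>C ?v j" for j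
  proof (induction j)
    case (Suc j)
    have "lie t (?v (Suc j)) = (- n + (m - of_nat j * n)) *\<^sub>C ?v (Suc j)"
      using Suc lie_derivation[of t b "?v j"] unfolding scaleC_add_left
      by (simp add: w(4) lie_scaleC_left lie_scaleC_right lie_minus_left)
    then show ?case by (simp add: algebra_simps)
  qed (simp add: w)
  have up: "lie a (?v (Suc j)) = (\<Sum>i\<le>j. m - of_nat i * n) *\<^sub>C ?v j" for j
  proof (induction j)
    case 0
    then show ?case using lie_derivation[of a b w] by (simp add: ab w)
  next
    case (Suc j)
    have "lie a (?v (Suc (Suc j))) = ((m - of_nat (Suc j) * n) + (\<Sum>i\<le>j. m - of_nat i * n)) *\<^sub>C ?v (Suc j)"
      using Suc lie_derivation[of a b "?v (Suc j)"] t[of "Suc j"] unfolding scaleC_add_left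
      by (simp add: ab lie_scaleC_right)
    then show ?case by (simp add: add.commute)
  qed
  have "?v j \<noteq> 0" for j
  proof (induction j)
    case (Suc j)
    then show ?case using up[of j] nz[of j] by auto
  qed (simp add: w)
  then show False using ladder_reaches_zero[OF H] by blast
qed

section \<open>Root space decomposition\<close>

locale root_data =
  fixes h :: "'g::complex_lie_algebra set"
    and \<alpha> :: "'n::finite \<Rightarrow> 'g \<Rightarrow> complex"
    and E :: "('g \<Rightarrow> complex) \<Rightarrow> 'g"
  assumes simple: "simple_lie_algebra TYPE('g)"
    and cartan: "cartan_subalgebra h"
    and simple_roots: "simple_roots h \<alpha>"
    and root_vectors: "root_vectors h E"
begin

lemma h_subspace: "cvs.subspace h"
  using cartan by (simp add: cartan_subalgebra_def abelian_subalgebra_def lie_subalgebra_def)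

lemma h_commute: "x \<in> h \<Longrightarrow> y \<in> h \<Longrightarrow> lie x y = 0"
  using cartan by (simp add: cartan_subalgebra_def abelian_subalgebra_def)

lemmas h_closed = cvs.subspace_0[OF h_subspace] cvs.subspace_add[OF h_subspace]
  cvs.subspace_scale[OF h_subspace] cvs.subspace_diff[OF h_subspace] cvs.subspace_neg[OF h_subspace]

text \<open>Adjoining \<open>x\<close> to \<open>h\<close> gives an abelian subalgebra
  \<open>k\<close>, so maximality of \<open>h\<close> applies.\<close>

lemma h_self_centralizing:
  assumes x: "\<And>H. H \<in> h \<Longrightarrow> lie H x = 0"
  shows "x \<in> h"
proof -
  define k where "k = {H + c *\<^sub>C x | H c. H \<in> h}"
  have kI: "y \<in> k" if "y = H + c *\<^sub>C x" "H \<in> h" for y H c using that by (auto simp: k_def)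
  have "cvs.subspace k"
  proof (rule cvs.subspaceI)
    show "0 \<in> k" using h_closed(1) by (intro kI[of 0 0 0]) auto
    fix y z assume "y \<in> k" "z \<in> k"
    then obtain H c H' c' where *: "y = H + c *\<^sub>C x" "z = H' + c' *\<^sub>C x" "H \<in> h" "H' \<in> h"
      by (auto simp: k_def)
    show "y + z \<in> k"
      by (rule kI[of _ "H + H'" "c + c'"]) (use * h_closed in \<open>auto simp: scaleC_add_left algebra_simps\<close>)
    show "d *\<^sub>C y \<in> k" for d
      by (rule kI[of _ "d *\<^sub>C H" "d * c"]) (use * h_closed in \<open>auto simp: scaleC_add_right scaleC_scaleC\<close>)
  qed
  moreover have comm: "lie y z = 0" if "y \<in> k" "z \<in> k" for y z
  proof -
    from that obtain H c H' c' where *: "y = H + c *\<^sub>C x" "z = H' + c' *\<^sub>C x" "H \<in> h" "H' \<in> h"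
      by (auto simp: k_def)
    then show ?thesis
      using x lie_anticommute[of x H'] by (simp add: lie_bilinear lie_self h_commute)
  qed
  ultimately have "abelian_subalgebra k"
    by (simp add: abelian_subalgebra_def lie_subalgebra_def cvs.subspace_0)
  moreover have "h \<subseteq> k" using kI[of _ _ 0] by auto
  ultimately have "k = h" using cartan by (auto simp: cartan_subalgebra_def)
  moreover have "x \<in> k" using h_closed(1) by (intro kI[of _ 0 1]) (auto simp: scaleC_one)
  ultimately show ?thesis by simp
qed

lemma rootD:
  assumes "\<beta> \<in> roots h"
  shows "\<beta> \<in> hstar h" "\<beta> \<noteq> (\<lambda>_. 0)"
  using assms by (auto simp: roots_def)

lemma uminus_root [simp]: "\<beta> \<in> roots h \<Longrightarrow> - \<beta> \<in> roots h"
proof -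
  have minus: "- (- \<gamma>) = \<gamma>" for \<gamma> :: "'g \<Rightarrow> complex" by (simp add: fun_eq_iff)
  assume "\<beta> \<in> roots h"
  moreover have "roots h = positive_roots h \<alpha> \<union> uminus ` positive_roots h \<alpha>"
    using simple_roots by (simp add: simple_roots_def)
  ultimately show ?thesis using minus by (auto simp: image_iff)
qed

lemma minus_minus_root [simp]: "- (- \<beta>) = (\<beta> :: 'g \<Rightarrow> complex)"
  by (simp add: fun_eq_iff)

lemma hstarD:
  assumes "\<beta> \<in> hstar h"
  shows "x \<in> h \<Longrightarrow> y \<in> h \<Longrightarrow> \<beta> (x + y) = \<beta> x + \<beta> y" "x \<in> h \<Longrightarrow> \<beta> (c *\<^sub>C x) = c * \<beta> x"
    "x \<notin> h \<Longrightarrow> \<beta> x = 0"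
  using assms by (auto simp: hstar_def)

lemma hstar_eqI:
  assumes "\<beta> \<in> hstar h" "\<gamma> \<in> hstar h" "\<And>H. H \<in> h \<Longrightarrow> \<beta> H = \<gamma> H"
  shows "\<beta> = \<gamma>"
proof
  fix x show "\<beta> x = \<gamma> x"
    using assms hstarD(3)[of \<beta> x] hstarD(3)[of \<gamma> x] by (cases "x \<in> h") auto
qed

lemma root_nonzero:
  assumes "\<beta> \<in> roots h"
  obtains H where "H \<in> h" "\<beta> H \<noteq> 0"
proof -
  have "(\<lambda>_. 0) \<in> hstar h" by (simp add: hstar_def)
  then show thesis using that hstar_eqI[of \<beta> "\<lambda>_. 0"] rootD[OF assms] by blast
qed

lemma lie_E: "\<beta> \<in> roots h \<Longrightarrow> H \<in> h \<Longrightarrow> lie H (E \<beta>) = \<beta> H *\<^sub>C E \<beta>"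
  using root_vectors by (simp add: root_vectors_def root_space_def)

lemma killing_E: "\<beta> \<in> roots h \<Longrightarrow> killing (E \<beta>) (E (- \<beta>)) = 1"
  using root_vectors by (simp add: root_vectors_def)

lemma killing_E': "\<beta> \<in> roots h \<Longrightarrow> killing (E (- \<beta>)) (E \<beta>) = 1"
  by (metis killing_E killing_commute)

lemma E_nonzero: "\<beta> \<in> roots h \<Longrightarrow> E \<beta> \<noteq> 0"
  using killing_E by fastforce

lemma finite_roots: "finite (roots h)"
  by (rule finite_weights[of _ h "\<lambda>H. H" E "\<lambda>\<beta> H. \<beta> H"])
    (use lie_E E_nonzero hstar_eqI rootD in blast)+

lemma killing_weights_orthogonal:
  assumes "lie H x = a *\<^sub>C x" "lie H y = b *\<^sub>C y" "a + b \<noteq> 0"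
  shows "killing x (y::'g) = 0"
proof -
  have "killing (lie H x) y = - killing x (lie H y)"
    by (metis killing_invariant killing_minus_left lie_anticommute)
  then have "(a + b) * killing x y = 0"
    using assms(1,2) by (simp add: killing_bilinear algebra_simps)
  with assms(3) show ?thesis by simp
qed

lemma killing_h_root: "H \<in> h \<Longrightarrow> \<beta> \<in> roots h \<Longrightarrow> x \<in> root_space h \<beta> \<Longrightarrow> killing H x = 0"
  by (erule root_nonzero, rule killing_weights_orthogonal[of _ _ 0])
    (auto simp: h_commute root_space_def)

lemma killing_root_spaces:
  assumes "\<beta> \<in> roots h" "\<gamma> \<in> roots h" "\<gamma> \<noteq> - \<beta>" "x \<in> root_space h \<beta>" "y \<in> root_space h \<gamma>"
  shows "killing x y = 0"
proof -
  have "\<exists>H\<in>h. \<gamma> H \<noteq> (- \<beta>) H"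
    using hstar_eqI[of \<gamma> "- \<beta>"] rootD(1)[OF assms(2)] rootD(1)[OF uminus_root[OF assms(1)]] assms(3)
    by blast
  then obtain H where "H \<in> h" "\<beta> H + \<gamma> H \<noteq> 0"
    by (auto simp: eq_neg_iff_add_eq_0 add.commute)
  then show ?thesis
    using assms(4,5) by (intro killing_weights_orthogonal[of H x "\<beta> H" y "\<gamma> H"]) (auto simp: root_space_def)
qed

lemma E_in_root_space: "\<beta> \<in> roots h \<Longrightarrow> E \<beta> \<in> root_space h \<beta>"
  using root_vectors by (simp add: root_vectors_def)

lemma killing_E_E:
  "\<beta> \<in> roots h \<Longrightarrow> \<gamma> \<in> roots h \<Longrightarrow> killing (E \<beta>) (E \<gamma>) = (if \<gamma> = - \<beta> then 1 else 0)"
  using killing_E killing_root_spaces E_in_root_space by auto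

lemma killing_h_E [simp]: "H \<in> h \<Longrightarrow> \<beta> \<in> roots h \<Longrightarrow> killing H (E \<beta>) = 0"
  "H \<in> h \<Longrightarrow> \<beta> \<in> roots h \<Longrightarrow> killing (E \<beta>) H = 0"
  using killing_h_root E_in_root_space killing_commute by metis+

lemma simple_root: "\<alpha> i \<in> roots h"
  using simple_roots unfolding simple_roots_def by blast

text \<open>The radical is an ideal; the normalization of the root vectors keeps it from being
  everything, and simplicity leaves only zero.\<close>

lemma killing_nondegenerate:
  assumes "\<And>y. killing x y = 0"
  shows "x = (0::'g)"
proof -
  let ?I = "{x::'g. \<forall>y. killing x y = 0}"
  have "lie_ideal ?I"
    unfolding lie_ideal_def
  proof (intro conjI allI ballI)
    show "cvs.subspace ?I" by (rule cvs.subspaceI) (simp_all add: killing_bilinear)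
    fix z x assume "x \<in> ?I"
    then show "lie z x \<in> ?I"
      using killing_invariant[of x z] lie_anticommute[of z x] by (simp add: killing_minus_left)
  qed
  \<comment> \<open>\<open>undefined\<close> stands for an arbitrary index: the index type is
    nonempty, so some simple root exists.\<close>
  moreover have "E (\<alpha> undefined) \<notin> ?I" using killing_E[OF simple_root[of undefined]] by force
  ultimately have "?I = {0}" using simple by (auto simp: simple_lie_algebra_def)
  with assms show ?thesis by blast
qed

text \<open>The eigenvalue of a nonzero \<open>y\<close> depends linearly on \<open>H\<close>, so it
  is a functional on \<open>h\<close>; if that functional is zero, \<open>y\<close> centralizes
  \<open>h\<close>.\<close>

lemma simultaneous_eigenvector_is_weight_vector:
  assumes y: "\<And>H. H \<in> h \<Longrightarrow> \<exists>c. lie H y = c *\<^sub>C y"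
  shows "y \<in> h \<union> (\<Union>\<beta>\<in>roots h. root_space h \<beta>)"
proof (cases "y = 0")
  case True
  then show ?thesis using h_closed(1) by simp
next
  case False
  have inj: "a = b" if "a *\<^sub>C y = b *\<^sub>C y" for a b
    using that False by simp
  define \<phi> where "\<phi> H = (if H \<in> h then SOME c. lie H y = c *\<^sub>C y else 0)" for H
  have \<phi>: "lie H y = \<phi> H *\<^sub>C y" if "H \<in> h" for H
    using someI_ex[OF y[OF that]] that by (simp add: \<phi>_def)
  have "\<phi> \<in> hstar h"
    unfolding hstar_def
  proof (intro CollectI conjI ballI allI impI)
    show "\<phi> (a + b) = \<phi> a + \<phi> b" if "a \<in> h" "b \<in> h" for a b
      by (rule inj) (use \<phi>[of "a + b"] \<phi>[of a] \<phi>[of b] that h_closed in \<open>simp add: lie_add_left scaleC_add_left\<close>)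
    show "\<phi> (c *\<^sub>C a) = c * \<phi> a" if "a \<in> h" for a c
      by (rule inj) (metis \<phi> that h_closed(3) lie_scaleC_left scaleC_scaleC)
    show "\<phi> x = 0" if "x \<notin> h" for x using that by (simp add: \<phi>_def)
  qed
  moreover have "y \<in> root_space h \<phi>" using \<phi> by (simp add: root_space_def)
  moreover have "y \<in> h" if "\<phi> = (\<lambda>_. 0)"
    by (rule h_self_centralizing) (simp add: \<phi> that)
  ultimately show ?thesis using False by (auto simp: roots_def)
qed

text \<open>A basis \<open>F\<close> of \<open>h\<close> is a finite commuting family of
  ad-semisimple elements, and its common eigenvectors are eigenvectors of all of
  \<open>h\<close>.\<close>

lemma span_weight_vectors: "cvs.span (h \<union> (\<Union>\<beta>\<in>roots h. root_space h \<beta>)) = UNIV"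
proof -
  obtain F where F: "F \<subseteq> h" "cvs.independent F" "h \<subseteq> cvs.span F"
    using cvs.maximal_independent_subset[of h] by blast
  have fin: "finite F"
    using cvs.independent_span_bound[OF lie_basis(1) F(2)] lie_basis(3) by blast
  have "y \<in> h \<union> (\<Union>\<beta>\<in>roots h. root_space h \<beta>)" if y: "\<forall>x\<in>F. \<exists>c. lie x y = c *\<^sub>C y" for y
  proof (rule simultaneous_eigenvector_is_weight_vector)
    fix H assume "H \<in> h"
    then have "H \<in> cvs.span F" using F(3) by blast
    then show "\<exists>c. lie H y = c *\<^sub>C y"
    proof (induction rule: cvs.span_induct_alt)
      case base
      show ?case by (rule exI[of _ 0]) simp
    next
      case (step c x z)
      obtain d where d: "lie x y = d *\<^sub>C y" using y step(1) by blast
      obtain e where e: "lie z y = e *\<^sub>C y" using step by blast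
      show ?case
        by (rule exI[of _ "c * d + e"]) (simp add: lie_add_left lie_scaleC_left d e scaleC_add_left scaleC_scaleC)
    qed
  qed
  then have "cvs.span {y. \<forall>x\<in>F. \<exists>c. lie x y = c *\<^sub>C y} \<subseteq> cvs.span (h \<union> (\<Union>\<beta>\<in>roots h. root_space h \<beta>))"
    by (intro cvs.span_mono) blast
  moreover have "cvs.span {y. \<forall>x\<in>F. \<exists>c. lie x y = c *\<^sub>C y} = UNIV"
    by (rule simultaneous_eigenvectors_span[OF fin]) (use F(1) cartan in \<open>auto simp: cartan_subalgebra_def intro!: h_commute\<close>)
  ultimately show ?thesis by blast
qed

lemma killing_nondegenerate_on_h:
  assumes x: "x \<in> h" "\<And>H. H \<in> h \<Longrightarrow> killing x H = 0"
  shows "x = 0"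
proof (rule killing_nondegenerate)
  fix y
  have "y \<in> cvs.span (h \<union> (\<Union>\<beta>\<in>roots h. root_space h \<beta>))" by (simp add: span_weight_vectors)
  then show "killing x y = 0"
    by (induction rule: cvs.span_induct_alt) (auto simp: killing_bilinear x killing_h_root)
qed

text \<open>By the normalization of the root vectors this is, for a root \<open>\<beta>\<close>, the
  element of \<open>h\<close> that represents \<open>\<beta>\<close> through the Killing form, not
  the coroot; see \<open>killing_dual_vec\<close>.\<close>

definition dual_vec :: "('g \<Rightarrow> complex) \<Rightarrow> 'g"
  where "dual_vec \<beta> = lie (E \<beta>) (E (- \<beta>))"

lemma lie_E_uminus_root: "\<beta> \<in> roots h \<Longrightarrow> H \<in> h \<Longrightarrow> lie H (E (- \<beta>)) = (- \<beta> H) *\<^sub>C E (- \<beta>)"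
  using lie_E[of "- \<beta>" H] by simp

lemma lie_opposite_root_spaces_in_h:
  assumes "x \<in> root_space h \<beta>" "y \<in> root_space h (- \<beta>)"
  shows "lie x y \<in> h"
proof (rule h_self_centralizing)
  fix H assume "H \<in> h"
  then show "lie H (lie x y) = 0"
    using lie_derivation[of H x y] assms
    by (simp add: root_space_def lie_scaleC_left lie_scaleC_right lie_minus_right)
qed

lemma dual_vec_in_h [simp]: "\<beta> \<in> roots h \<Longrightarrow> dual_vec \<beta> \<in> h"
  unfolding dual_vec_def using E_in_root_space uminus_root by (blast intro: lie_opposite_root_spaces_in_h)

lemma killing_dual_vec: "\<beta> \<in> roots h \<Longrightarrow> H \<in> h \<Longrightarrow> killing H (dual_vec \<beta>) = \<beta> H"
  unfolding dual_vec_def by (simp add: lie_E killing_scale_left killing_E flip: killing_invariant)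

text \<open>Both sides lie in \<open>h\<close> and pair with each \<open>H\<close> of
  \<open>h\<close> to \<open>\<beta> H * killing x y\<close>.\<close>

lemma lie_opposite_root_spaces:
  assumes \<beta>: "\<beta> \<in> roots h" and xy: "x \<in> root_space h \<beta>" "y \<in> root_space h (- \<beta>)"
  shows "lie x y = killing x y *\<^sub>C dual_vec \<beta>"
proof -
  have "lie x y - killing x y *\<^sub>C dual_vec \<beta> = 0"
  proof (rule killing_nondegenerate_on_h)
    show "lie x y - killing x y *\<^sub>C dual_vec \<beta> \<in> h"
      using lie_opposite_root_spaces_in_h[OF xy] \<beta> h_closed by simp
    fix H assume H: "H \<in> h"
    have "killing H (lie x y) = \<beta> H * killing x y"
      using xy(1) H by (simp add: root_space_def killing_scale_left flip: killing_invariant)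
    then show "killing (lie x y - killing x y *\<^sub>C dual_vec \<beta>) H = 0"
      using killing_dual_vec[OF \<beta> H] by (simp add: killing_bilinear killing_commute[of _ H])
  qed
  then show ?thesis by simp
qed

lemma dual_vec_nonzero: "\<beta> \<in> roots h \<Longrightarrow> dual_vec \<beta> \<noteq> 0"
  using killing_dual_vec by (metis killing_zero_right root_nonzero)

text \<open>An element of \<open>h\<close> on which all roots vanish is central, hence in the
  radical of the Killing form.\<close>

lemma exists_root_not_vanishing:
  assumes "t \<in> h" "t \<noteq> 0"
  obtains \<gamma> where "\<gamma> \<in> roots h" "\<gamma> t \<noteq> 0"
proof -
  have False if \<gamma>: "\<And>\<gamma>. \<gamma> \<in> roots h \<Longrightarrow> \<gamma> t = 0"
  proof -
    have central: "lie t y = 0" for y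
    proof -
      have "y \<in> cvs.span (h \<union> (\<Union>\<beta>\<in>roots h. root_space h \<beta>))" by (simp add: span_weight_vectors)
      then show ?thesis
        by (induction rule: cvs.span_induct_alt)
          (use assms(1) \<gamma> in \<open>auto simp: lie_bilinear h_commute root_space_def\<close>)
    qed
    have "lie_trace (\<lambda>z. 0 :: 'g) = 0" by (simp add: lie_trace_def cvs.representation_zero)
    then have "t = 0" by (intro killing_nondegenerate) (simp add: killing_def central)
    with assms(2) show False by simp
  qed
  with that show thesis by blast
qed

text \<open>If \<open>\<beta>\<close> vanished on \<open>?t\<close>, then \<open>?t\<close> would
  act on a whole \<open>\<beta>\<close>-string through some \<open>\<gamma>\<close> by the same
  nonzero scalar \<open>\<gamma> ?t\<close>. Descending from the top of that string, the factors are
  the positive multiples of this scalar, so the descent would never end.\<close>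

theorem root_dual_vec_nonzero:
  assumes \<beta>: "\<beta> \<in> roots h"
  shows "\<beta> (dual_vec \<beta>) \<noteq> 0"
proof
  let ?t = "dual_vec \<beta>"
  assume zero: "\<beta> ?t = 0"
  obtain \<gamma> where \<gamma>: "\<gamma> \<in> roots h" "\<gamma> ?t \<noteq> 0"
    using exists_root_not_vanishing[OF dual_vec_in_h dual_vec_nonzero] \<beta> by blast
  obtain H where H: "H \<in> h" "\<beta> H \<noteq> 0" using root_nonzero[OF \<beta>] by blast
  let ?v = "\<lambda>j. (lie (E \<beta>) ^^ j) (E \<gamma>)"
  have "\<exists>j. ?v j = 0"
    by (rule ladder_reaches_zero[of H _ "\<gamma> H" _ "\<beta> H"]) (use \<beta> \<gamma> H lie_E in auto)
  \<comment> \<open>\<open>k\<close> is positive since \<open>E \<gamma>\<close> is nonzero; its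
    predecessor \<open>l\<close> marks the top of the string.\<close>
  define k where "k = (LEAST j. ?v j = 0)"
  have k: "?v k = 0" "\<And>j. j < k \<Longrightarrow> ?v j \<noteq> 0"
    using LeastI_ex[OF \<open>\<exists>j. ?v j = 0\<close>] not_less_Least by (auto simp: k_def)
  then obtain l where l: "k = Suc l" using E_nonzero[OF \<gamma>(1)] by (cases k) auto
  have eig: "lie K (?v j) = (\<gamma> K + of_nat j * \<beta> K) *\<^sub>C ?v j" if "K \<in> h" for j K
  proof (induction j)
    case (Suc j)
    have "lie K (?v (Suc j)) = (\<beta> K + (\<gamma> K + of_nat j * \<beta> K)) *\<^sub>C ?v (Suc j)"
      using Suc lie_derivation[of K "E \<beta>" "?v j"] unfolding scaleC_add_left
      by (simp add: lie_E \<beta> that lie_scaleC_left lie_scaleC_right lie_add_right)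
    then show ?case by (simp add: algebra_simps)
  qed (simp add: lie_E \<gamma> that)
  show False
  proof (rule no_infinite_ladder[of "E \<beta>" "E (- \<beta>)" ?t "?v l" "\<gamma> ?t" 0 H])
    show "lie (E \<beta>) (E (- \<beta>)) = ?t" by (simp add: dual_vec_def)
    show "?v l \<noteq> 0" "lie (E \<beta>) (?v l) = 0" using k l by auto
    show "lie ?t (?v l) = \<gamma> ?t *\<^sub>C ?v l" using eig[of ?t l] \<beta> zero by simp
    show "lie ?t (E (- \<beta>)) = - 0 *\<^sub>C E (- \<beta>)" using lie_E[of "- \<beta>" ?t] \<beta> zero by simp
    show "lie H (?v l) = (\<gamma> H + of_nat l * \<beta> H) *\<^sub>C ?v l" using eig H(1) by blast
    show "lie H (E (- \<beta>)) = (- \<beta> H) *\<^sub>C E (- \<beta>)" using lie_E_uminus_root \<beta> H(1) by blast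
    show "- \<beta> H \<noteq> 0" using H by simp
    have "(\<Sum>i\<le>j. \<gamma> ?t - of_nat i * 0) = of_nat (Suc j) * \<gamma> ?t" for j by simp
    then show "(\<Sum>i\<le>j. \<gamma> ?t - of_nat i * 0) \<noteq> 0" for j
      using \<gamma>(2) of_nat_neq_0[of j] by (metis mult_eq_0_iff)
  qed
qed

text \<open>Subtract the multiple of \<open>E \<beta>\<close> that \<open>E (- \<beta>)\<close>
  detects. The remainder \<open>w\<close> is annihilated by \<open>E (- \<beta>)\<close>; were it
  nonzero, the string rising from it would be infinite, since its factors are triangular numbers
  times \<open>- \<beta> ?t\<close>.\<close>

theorem root_space_one_dimensional:
  assumes \<beta>: "\<beta> \<in> roots h" and x: "x \<in> root_space h \<beta>"
  shows "x = killing x (E (- \<beta>)) *\<^sub>C E \<beta>"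
proof (rule ccontr)
  assume ne: "x \<noteq> killing x (E (- \<beta>)) *\<^sub>C E \<beta>"
  define w where "w = x - killing x (E (- \<beta>)) *\<^sub>C E \<beta>"
  let ?t = "dual_vec \<beta>"
  obtain H where H: "H \<in> h" "\<beta> H \<noteq> 0" using root_nonzero[OF \<beta>] by blast
  have eig: "lie K w = \<beta> K *\<^sub>C w" if "K \<in> h" for K
    using x \<beta> that lie_E[OF \<beta>, of K]
    by (simp add: w_def root_space_def lie_bilinear cvs.scale_right_diff_distrib mult.commute)
  have "killing w (E (- \<beta>)) = 0" by (simp add: w_def killing_bilinear killing_E[OF \<beta>])
  then have orth: "lie w (E (- \<beta>)) = 0"
    using lie_opposite_root_spaces[OF \<beta>, of w "E (- \<beta>)"] eig E_in_root_space[of "- \<beta>"] \<beta>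
    by (simp add: root_space_def)
  have sum: "(\<Sum>i\<le>j. - \<beta> ?t - of_nat i * \<beta> ?t) = - (of_nat (Suc j) * of_nat (Suc (Suc j)) / 2) * \<beta> ?t" for j
    by (induction j) (simp_all add: field_simps)
  show False
  proof (rule no_infinite_ladder[of "E (- \<beta>)" "E \<beta>" "- ?t" w "- \<beta> ?t" "\<beta> ?t" H])
    show "lie (E (- \<beta>)) (E \<beta>) = - ?t" unfolding dual_vec_def by (rule lie_anticommute)
    show "w \<noteq> 0" using ne by (simp add: w_def)
    show "lie (E (- \<beta>)) w = 0" using orth lie_anticommute[of "E (- \<beta>)" w] by simp
    show "lie (- ?t) w = - \<beta> ?t *\<^sub>C w" "lie (- ?t) (E \<beta>) = - \<beta> ?t *\<^sub>C E \<beta>"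
      using eig[of ?t] lie_E[of \<beta> ?t] \<beta> by (simp_all add: lie_minus_left)
    show "lie H w = \<beta> H *\<^sub>C w" "lie H (E \<beta>) = \<beta> H *\<^sub>C E \<beta>" "\<beta> H \<noteq> 0"
      using eig lie_E \<beta> H by auto
    show "(\<Sum>i\<le>j. - \<beta> ?t - of_nat i * \<beta> ?t) \<noteq> 0" for j
      unfolding sum using root_dual_vec_nonzero[OF \<beta>] of_nat_neq_0[of j, where 'a = complex]
        of_nat_neq_0[of "Suc j", where 'a = complex] by (simp del: of_nat_Suc)
  qed
qed

section \<open>Expansion into a Cartan part and root vectors\<close>

definition h_part :: "'g \<Rightarrow> 'g"
  where "h_part x = x - (\<Sum>\<beta>\<in>roots h. killing x (E (- \<beta>)) *\<^sub>C E \<beta>)"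

lemma h_part_add: "h_part (x + y) = h_part x + h_part y"
  by (simp add: h_part_def killing_add_left scaleC_add_left sum.distrib algebra_simps)

lemma h_part_scale: "h_part (c *\<^sub>C x) = c *\<^sub>C h_part x"
  by (simp add: h_part_def killing_scale_left scaleC_scaleC cvs.scale_right_diff_distrib cvs.scale_sum_right)

lemma root_expansion: "h_part x + (\<Sum>\<beta>\<in>roots h. killing x (E (- \<beta>)) *\<^sub>C E \<beta>) = x"
  by (simp add: h_part_def)

lemma h_part_h [simp]: "H \<in> h \<Longrightarrow> h_part H = H"
  by (simp add: h_part_def)

lemma uminus_root_eq_iff: "- \<beta> = - \<gamma> \<longleftrightarrow> \<beta> = (\<gamma> :: 'g \<Rightarrow> complex)"
  by (metis minus_minus_root)

lemma sum_killing_E: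
  assumes "\<gamma> \<in> roots h"
  shows "(\<Sum>\<beta>\<in>roots h. killing (E \<gamma>) (E (- \<beta>)) *\<^sub>C (f \<beta> :: 'b::complex_lie_algebra)) = f \<gamma>"
proof -
  have "(\<Sum>\<beta>\<in>roots h. killing (E \<gamma>) (E (- \<beta>)) *\<^sub>C f \<beta>) = (\<Sum>\<beta>\<in>roots h. if \<beta> = \<gamma> then f \<beta> else 0)"
    using assms by (intro sum.cong refl) (auto simp: killing_E_E uminus_root_eq_iff scaleC_one)
  then show ?thesis using finite_roots assms by simp
qed

lemma h_part_E [simp]: "\<gamma> \<in> roots h \<Longrightarrow> h_part (E \<gamma>) = 0"
  by (simp add: h_part_def sum_killing_E)

text \<open>The map \<open>h_part\<close> fixes \<open>h\<close> and, root spaces being lines, kills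
  every root space; together these span.\<close>

lemma h_part_in_h [simp]: "h_part x \<in> h"
proof -
  have "x \<in> cvs.span (h \<union> (\<Union>\<beta>\<in>roots h. root_space h \<beta>))" by (simp add: span_weight_vectors)
  then show ?thesis
  proof (induction rule: cvs.span_induct_alt)
    case base
    show ?case using h_part_scale[of 0 0] h_closed(1) by simp
  next
    case (step c x y)
    have "h_part x \<in> h"
    proof (cases "x \<in> h")
      case False
      then obtain \<beta> where \<beta>: "\<beta> \<in> roots h" "x \<in> root_space h \<beta>" using step by blast
      then have "h_part x = killing x (E (- \<beta>)) *\<^sub>C h_part (E \<beta>)"
        using root_space_one_dimensional h_part_scale by metis
      then show ?thesis using \<beta>(1) h_closed(1) by simp
    qed simp
    then show ?case using step h_closed by (simp add: h_part_add h_part_scale)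
  qed
qed

lemma zero_on_generators:
  fixes f :: "'g \<Rightarrow> complex"
  assumes "\<And>x y. f (x + y) = f x + f y" "\<And>c x. f (c *\<^sub>C x) = c * f x"
    and "\<And>H. H \<in> h \<Longrightarrow> f H = 0" "\<And>\<beta>. \<beta> \<in> roots h \<Longrightarrow> f (E \<beta>) = 0"
  shows "f x = 0"
proof -
  have "f 0 = 0" using assms(3) h_closed(1) by blast
  then have "f (\<Sum>i\<in>I. y i) = (\<Sum>i\<in>I. f (y i))" for I and y :: "('g \<Rightarrow> complex) \<Rightarrow> 'g"
    by (induction I rule: infinite_finite_induct) (simp_all add: assms(1))
  then have "f (h_part x + (\<Sum>\<beta>\<in>roots h. killing x (E (- \<beta>)) *\<^sub>C E \<beta>)) = 0"
    by (simp add: assms)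
  then show ?thesis by (simp only: root_expansion)
qed

end

section \<open>Tensors as operators\<close>

lemma linear_scaleC_timesI:
  assumes "\<And>x y. f (x + y) = f x + f y" "\<And>c x. f (c *\<^sub>C x) = c * f x"
  shows "Vector_Spaces.linear scaleC (*) (f :: 'g::complex_lie_algebra \<Rightarrow> complex)"
  by unfold_locales (simp_all add: assms algebra_simps)

lemma pairing_ldual_of:
  assumes "\<And>x y. f (x + y) = f x + f y" "\<And>c x. f (c *\<^sub>C x) = c * f x"
  shows "pairing (ldual_of f) = (f :: 'g::complex_lie_algebra \<Rightarrow> complex)"
  using linear_scaleC_timesI[OF assms] by (simp add: ldual_of_inverse)

lemma pairing_add: "pairing \<xi> (x + y) = pairing \<xi> x + pairing \<xi> y"
  and pairing_scale: "pairing \<xi> (c *\<^sub>C x) = c * pairing \<xi> x"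
proof -
  interpret Vector_Spaces.linear scaleC "(*)" "pairing \<xi>" using pairing[of \<xi>] by simp
  show "pairing \<xi> (x + y) = pairing \<xi> x + pairing \<xi> y" "pairing \<xi> (c *\<^sub>C x) = c * pairing \<xi> x"
    by (rule add, rule scale)
qed

lemma pairing_zero [simp]: "pairing \<xi> 0 = 0"
  using pairing_scale[of \<xi> 0 0] by simp

lemma pairing_sum: "pairing \<xi> (\<Sum>i\<in>I. f i) = (\<Sum>i\<in>I. pairing \<xi> (f i))"
  by (induction I rule: infinite_finite_induct) (simp_all add: pairing_add)

lemma pairing_coord [simp]: "pairing (coord b) x = coordinate x b"
  unfolding coord_def by (subst pairing_ldual_of) (simp_all add: coordinate_add coordinate_scale)

definition killing_flat :: "'g::complex_lie_algebra \<Rightarrow> 'g ldual"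
  where "killing_flat x = ldual_of (killing x)"

lemma pairing_killing_flat [simp]: "pairing (killing_flat x) y = killing x y"
  unfolding killing_flat_def
  by (subst pairing_ldual_of) (simp_all add: killing_bilinear)

text \<open>The type of tensors also contains functions that are not bilinear; those equal to their
  expansion in the fixed basis are the genuine tensors.\<close>

definition tensorial :: "'g::complex_lie_algebra tensor2 \<Rightarrow> bool"
  where "tensorial T \<longleftrightarrow> (\<forall>\<xi> \<eta>. T \<xi> \<eta> =
    (\<Sum>b\<in>lie_basis. \<Sum>c\<in>lie_basis. coef T b c * (pairing \<xi> b * pairing \<eta> c)))"

lemma tensorialD:
  "tensorial T \<Longrightarrow> T \<xi> \<eta> = (\<Sum>b\<in>lie_basis. \<Sum>c\<in>lie_basis. coef T b c * (pairing \<xi> b * pairing \<eta> c))"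
  by (simp add: tensorial_def)

lemma pairing_in_coordinates: "pairing \<xi> x = (\<Sum>b\<in>lie_basis. coordinate x b * pairing \<xi> b)"
proof -
  have "pairing \<xi> x = pairing \<xi> (\<Sum>b\<in>lie_basis. coordinate x b *\<^sub>C b)" by (simp only: sum_coordinate)
  then show ?thesis by (simp only: pairing_sum pairing_scale)
qed

lemma tensorial_tensor2: "tensorial (tensor2 x y)"
  unfolding tensorial_def
proof (intro allI)
  fix \<xi> \<eta>
  show "tensor2 x y \<xi> \<eta> = (\<Sum>b\<in>lie_basis. \<Sum>c\<in>lie_basis. coef (tensor2 x y) b c * (pairing \<xi> b * pairing \<eta> c))"
    unfolding tensor2_def coef_def pairing_in_coordinates[of \<xi> x] pairing_in_coordinates[of \<eta> y] sum_product
    by (simp add: mult_ac)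
qed

lemma tensorial_diff:
  assumes "tensorial S" "tensorial T" shows "tensorial (\<lambda>\<xi> \<eta>. S \<xi> \<eta> - T \<xi> \<eta>)"
  unfolding tensorial_def
proof (intro allI)
  fix \<xi> \<eta>
  show "S \<xi> \<eta> - T \<xi> \<eta> = (\<Sum>b\<in>lie_basis. \<Sum>d\<in>lie_basis. coef (\<lambda>\<xi> \<eta>. S \<xi> \<eta> - T \<xi> \<eta>) b d * (pairing \<xi> b * pairing \<eta> d))"
    using tensorialD[OF assms(1), of \<xi> \<eta>] tensorialD[OF assms(2), of \<xi> \<eta>]
    by (simp add: coef_def left_diff_distrib sum_subtractf)
qed

lemma tensorial_sum:
  assumes "\<And>i. i \<in> I \<Longrightarrow> tensorial (T i)" shows "tensorial (\<lambda>\<xi> \<eta>. \<Sum>i\<in>I. T i \<xi> \<eta>)"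
  unfolding tensorial_def
proof (intro allI)
  fix \<xi> \<eta>
  have "(\<Sum>i\<in>I. T i \<xi> \<eta>) = (\<Sum>i\<in>I. \<Sum>b\<in>lie_basis. \<Sum>c\<in>lie_basis. coef (T i) b c * (pairing \<xi> b * pairing \<eta> c))"
    by (intro sum.cong refl tensorialD assms)
  also have "\<dots> = (\<Sum>b\<in>lie_basis. \<Sum>c\<in>lie_basis. \<Sum>i\<in>I. coef (T i) b c * (pairing \<xi> b * pairing \<eta> c))"
    by (subst sum.swap) (intro sum.cong refl sum.swap)
  finally show "(\<Sum>i\<in>I. T i \<xi> \<eta>) = (\<Sum>b\<in>lie_basis. \<Sum>c\<in>lie_basis. coef (\<lambda>\<xi> \<eta>. \<Sum>i\<in>I. T i \<xi> \<eta>) b c * (pairing \<xi> b * pairing \<eta> c))"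
    by (simp add: coef_def sum_distrib_right)
qed

lemma tensorial_wedge2: "tensorial (wedge2 x y)"
  unfolding wedge2_def by (intro tensorial_diff tensorial_tensor2)

lemma wedge2_antisymmetric: "wedge2 x y \<eta> \<xi> = - wedge2 x y \<xi> \<eta>"
  by (simp add: wedge2_def tensor2_def)

lemma bivector_tensorial: "T \<in> bivectors \<Longrightarrow> tensorial T"
  by (auto simp: bivectors_def intro: tensorial_sum tensorial_wedge2)

lemma bivector_antisymmetric: "T \<in> bivectors \<Longrightarrow> T \<eta> \<xi> = - T \<xi> \<eta>"
  by (auto simp: bivectors_def wedge2_antisymmetric[of _ _ \<eta> \<xi>] sum_negf)

lemma bivector_sum_wedge2:
  assumes "finite I" shows "(\<lambda>\<xi> \<eta>. \<Sum>i\<in>I. c i * wedge2 (x i) (y i) \<xi> \<eta>) \<in> bivectors"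
proof -
  obtain f where f: "bij_betw f {..<card I} I"
    using assms by (metis lessThan_atLeast0 ex_bij_betw_nat_finite)
  have "(\<lambda>\<xi> \<eta>. \<Sum>i\<in>I. c i * wedge2 (x i) (y i) \<xi> \<eta>)
      = (\<lambda>\<xi> \<eta>. \<Sum>j<card I. wedge2 (c (f j) *\<^sub>C x (f j)) (y (f j)) \<xi> \<eta>)"
    unfolding sum.reindex_bij_betw[OF f, symmetric]
    by (simp add: wedge2_def tensor2_def pairing_scale algebra_simps)
  then show ?thesis
    unfolding bivectors_def
    by (intro CollectI exI[of _ "card I"] exI[of _ "\<lambda>j. c (f j) *\<^sub>C x (f j)"] exI[of _ "\<lambda>j. y (f j)"])
qed

lemma pairing_sharp:
  assumes "tensorial T" shows "pairing \<xi> (sharp T \<eta>) = T \<xi> \<eta>"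
proof -
  have coordT: "T (coord b) \<eta> = (\<Sum>c\<in>lie_basis. coef T b c * pairing \<eta> c)" if b: "b \<in> lie_basis" for b
  proof -
    have "T (coord b) \<eta> = (\<Sum>b'\<in>lie_basis. \<Sum>c\<in>lie_basis. coef T b' c * (coordinate b' b * pairing \<eta> c))"
      using tensorialD[OF assms, of "coord b" \<eta>] by simp
    also have "\<dots> = (\<Sum>b'\<in>lie_basis. if b' = b then (\<Sum>c\<in>lie_basis. coef T b' c * pairing \<eta> c) else 0)"
      by (intro sum.cong refl) (auto simp: coordinate_basis)
    finally show ?thesis using b by (simp add: lie_basis)
  qed
  show ?thesis
    unfolding sharp_def pairing_sum pairing_scale tensorialD[OF assms, of \<xi> \<eta>]
    by (intro sum.cong refl) (simp add: coordT sum_distrib_left sum_distrib_right mult_ac)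
qed

definition bivector_op :: "'g::complex_lie_algebra tensor2 \<Rightarrow> 'g \<Rightarrow> 'g"
  where "bivector_op T y = sharp T (killing_flat y)"

lemma killing_bivector_op:
  "tensorial T \<Longrightarrow> killing x (bivector_op T y) = T (killing_flat x) (killing_flat y)"
  unfolding bivector_op_def by (simp flip: pairing_killing_flat add: pairing_sharp)

context root_data
begin

section \<open>The terms of the dynamical equation as expressions in operators\<close>

lemma killing_eqI:
  assumes "\<And>z. killing z x = killing z y" shows "x = (y::'g)"
proof -
  have "x - y = 0"
    by (rule killing_nondegenerate) (metis assms killing_commute killing_diff_left right_minus_eq)
  then show ?thesis by simp
qed

lemma pairing_eqI:
  assumes "\<And>\<xi>. pairing \<xi> x = pairing \<xi> y" shows "x = (y::'g)"
  by (rule killing_eqI) (metis assms pairing_killing_flat)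

lemma bivector_op_expansion:
  assumes "tensorial T"
  shows "bivector_op T (y::'g) = (\<Sum>b\<in>lie_basis. \<Sum>c\<in>lie_basis. (coef T b c * killing y c) *\<^sub>C b)"
  by (rule pairing_eqI)
    (simp add: bivector_op_def pairing_sharp[OF assms] tensorialD[OF assms] pairing_sum pairing_scale mult_ac)

lemma bivector_op_add: "tensorial T \<Longrightarrow> bivector_op T (x + y :: 'g) = bivector_op T x + bivector_op T y"
  by (simp add: bivector_op_expansion killing_add_left distrib_left scaleC_add_left sum.distrib)

lemma bivector_op_scale: "tensorial T \<Longrightarrow> bivector_op T (c *\<^sub>C x :: 'g) = c *\<^sub>C bivector_op T x"
  by (simp add: bivector_op_expansion killing_scale_left cvs.scale_sum_right scaleC_scaleC mult_ac)

text \<open>Invariance of the Killing form moves the bracket from the second tensor factor to the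
  argument \<open>y\<close>, with a sign. Weight zero therefore means that the operator commutes
  with the action of \<open>h\<close>.\<close>

lemma ad_tensor2_eq:
  assumes "tensorial T"
  shows "ad_tensor2 H T \<xi> (killing_flat y)
    = pairing \<xi> (lie H (bivector_op T y)) - pairing \<xi> (bivector_op T (lie H (y::'g)))"
proof -
  have inv: "killing y (lie H c) = - killing (lie H y) c" for c
    by (metis killing_invariant killing_minus_left lie_anticommute)
  show ?thesis
    unfolding ad_tensor2_def bivector_op_expansion[OF assms] tensor2_def
    by (simp add: lie_sum_right lie_scaleC_right pairing_sum pairing_scale inv algebra_simps sum_subtractf sum.distrib)
qed

lemma sum_antisymmetric_swap:
  assumes "\<And>b c. k b c = - (k c b :: complex)"
  shows "(\<Sum>b\<in>B. \<Sum>c\<in>B. k b c * F c b) = - (\<Sum>b\<in>B. \<Sum>c\<in>B. k b c * F b c)"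
proof -
  have "(\<Sum>b\<in>B. \<Sum>c\<in>B. k b c * F c b) = (\<Sum>b\<in>B. \<Sum>c\<in>B. k c b * F b c)" by (rule sum.swap)
  also have "\<dots> = (\<Sum>b\<in>B. \<Sum>c\<in>B. - (k b c * F b c))"
  proof (intro sum.cong refl)
    show "k c b * F b c = - (k b c * F b c)" for b c using assms[of c b] by simp
  qed
  finally show ?thesis by (simp add: sum_negf)
qed

text \<open>Antisymmetry of the coefficients makes the four terms of
  \<open>schouten_decomposable\<close> contribute equally, which cancels the factor 1/4; the six
  terms of \<open>wedge3\<close> then pair up into three, whence the factor 2.\<close>

lemma schouten_self:
  assumes T: "tensorial T" and anti: "\<And>\<xi> \<eta>. T \<eta> \<xi> = - T \<xi> \<eta>"
  defines "R \<equiv> bivector_op T"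
  shows "schouten T T (killing_flat x) (killing_flat y) (killing_flat z)
    = 2 * (killing x (lie (R y) (R z)) + killing y (lie (R z) (R x)) + killing z (lie (R x) (R (y::'g))))"
proof -
  let ?B = "lie_basis :: 'g set" and ?k = "coef T"
  have k: "?k b c = - ?k c b" for b c unfolding coef_def by (rule anti)
  define G where "G p q r s = wedge3 (lie p q) r s (killing_flat x) (killing_flat y) (killing_flat z)"
    for p q r s
  define Q where "Q F = (\<Sum>a\<in>?B. \<Sum>b\<in>?B. ?k a b * (\<Sum>c\<in>?B. \<Sum>d\<in>?B. ?k c d * F a b c d))" for F :: "'g \<Rightarrow> 'g \<Rightarrow> 'g \<Rightarrow> 'g \<Rightarrow> complex"
  have swap1: "Q (\<lambda>a b c d. F b a c d) = - Q F" for F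
    unfolding Q_def using sum_antisymmetric_swap[OF k, where F = "\<lambda>a b. \<Sum>c\<in>?B. \<Sum>d\<in>?B. ?k c d * F a b c d"] by simp
  have swap2: "Q (\<lambda>a b c d. F a b d c) = - Q F" for F
    unfolding Q_def by (subst sum_antisymmetric_swap[OF k]) (simp add: sum_negf)
  have lin: "Q (\<lambda>a b c d. F a b c d + F' a b c d) = Q F + Q F'" "Q (\<lambda>a b c d. F a b c d - F' a b c d) = Q F - Q F'"
    for F F'
    by (simp_all add: Q_def distrib_left right_diff_distrib sum.distrib sum_subtractf)
  have "schouten T T (killing_flat x) (killing_flat y) (killing_flat z)
      = 1/4 * Q (\<lambda>a b c d. G a c b d - G a d b c - G b c a d + G b d a c)"
    unfolding schouten_def schouten_decomposable_def Q_def G_def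
    by (simp add: sum_distrib_left sum_distrib_right mult_ac)
  also have "Q (\<lambda>a b c d. G a c b d - G a d b c - G b c a d + G b d a c)
      = Q (\<lambda>a b c d. G a c b d) - Q (\<lambda>a b c d. G a d b c) - Q (\<lambda>a b c d. G b c a d) + Q (\<lambda>a b c d. G b d a c)"
    by (simp only: lin)
  also have "\<dots> = 4 * Q (\<lambda>a b c d. G a c b d)"
    using swap2[of "\<lambda>a b c d. G a c b d"] swap1[of "\<lambda>a b c d. G a c b d"] swap1[of "\<lambda>a b c d. G a d b c"]
    by simp
  finally have 1: "schouten T T (killing_flat x) (killing_flat y) (killing_flat z)
      = Q (\<lambda>a b c d. G a c b d)" by simp
  define g where "g x y z = Q (\<lambda>a b c d. killing x (lie a c) * killing y b * killing z d)" for x y z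
  have g: "g x y z = killing x (lie (R y) (R z))" for x y z
  proof -
    have "killing x (lie (R y) (R z)) = (\<Sum>a\<in>?B. \<Sum>b\<in>?B. \<Sum>c\<in>?B. \<Sum>d\<in>?B.
        (?k a b * killing y b) * ((?k c d * killing z d) * killing x (lie a c)))"
      unfolding R_def bivector_op_expansion[OF T] lie_sum_left
      unfolding lie_sum_right killing_sum_right lie_scaleC_left lie_scaleC_right killing_scale_right
      by (simp add: mult_ac)
    then show ?thesis unfolding g_def Q_def by (simp add: sum_distrib_left mult_ac)
  qed
  have Geq: "G a c b d = killing x (lie a c) * killing y b * killing z d
      + killing z (lie a c) * killing x b * killing y d + killing y (lie a c) * killing z b * killing x d
      - killing y (lie a c) * killing x b * killing z d - killing x (lie a c) * killing z b * killing y d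
      - killing z (lie a c) * killing y b * killing x d" for a b c d
    unfolding G_def wedge3_def tensor3_def by (simp add: mult_ac)
  have "Q (\<lambda>a b c d. G a c b d) = g x y z + g z x y + g y z x - g y x z - g x z y - g z y x"
    unfolding Geq lin g_def ..
  also have "\<dots> = 2 * (g x y z + g y z x + g z x y)"
    unfolding g using killing_lie_swap[of x "R y"] killing_lie_swap[of y "R z"] killing_lie_swap[of z "R x"] by simp
  finally show ?thesis using 1 by (simp add: g)
qed

text \<open>The preimage is assembled from the simple root coefficients of \<open>\<xi>\<close> on
  \<open>h\<close> and from its values on the opposite root vectors. Hence tensor identities need
  only be tested on arguments of the form \<open>killing_flat x\<close>.\<close>

lemma killing_flat_surj: "\<exists>x::'g. \<xi> = killing_flat x"
proof -
  have "(\<lambda>H. if H \<in> h then pairing \<xi> H else 0) \<in> hstar h"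
    by (auto simp: hstar_def pairing_add pairing_scale h_closed)
  then obtain c where c: "(\<lambda>H. if H \<in> h then pairing \<xi> H else 0) = (\<lambda>x. \<Sum>i\<in>UNIV. c i * \<alpha> i x)"
    using simple_roots unfolding simple_roots_def by blast
  define x where "x = (\<Sum>i\<in>UNIV. c i *\<^sub>C dual_vec (\<alpha> i)) + (\<Sum>\<beta>\<in>roots h. pairing \<xi> (E (- \<beta>)) *\<^sub>C E \<beta>)"
  have xh: "(\<Sum>i\<in>UNIV. c i *\<^sub>C dual_vec (\<alpha> i)) \<in> h"
    by (intro cvs.subspace_sum[OF h_subspace] h_closed dual_vec_in_h simple_root)
  have "killing x y - pairing \<xi> y = 0" for y
  proof (rule zero_on_generators)
    fix H assume H: "H \<in> h"
    have "pairing \<xi> H = (\<Sum>i\<in>UNIV. c i * \<alpha> i H)" using fun_cong[OF c, of H] H by simp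
    moreover have "killing x H = (\<Sum>i\<in>UNIV. c i * \<alpha> i H)"
      using H by (simp add: x_def killing_bilinear killing_sum_left killing_commute[of "dual_vec _"] killing_dual_vec simple_root)
    ultimately show "killing x H - pairing \<xi> H = 0" by simp
  next
    fix \<gamma> assume \<gamma>: "\<gamma> \<in> roots h"
    have "killing x (E \<gamma>) = (\<Sum>\<beta>\<in>roots h. pairing \<xi> (E (- \<beta>)) * killing (E \<beta>) (E \<gamma>))"
      using xh \<gamma> by (simp add: x_def killing_bilinear killing_sum_left[of _ "roots h"])
    also have "\<dots> = (\<Sum>\<beta>\<in>roots h. if \<beta> = - \<gamma> then pairing \<xi> (E \<gamma>) else 0)"
      using \<gamma> by (intro sum.cong refl) (auto simp: killing_E_E)
    also have "\<dots> = pairing \<xi> (E \<gamma>)" using \<gamma> by (simp add: finite_roots)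
    finally show "killing x (E \<gamma>) - pairing \<xi> (E \<gamma>) = 0" by simp
  qed (simp_all add: killing_bilinear pairing_add pairing_scale algebra_simps)
  then have "pairing \<xi> = pairing (killing_flat x)" by (simp add: fun_eq_iff)
  then show ?thesis by (metis pairing_inject)
qed

lemma killing_killing_dual:
  assumes "b \<in> lie_basis"
  shows "killing x (killing_dual b) = coordinate x (b::'g)"
proof -
  obtain y :: 'g where y: "coord b = killing_flat y" using killing_flat_surj by blast
  then have yx: "killing y x = coordinate x b" for x by (metis pairing_coord pairing_killing_flat)
  have "killing_dual b = y"
    unfolding killing_dual_def
  proof (rule the_equality)
    show "\<forall>c\<in>lie_basis. killing y c = (if c = b then 1 else 0)" by (auto simp: yx coordinate_basis)
    fix w assume w: "\<forall>c\<in>lie_basis. killing w c = (if c = b then 1 else 0)"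
    have wy: "killing w x = killing y x" for x
    proof -
      have "killing w (\<Sum>c\<in>lie_basis. coordinate x c *\<^sub>C c) = killing y (\<Sum>c\<in>lie_basis. coordinate x c *\<^sub>C c)"
        unfolding killing_sum_right killing_scale_right
        by (intro sum.cong refl) (use w in \<open>auto simp: yx coordinate_basis\<close>)
      then show ?thesis by (simp only: sum_coordinate)
    qed
    show "w = y"
      by (rule killing_eqI) (simp only: killing_commute[of _ w] killing_commute[of _ y] wy)
  qed
  then show ?thesis using yx killing_commute by metis
qed

lemma casimir_eq: "casimir (killing_flat x) (killing_flat y) = killing x (y::'g)"
proof -
  have "casimir (killing_flat x) (killing_flat y) = killing x (\<Sum>b\<in>lie_basis. coordinate y b *\<^sub>C b)"
    by (simp add: casimir_def tensor2_def killing_killing_dual killing_sum_right killing_scale_right mult.commute)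
  then show ?thesis by (simp only: sum_coordinate)
qed

lemma tensorial_casimir: "tensorial (casimir :: 'g tensor2)"
  unfolding casimir_def by (intro tensorial_sum tensorial_tensor2)

text \<open>The Casimir element corresponds to the identity operator, so the contraction gives
  \<open>killing y (lie x z)\<close>; the sign comes from rearranging the three arguments.\<close>

lemma bracket_casimir:
  "bracket_12_23 casimir casimir (killing_flat x) (killing_flat y) (killing_flat z)
    = - killing x (lie y (z::'g))"
proof -
  let ?B = "lie_basis :: 'g set" and ?k = "coef (casimir :: 'g tensor2)"
  have T: "tensorial (casimir :: 'g tensor2)" by (rule tensorial_casimir)
  have op: "(\<Sum>b\<in>?B. \<Sum>c\<in>?B. (?k b c * killing z c) *\<^sub>C b) = z" for z
    unfolding bivector_op_expansion[OF T, symmetric]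
    by (rule killing_eqI) (simp add: killing_bivector_op[OF T] casimir_eq)
  have op': "(\<Sum>b\<in>?B. \<Sum>c\<in>?B. (?k b c * killing z b) *\<^sub>C c) = z" for z
  proof (rule killing_eqI)
    fix w
    have "killing w (\<Sum>b\<in>?B. \<Sum>c\<in>?B. (?k b c * killing z b) *\<^sub>C c) = casimir (killing_flat z) (killing_flat w)"
      by (simp add: tensorialD[OF T] killing_sum_right killing_scale_right mult_ac)
    then show "killing w (\<Sum>b\<in>?B. \<Sum>c\<in>?B. (?k b c * killing z b) *\<^sub>C c) = killing w z"
      by (simp add: casimir_eq killing_commute)
  qed
  have "killing y (lie x z) = killing y (lie (\<Sum>b\<in>?B. \<Sum>c\<in>?B. (?k b c * killing x b) *\<^sub>C c)
      (\<Sum>b\<in>?B. \<Sum>c\<in>?B. (?k b c * killing z c) *\<^sub>C b))"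
    by (simp only: op op')
  also have "\<dots> = bracket_12_23 casimir casimir (killing_flat x) (killing_flat y) (killing_flat z)"
    unfolding lie_sum_left bracket_12_23_def
    unfolding lie_sum_right killing_sum_right lie_scaleC_left lie_scaleC_right killing_scale_right
    by (simp add: tensor3_def mult_ac)
  finally show ?thesis by (metis killing_lie_cyclic killing_lie_swap)
qed

text \<open>Antisymmetry merges the six wedge terms into three and absorbs the factor 1/2.\<close>

lemma wedge12_eq:
  fixes T :: "'g tensor2"
  assumes T: "tensorial T" and anti: "\<And>\<xi> \<eta>. T \<eta> \<xi> = - T \<xi> \<eta>"
  shows "wedge12 H T \<xi> \<eta> \<zeta> = pairing \<xi> H * T \<eta> \<zeta> + pairing \<eta> H * T \<zeta> \<xi> + pairing \<zeta> H * T \<xi> \<eta>"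
proof -
  let ?B = "lie_basis :: 'g set" and ?k = "coef T"
  define S where "S F = (\<Sum>b\<in>?B. \<Sum>c\<in>?B. ?k b c * F b c)" for F :: "'g \<Rightarrow> 'g \<Rightarrow> complex"
  have ST: "S (\<lambda>b c. pairing \<xi> b * pairing \<eta> c) = T \<xi> \<eta>" for \<xi> \<eta>
    unfolding S_def tensorialD[OF T, symmetric] ..
  have lin: "S (\<lambda>b c. F b c + F' b c) = S F + S F'" "S (\<lambda>b c. F b c - F' b c) = S F - S F'"
      "S (\<lambda>b c. a * F b c) = a * S F" for F F' :: "'g \<Rightarrow> 'g \<Rightarrow> complex" and a
    by (simp_all add: S_def distrib_left right_diff_distrib sum.distrib sum_subtractf sum_distrib_left mult_ac)
  have "wedge12 H T \<xi> \<eta> \<zeta> = S (\<lambda>b c. 1/2 * (pairing \<xi> H * (pairing \<eta> b * pairing \<zeta> c)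
      + pairing \<zeta> H * (pairing \<xi> b * pairing \<eta> c) + pairing \<eta> H * (pairing \<zeta> b * pairing \<xi> c)
      - pairing \<eta> H * (pairing \<xi> b * pairing \<zeta> c) - pairing \<xi> H * (pairing \<zeta> b * pairing \<eta> c)
      - pairing \<zeta> H * (pairing \<eta> b * pairing \<xi> c)))"
    unfolding wedge12_def S_def wedge3_def tensor3_def
    by (intro sum.cong refl) (simp add: algebra_simps)
  also have "\<dots> = pairing \<xi> H * T \<eta> \<zeta> + pairing \<eta> H * T \<zeta> \<xi> + pairing \<zeta> H * T \<xi> \<eta>"
    unfolding lin ST using anti[of \<eta> \<zeta>] anti[of \<xi> \<zeta>] anti[of \<xi> \<eta>] anti[of \<zeta> \<xi>] by (simp add: field_simps)
  finally show ?thesis .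
qed

section \<open>Coordinates on the dual of the Cartan subalgebra\<close>

abbreviation "hv \<equiv> hvec \<alpha> E"
abbreviation "hvd \<equiv> hvec_dual h \<alpha> E"
abbreviation "pt \<equiv> hstar_point h \<alpha> E"

lemma hvec_eq: "hv i = dual_vec (\<alpha> i)"
  by (simp add: hvec_def dual_vec_def)

lemma hvec_in_h [simp]: "hv i \<in> h"
  by (simp add: hvec_eq simple_root)

lemma hstar_lincomb:
  assumes "\<And>i. i \<in> I \<Longrightarrow> f i \<in> hstar h" shows "(\<lambda>x. \<Sum>i\<in>I. c i * f i x) \<in> hstar h"
  using assms by (auto simp: hstar_def sum.distrib distrib_left sum_distrib_left mult_ac)

lemma simple_roots_basis:
  assumes "\<phi> \<in> hstar h" shows "\<exists>!c. \<phi> = (\<lambda>x. \<Sum>i\<in>UNIV. c i * \<alpha> i x)"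
  using simple_roots assms unfolding simple_roots_def by blast

lemma simple_roots_coeffs_unique:
  assumes "\<And>H. H \<in> h \<Longrightarrow> (\<Sum>i\<in>UNIV. c i * \<alpha> i H) = (\<Sum>i\<in>UNIV. d i * \<alpha> i H)"
  shows "c = d"
proof -
  have *: "(\<lambda>x. \<Sum>i\<in>UNIV. c i * \<alpha> i x) \<in> hstar h" for c
    by (intro hstar_lincomb rootD(1) simple_root)
  have "(\<lambda>x. \<Sum>i\<in>UNIV. c i * \<alpha> i x) = (\<lambda>x. \<Sum>i\<in>UNIV. d i * \<alpha> i x)"
    by (rule hstar_eqI[OF * *]) (rule assms)
  then show ?thesis using simple_roots_basis[OF *[of c]] by blast
qed

definition hvec_coeffs :: "'g \<Rightarrow> 'n \<Rightarrow> complex"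
  where "hvec_coeffs H = (THE c. H = (\<Sum>i\<in>UNIV. c i *\<^sub>C hv i))"

lemma killing_hvec_sum:
  "H \<in> h \<Longrightarrow> killing H (\<Sum>i\<in>UNIV. c i *\<^sub>C hv i) = (\<Sum>i\<in>UNIV. c i * \<alpha> i H)"
  by (simp add: killing_sum_right killing_scale_right hvec_eq killing_dual_vec simple_root)

lemma hvec_sum_in_h: "(\<Sum>i\<in>UNIV. c i *\<^sub>C hv i) \<in> h"
  by (intro cvs.subspace_sum[OF h_subspace] h_closed) simp

text \<open>The Killing form carries the \<open>hv i\<close> to the simple roots, so the basis
  property of the latter is transferred.\<close>

lemma hvec_basis:
  assumes H: "H \<in> h" shows "\<exists>!c. H = (\<Sum>i\<in>UNIV. c i *\<^sub>C hv i)"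
proof (rule ex_ex1I)
  have "(\<lambda>x. if x \<in> h then killing x H else 0) \<in> hstar h"
    by (auto simp: hstar_def killing_bilinear h_closed)
  then obtain c where c: "(\<lambda>x. if x \<in> h then killing x H else 0) = (\<lambda>x. \<Sum>i\<in>UNIV. c i * \<alpha> i x)"
    using simple_roots_basis by blast
  have "H - (\<Sum>i\<in>UNIV. c i *\<^sub>C hv i) = 0"
  proof (rule killing_nondegenerate_on_h)
    show "H - (\<Sum>i\<in>UNIV. c i *\<^sub>C hv i) \<in> h" by (intro h_closed H hvec_sum_in_h)
    fix K assume K: "K \<in> h"
    then show "killing (H - (\<Sum>i\<in>UNIV. c i *\<^sub>C hv i)) K = 0"
      using fun_cong[OF c, of K] by (simp add: killing_commute[of _ K] killing_diff_right killing_hvec_sum)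
  qed
  then show "\<exists>c. H = (\<Sum>i\<in>UNIV. c i *\<^sub>C hv i)" by auto
next
  fix c d assume "H = (\<Sum>i\<in>UNIV. c i *\<^sub>C hv i)" "H = (\<Sum>i\<in>UNIV. d i *\<^sub>C hv i)"
  then show "c = d" by (intro simple_roots_coeffs_unique) (metis killing_hvec_sum)
qed

lemma hstar_sum_hvec:
  assumes "\<phi> \<in> hstar h" shows "\<phi> (\<Sum>i\<in>I. c i *\<^sub>C hv i) = (\<Sum>i\<in>I. c i * \<phi> (hv i))"
proof (induction I rule: infinite_finite_induct)
  case (insert i I)
  have "(\<Sum>i\<in>I. c i *\<^sub>C hv i) \<in> h" by (intro cvs.subspace_sum[OF h_subspace] h_closed) simp
  then show ?case using insert hstarD[OF assms] h_closed by simp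
qed (use hstarD(2)[OF assms h_closed(1), of 0] in simp_all)

lemma hstar_eqI_hvec:
  assumes "\<phi> \<in> hstar h" "\<psi> \<in> hstar h" "\<And>i. \<phi> (hv i) = \<psi> (hv i)"
  shows "\<phi> = \<psi>"
proof (rule hstar_eqI[OF assms(1,2)])
  fix H assume "H \<in> h"
  then obtain c where "H = (\<Sum>i\<in>UNIV. c i *\<^sub>C hv i)" using hvec_basis by blast
  then show "\<phi> H = \<psi> H"
    using hstar_sum_hvec[OF assms(1)] hstar_sum_hvec[OF assms(2)] by (simp add: assms(3))
qed

text \<open>The coordinate functionals, extended by zero off \<open>h\<close>, witness the definite
  description.\<close>

lemma hvec_dual: "hvd i \<in> hstar h" "hvd i (hv j) = (if j = i then 1 else 0)"
proof -
  have coeffs: "H = (\<Sum>i\<in>UNIV. hvec_coeffs H i *\<^sub>C hv i)" if "H \<in> h" for H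
    using theI'[OF hvec_basis[OF that]] by (simp add: hvec_coeffs_def)
  have coeffs_eq: "hvec_coeffs H = c" if "H = (\<Sum>i\<in>UNIV. c i *\<^sub>C hv i)" for H c
    using hvec_basis[of H] hvec_sum_in_h[of c] coeffs[of H] that by metis
  let ?\<phi> = "\<lambda>x. if x \<in> h then hvec_coeffs x i else 0"
  have add: "hvec_coeffs (a + b) = (\<lambda>i. hvec_coeffs a i + hvec_coeffs b i)" if "a \<in> h" "b \<in> h" for a b
    by (rule coeffs_eq)
      (use coeffs[OF that(1)] coeffs[OF that(2)] in \<open>simp add: scaleC_add_left sum.distrib\<close>)
  have scale: "hvec_coeffs (c *\<^sub>C a) = (\<lambda>i. c * hvec_coeffs a i)" if "a \<in> h" for a c
  proof (rule coeffs_eq)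
    have "c *\<^sub>C a = c *\<^sub>C (\<Sum>i\<in>UNIV. hvec_coeffs a i *\<^sub>C hv i)" using coeffs[OF that] by simp
    then show "c *\<^sub>C a = (\<Sum>i\<in>UNIV. (c * hvec_coeffs a i) *\<^sub>C hv i)"
      by (simp add: cvs.scale_sum_right scaleC_scaleC)
  qed
  have "hvec_coeffs (hv j) = (\<lambda>i. if j = i then 1 else 0)" for j
  proof (rule coeffs_eq)
    have "(\<Sum>i\<in>UNIV. (if j = i then 1 else 0) *\<^sub>C hv i) = (\<Sum>i\<in>UNIV. if i = j then hv i else 0)"
      by (intro sum.cong refl) (auto simp: scaleC_one)
    then show "hv j = (\<Sum>i\<in>UNIV. (if j = i then 1 else 0) *\<^sub>C hv i)" by simp
  qed
  then have "?\<phi> \<in> hstar h \<and> (\<forall>j. ?\<phi> (hv j) = (if j = i then 1 else 0))"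
    by (auto simp: hstar_def add scale h_closed)
  moreover have "\<phi> = \<psi>" if "\<phi> \<in> hstar h \<and> (\<forall>j. \<phi> (hv j) = (if j = i then 1 else 0))"
      "\<psi> \<in> hstar h \<and> (\<forall>j. \<psi> (hv j) = (if j = i then 1 else 0))" for \<phi> \<psi>
    by (rule hstar_eqI_hvec) (use that in auto)
  ultimately have "\<exists>!\<phi>. \<phi> \<in> hstar h \<and> (\<forall>j. \<phi> (hv j) = (if j = i then 1 else 0))"
    by (rule_tac ex_ex1I) blast+
  from theI'[OF this] show "hvd i \<in> hstar h" "hvd i (hv j) = (if j = i then 1 else 0)"
    unfolding hvec_dual_def by blast+
qed

lemma hstar_point_in_hstar [simp]: "pt v \<in> hstar h"
  unfolding hstar_point_def by (intro hstar_lincomb hvec_dual)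

lemma hstar_point_hvec: "pt v (hv i) = v $ i"
proof -
  have "pt v (hv i) = (\<Sum>j\<in>UNIV. if j = i then v $ j else 0)"
    unfolding hstar_point_def by (intro sum.cong refl) (auto simp: hvec_dual)
  then show ?thesis by simp
qed

lemma hstar_point_surj: "\<phi> \<in> hstar h \<Longrightarrow> pt (\<chi> i. \<phi> (hv i)) = \<phi>"
  by (rule hstar_eqI_hvec) (simp_all add: hstar_point_hvec)

text \<open>Turns partial derivatives on the dual of \<open>h\<close> into derivatives along
  coordinate lines.\<close>

lemma hstar_point_shift: "(\<lambda>x. pt v x + t * hvd i x) = pt (v + t *s axis i 1)"
proof -
  have "(\<Sum>j\<in>UNIV. t * axis i 1 $ j * hvd j x) = (\<Sum>j\<in>UNIV. if j = i then t * hvd j x else 0)" for x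
    by (intro sum.cong refl) (auto simp: axis_def)
  then show ?thesis by (auto simp: hstar_point_def distrib_right sum.distrib)
qed

lemma hvec_expansion:
  assumes H: "H \<in> h" shows "(\<Sum>i\<in>UNIV. hvd i H *\<^sub>C hv i) = H"
proof -
  obtain c where c: "H = (\<Sum>i\<in>UNIV. c i *\<^sub>C hv i)" using hvec_basis[OF H] by blast
  have "hvd i H = c i" for i
  proof -
    have "hvd i H = (\<Sum>j\<in>UNIV. if j = i then c j else 0)"
      unfolding c hstar_sum_hvec[OF hvec_dual(1)] by (intro sum.cong refl) (auto simp: hvec_dual)
    then show ?thesis by simp
  qed
  with c show ?thesis by simp
qed

text \<open>These coefficients are the constants of the Riccati equation, one for each coordinate
  direction.\<close>

lemma root_in_simple_roots:
  assumes "\<beta> \<in> roots h" "H \<in> h"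
  shows "\<beta> H = (\<Sum>i\<in>UNIV. hvd i (dual_vec \<beta>) * \<alpha> i H)"
  using killing_dual_vec[OF assms] killing_hvec_sum[OF assms(2), of "\<lambda>i. hvd i (dual_vec \<beta>)"]
    hvec_expansion[OF dual_vec_in_h[OF assms(1)]] by simp

section \<open>Positive roots\<close>

abbreviation "\<Phi>pos \<equiv> positive_roots h \<alpha>"

lemma positive_rootD: "\<beta> \<in> \<Phi>pos \<Longrightarrow> \<beta> \<in> roots h"
  by (simp add: positive_roots_def)

lemma finite_positive_roots: "finite \<Phi>pos"
  using finite_roots positive_rootD by (metis finite_subset subsetI)

lemma roots_eq: "roots h = \<Phi>pos \<union> uminus ` \<Phi>pos"
  using simple_roots by (simp add: simple_roots_def)

lemma uminus_positive_root: assumes "\<beta> \<in> \<Phi>pos" shows "- \<beta> \<notin> \<Phi>pos"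
proof
  assume "- \<beta> \<in> \<Phi>pos"
  with assms obtain k l :: "'n \<Rightarrow> nat" where k: "\<beta> = (\<lambda>x. \<Sum>i\<in>UNIV. of_nat (k i) * \<alpha> i x)"
    and l: "- \<beta> = (\<lambda>x. \<Sum>i\<in>UNIV. of_nat (l i) * \<alpha> i x)"
    by (auto simp: positive_roots_def)
  have "(\<lambda>i. of_nat (k i) + of_nat (l i) :: complex) = (\<lambda>_. 0)"
  proof (rule simple_roots_coeffs_unique)
    fix H
    have "(\<Sum>i\<in>UNIV. of_nat (k i) * \<alpha> i H) = \<beta> H" "(\<Sum>i\<in>UNIV. of_nat (l i) * \<alpha> i H) = - \<beta> H"
      using fun_cong[OF k, of H] fun_cong[OF l, of H] by simp_all
    then show "(\<Sum>i\<in>UNIV. (of_nat (k i) + of_nat (l i)) * \<alpha> i H) = (\<Sum>i\<in>UNIV. 0 * \<alpha> i H)"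
      by (simp add: distrib_right sum.distrib)
  qed
  then have "of_nat (k i + l i) = (0 :: complex)" for i by (simp add: fun_eq_iff)
  then have "k i = 0" for i by (metis add_eq_0_iff_both_eq_0 of_nat_eq_0_iff)
  then have "\<beta> = (\<lambda>_. 0)" using k by simp
  then show False using rootD(2) positive_rootD assms by blast
qed

lemma sum_roots:
  fixes f :: "('g \<Rightarrow> complex) \<Rightarrow> 'b::comm_monoid_add"
  shows "(\<Sum>\<beta>\<in>roots h. f \<beta>) = (\<Sum>\<beta>\<in>\<Phi>pos. f \<beta>) + (\<Sum>\<beta>\<in>\<Phi>pos. f (- \<beta>))"
proof -
  have "\<Phi>pos \<inter> uminus ` \<Phi>pos = {}" using uminus_positive_root by fastforce
  moreover have "(\<Sum>\<beta>\<in>uminus ` \<Phi>pos. f \<beta>) = (\<Sum>\<beta>\<in>\<Phi>pos. f (- \<beta>))"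
    by (subst sum.reindex) (auto simp: inj_on_def uminus_root_eq_iff)
  ultimately show ?thesis unfolding roots_eq using finite_positive_roots by (subst sum.union_disjoint) auto
qed

definition odd_on_roots :: "(('g \<Rightarrow> complex) \<Rightarrow> complex) \<Rightarrow> bool"
  where "odd_on_roots f \<longleftrightarrow> (\<forall>\<beta>\<in>roots h. f (- \<beta>) = - f \<beta>)"

definition root_tensor :: "(('g \<Rightarrow> complex) \<Rightarrow> complex) \<Rightarrow> 'g tensor2"
  where "root_tensor f = (\<lambda>\<xi> \<eta>. \<Sum>\<beta>\<in>\<Phi>pos. f \<beta> * wedge2 (E \<beta>) (E (- \<beta>)) \<xi> \<eta>)"

lemma root_tensor_bivector: "root_tensor f \<in> bivectors"
  unfolding root_tensor_def
  by (rule bivector_sum_wedge2) (rule finite_positive_roots)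

lemmas root_tensor_tensorial = bivector_tensorial[OF root_tensor_bivector]

text \<open>The second half of each wedge product is the term of the negative root, oddness of
  \<open>f\<close> supplying its sign.\<close>

lemma root_tensor_eq:
  assumes "odd_on_roots f"
  shows "root_tensor f \<xi> \<eta> = (\<Sum>\<beta>\<in>roots h. f \<beta> * (pairing \<xi> (E \<beta>) * pairing \<eta> (E (- \<beta>))))"
proof -
  have "(\<Sum>\<beta>\<in>\<Phi>pos. f (- \<beta>) * (pairing \<xi> (E (- \<beta>)) * pairing \<eta> (E (- (- \<beta>)))))
      = (\<Sum>\<beta>\<in>\<Phi>pos. - (f \<beta> * (pairing \<xi> (E (- \<beta>)) * pairing \<eta> (E \<beta>))))"
    using assms positive_rootD by (intro sum.cong refl) (simp add: odd_on_roots_def)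
  then show ?thesis
    unfolding sum_roots root_tensor_def wedge2_def tensor2_def
    by (simp add: right_diff_distrib sum_subtractf sum_negf)
qed

lemma root_tensor_op:
  assumes "odd_on_roots f"
  shows "bivector_op (root_tensor f) y = (\<Sum>\<beta>\<in>roots h. (f \<beta> * killing y (E (- \<beta>))) *\<^sub>C E \<beta>)"
  by (rule killing_eqI)
    (simp add: killing_bivector_op[OF root_tensor_tensorial] root_tensor_eq[OF assms]
      killing_sum_right killing_scale_right mult_ac)

lemma root_tensor_op_h [simp]: "odd_on_roots f \<Longrightarrow> H \<in> h \<Longrightarrow> bivector_op (root_tensor f) H = 0"
  by (simp add: root_tensor_op)

lemma root_tensor_op_E [simp]:
  assumes "odd_on_roots f" "\<gamma> \<in> roots h" shows "bivector_op (root_tensor f) (E \<gamma>) = f \<gamma> *\<^sub>C E \<gamma>"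
proof -
  have "bivector_op (root_tensor f) (E \<gamma>) = (\<Sum>\<beta>\<in>roots h. killing (E \<gamma>) (E (- \<beta>)) *\<^sub>C f \<beta> *\<^sub>C E \<beta>)"
    by (simp add: root_tensor_op[OF assms(1)] scaleC_scaleC mult.commute)
  also have "\<dots> = f \<gamma> *\<^sub>C E \<gamma>" by (rule sum_killing_E[OF assms(2)])
  finally show ?thesis .
qed

text \<open>The scalars by which the operator of \<open>r_zero\<close> acts on the root
  spaces.\<close>

definition root_sign :: "('g \<Rightarrow> complex) \<Rightarrow> complex"
  where "root_sign \<beta> = (if \<beta> \<in> \<Phi>pos then 1 else - 1)"

lemma odd_root_sign: "odd_on_roots root_sign"
  using uminus_positive_root roots_eq by (fastforce simp: odd_on_roots_def root_sign_def)

lemma r_zero_eq: "r_zero h \<alpha> E = root_tensor root_sign"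
  unfolding r_zero_def root_tensor_def by (intro ext sum.cong refl) (simp add: root_sign_def)

section \<open>The Lagrangian subspaces attached to functions on the roots\<close>

definition scale_op :: "(('g \<Rightarrow> complex) \<Rightarrow> complex) \<Rightarrow> 'g \<Rightarrow> 'g"
  where "scale_op f u = h_part u + (\<Sum>\<beta>\<in>roots h. (f \<beta> * killing u (E (- \<beta>))) *\<^sub>C E \<beta>)"

lemma scale_op_add: "scale_op f (u + v) = scale_op f u + scale_op f v"
  by (simp add: scale_op_def h_part_add killing_add_left distrib_left scaleC_add_left sum.distrib algebra_simps)

lemma scale_op_scale: "scale_op f (c *\<^sub>C u) = c *\<^sub>C scale_op f u"
  by (simp add: scale_op_def h_part_scale killing_scale_left scaleC_add_right cvs.scale_sum_right scaleC_scaleC mult_ac)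

lemma scale_op_h [simp]: "H \<in> h \<Longrightarrow> scale_op f H = H"
  by (simp add: scale_op_def)

lemma scale_op_E [simp]: assumes "\<gamma> \<in> roots h" shows "scale_op f (E \<gamma>) = f \<gamma> *\<^sub>C E \<gamma>"
proof -
  have "scale_op f (E \<gamma>) = (\<Sum>\<beta>\<in>roots h. killing (E \<gamma>) (E (- \<beta>)) *\<^sub>C f \<beta> *\<^sub>C E \<beta>)"
    using assms by (simp add: scale_op_def scaleC_scaleC mult.commute)
  also have "\<dots> = f \<gamma> *\<^sub>C E \<gamma>" by (rule sum_killing_E[OF assms])
  finally show ?thesis .
qed

lemma killing_scale_op:
  assumes "\<beta> \<in> roots h" shows "killing (scale_op f u) (E (- \<beta>)) = f \<beta> * killing u (E (- \<beta>))"
proof -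
  have "killing (scale_op f u) (E (- \<beta>)) - f \<beta> * killing u (E (- \<beta>)) = 0"
    by (rule zero_on_generators[of "\<lambda>u. killing (scale_op f u) (E (- \<beta>)) - f \<beta> * killing u (E (- \<beta>))"])
      (use assms in \<open>auto simp: scale_op_add scale_op_scale killing_bilinear killing_E_E uminus_root_eq_iff algebra_simps\<close>)
  then show ?thesis by simp
qed

abbreviation "lower_op \<psi> \<equiv> scale_op (\<lambda>\<beta>. (\<psi> \<beta> - 1) / 2)"
abbreviation "upper_op \<psi> \<equiv> scale_op (\<lambda>\<beta>. (\<psi> \<beta> + 1) / 2)"

text \<open>The parameter \<open>u\<close> can be read off from the pair: both components share its
  \<open>h\<close> part, and upper minus lower is its root part, since the two factors differ by
  1.\<close>

definition root_graph :: "(('g \<Rightarrow> complex) \<Rightarrow> complex) \<Rightarrow> ('g \<times> 'g) set"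
  where "root_graph \<psi> = {(lower_op \<psi> u, upper_op \<psi> u) | u. True}"

lemma root_graph_cong: "(\<And>\<beta>. \<beta> \<in> roots h \<Longrightarrow> \<psi> \<beta> = \<psi>' \<beta>) \<Longrightarrow> root_graph \<psi> = root_graph \<psi>'"
  unfolding root_graph_def scale_op_def by (simp cong: sum.cong)

lemma root_graph_inject:
  assumes eq: "root_graph \<psi> = root_graph \<psi>'" and \<beta>: "\<beta> \<in> roots h"
  shows "\<psi> \<beta> = \<psi>' \<beta>"
proof -
  have "(lower_op \<psi> (E \<beta>), upper_op \<psi> (E \<beta>)) \<in> root_graph \<psi>"
    unfolding root_graph_def by blast
  then have "(lower_op \<psi> (E \<beta>), upper_op \<psi> (E \<beta>)) \<in> root_graph \<psi>'"
    by (simp only: eq)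
  then obtain u where u: "lower_op \<psi> (E \<beta>) = lower_op \<psi>' u"
      "upper_op \<psi> (E \<beta>) = upper_op \<psi>' u"
    by (auto simp: root_graph_def)
  define c where "c = killing u (E (- \<beta>))"
  have 1: "(\<psi> \<beta> - 1) / 2 = (\<psi>' \<beta> - 1) / 2 * c"
    using arg_cong[OF u(1), of "\<lambda>x. killing x (E (- \<beta>))"] killing_E[OF \<beta>] by (simp add: killing_scale_op[OF \<beta>] c_def del: scale_op_E)
  have 2: "(\<psi> \<beta> + 1) / 2 = (\<psi>' \<beta> + 1) / 2 * c"
    using arg_cong[OF u(2), of "\<lambda>x. killing x (E (- \<beta>))"] killing_E[OF \<beta>] by (simp add: killing_scale_op[OF \<beta>] c_def del: scale_op_E)
  \<comment> \<open>Subtract the first equation from the second.\<close>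
  have "c = 1" using 1 2 by (simp add: field_simps) algebra
  with 1 show ?thesis by simp
qed

lemma root_graphI:
  assumes hx: "h_part x = h_part y"
    and xy: "\<And>\<beta>. \<beta> \<in> roots h \<Longrightarrow>
      killing x (E (- \<beta>)) = (\<psi> \<beta> - 1) / 2 * (killing y (E (- \<beta>)) - killing x (E (- \<beta>)))"
  shows "(x, y) \<in> root_graph \<psi>"
proof -
  define u where "u = h_part x + (y - x)"
  have u\<beta>: "killing u (E (- \<beta>)) = killing y (E (- \<beta>)) - killing x (E (- \<beta>))" if "\<beta> \<in> roots h" for \<beta>
    using that by (simp add: u_def killing_bilinear)
  have "h_part y = h_part x + h_part (y - x)" using h_part_add[of x "y - x"] by simp
  then have uh: "h_part u = h_part x" by (simp add: u_def h_part_add hx)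
  have "lower_op \<psi> u = h_part x + (\<Sum>\<beta>\<in>roots h. killing x (E (- \<beta>)) *\<^sub>C E \<beta>)"
    unfolding scale_op_def uh by (intro arg_cong2[where f = "(+)"] sum.cong refl) (simp only: u\<beta> xy[symmetric])
  moreover have "upper_op \<psi> u = h_part y + (\<Sum>\<beta>\<in>roots h. killing y (E (- \<beta>)) *\<^sub>C E \<beta>)"
    unfolding scale_op_def uh hx
  proof (intro arg_cong2[where f = "(+)"] sum.cong refl)
    fix \<beta> assume \<beta>: "\<beta> \<in> roots h"
    have "(\<psi> \<beta> + 1) / 2 * killing u (E (- \<beta>))
        = (\<psi> \<beta> - 1) / 2 * (killing y (E (- \<beta>)) - killing x (E (- \<beta>))) + (killing y (E (- \<beta>)) - killing x (E (- \<beta>)))"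
      unfolding u\<beta>[OF \<beta>] by (simp add: field_simps)
    then show "((\<psi> \<beta> + 1) / 2 * killing u (E (- \<beta>))) *\<^sub>C E \<beta> = killing y (E (- \<beta>)) *\<^sub>C E \<beta>"
      using xy[OF \<beta>] by simp
  qed
  ultimately have "(x, y) = (lower_op \<psi> u, upper_op \<psi> u)"
    by (simp add: root_expansion)
  then show ?thesis unfolding root_graph_def by blast
qed

lemma double_form_Pair: "double_form (x, y) (x', y') = (killing y y' - killing x x') / 2"
  by (simp add: double_form_def)

lemma root_graph_generators:
  shows "H \<in> h \<Longrightarrow> (H, H) \<in> root_graph \<psi>"
    and "\<beta> \<in> roots h \<Longrightarrow> (((\<psi> \<beta> - 1) / 2) *\<^sub>C E \<beta>, ((\<psi> \<beta> + 1) / 2) *\<^sub>C E \<beta>) \<in> root_graph \<psi>"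
  unfolding root_graph_def by (force intro: exI[of _ H], force intro: exI[of _ "E \<beta>"])

lemma root_graph_subspace: "cvs.subspace (root_graph \<psi>)"
proof (rule cvs.subspaceI)
  show "0 \<in> root_graph \<psi>" using root_graph_generators(1)[of 0] h_closed(1) by (simp add: zero_prod_def)
  fix p q assume "p \<in> root_graph \<psi>" "q \<in> root_graph \<psi>"
  then show "p + q \<in> root_graph \<psi>"
    unfolding root_graph_def by (force simp flip: scale_op_add)
next
  fix c p assume "p \<in> root_graph \<psi>"
  then show "c *\<^sub>C p \<in> root_graph \<psi>"
    unfolding root_graph_def by (force simp flip: scale_op_scale)
qed

text \<open>Orthogonality to the diagonal of \<open>h\<close> equates the \<open>h\<close> parts;
  orthogonality to the generator at \<open>- \<beta>\<close> fixes the ratio of the components at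
  \<open>\<beta>\<close>, where oddness enters. Both maximality and closure under the bracket rest
  on this.\<close>

lemma root_graph_maximal:
  assumes odd: "odd_on_roots \<psi>" and orth: "\<And>w. w \<in> root_graph \<psi> \<Longrightarrow> double_form w m = 0"
  shows "m \<in> root_graph \<psi>"
proof -
  obtain x y where m: "m = (x, y)" by (cases m)
  have "h_part y - h_part x = 0"
  proof (rule killing_nondegenerate_on_h)
    fix H assume H: "H \<in> h"
    have split: "killing H z = killing H (h_part z)" for z
    proof -
      have "killing H (h_part z + (\<Sum>\<beta>\<in>roots h. killing z (E (- \<beta>)) *\<^sub>C E \<beta>)) = killing H (h_part z)"
        using H by (simp add: killing_add_right killing_sum_right killing_scale_right)
      then show ?thesis by (simp only: root_expansion)
    qed
    have "killing H y - killing H x = 0"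
      using orth[OF root_graph_generators(1)[OF H]] by (simp add: m double_form_Pair)
    then show "killing (h_part y - h_part x) H = 0"
      using split[of x] split[of y] by (simp add: killing_commute[of _ H] killing_diff_right)
  qed (simp add: h_closed)
  moreover have "killing x (E (- \<beta>)) = (\<psi> \<beta> - 1) / 2 * (killing y (E (- \<beta>)) - killing x (E (- \<beta>)))"
    if \<beta>: "\<beta> \<in> roots h" for \<beta>
  proof -
    have "\<psi> (- \<beta>) = - \<psi> \<beta>" using odd \<beta> by (simp add: odd_on_roots_def)
    then have "(- \<psi> \<beta> + 1) / 2 * killing (E (- \<beta>)) y - (- \<psi> \<beta> - 1) / 2 * killing (E (- \<beta>)) x = 0"
      using orth[OF root_graph_generators(2)[of "- \<beta>"]] \<beta>
      by (simp add: m double_form_Pair killing_scale_left)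
    moreover have "X - (\<psi> \<beta> - 1) / 2 * (Y - X) = (- \<psi> \<beta> + 1) / 2 * Y - (- \<psi> \<beta> - 1) / 2 * X" for X Y
      by (simp add: field_simps)
    ultimately show ?thesis
      by (metis eq_iff_diff_eq_0 killing_commute)
  qed
  ultimately show ?thesis unfolding m by (intro root_graphI) auto
qed

section \<open>Multilinear forms on generators, isotropy and closure under the bracket\<close>

lemma bilinear_zero_on_generators:
  fixes F :: "'g \<Rightarrow> 'g \<Rightarrow> complex"
  assumes add: "\<And>x y z. F (x + y) z = F x z + F y z" and scale: "\<And>c x z. F (c *\<^sub>C x) z = c * F x z"
    and sym: "\<And>x y. F x y = F y x"
    and gen: "\<And>H K. H \<in> h \<Longrightarrow> K \<in> h \<Longrightarrow> F H K = 0" "\<And>H \<beta>. H \<in> h \<Longrightarrow> \<beta> \<in> roots h \<Longrightarrow> F H (E \<beta>) = 0"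
      "\<And>\<beta> \<gamma>. \<beta> \<in> roots h \<Longrightarrow> \<gamma> \<in> roots h \<Longrightarrow> F (E \<beta>) (E \<gamma>) = 0"
  shows "F x y = 0"
proof (rule zero_on_generators[of "\<lambda>x. F x y"])
  show "F H y = 0" if "H \<in> h" for H
    unfolding sym[of H y]
    by (rule zero_on_generators[of "\<lambda>y. F y H"]) (use that add scale gen sym in auto)
  show "F (E \<beta>) y = 0" if "\<beta> \<in> roots h" for \<beta>
    unfolding sym[of "E \<beta>" y]
    by (rule zero_on_generators[of "\<lambda>y. F y (E \<beta>)"]) (use that add scale gen in auto)
qed (simp_all add: add scale)

text \<open>Every triple of generators can be rotated into one of the three listed kinds, and cyclic
  invariance lets the one slot in which linearity is assumed stand anywhere.\<close>

lemma trilinear_zero_on_generators: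
  fixes F :: "'g \<Rightarrow> 'g \<Rightarrow> 'g \<Rightarrow> complex"
  assumes add: "\<And>x y z w. F (x + y) z w = F x z w + F y z w"
    and scale: "\<And>c x z w. F (c *\<^sub>C x) z w = c * F x z w"
    and cyclic: "\<And>x y z. F x y z = F y z x"
    and gen: "\<And>H K z. H \<in> h \<Longrightarrow> K \<in> h \<Longrightarrow> F H K z = 0"
      "\<And>H \<beta> \<gamma>. H \<in> h \<Longrightarrow> \<beta> \<in> roots h \<Longrightarrow> \<gamma> \<in> roots h \<Longrightarrow> F H (E \<beta>) (E \<gamma>) = 0"
      "\<And>\<beta> \<gamma> \<delta>. \<beta> \<in> roots h \<Longrightarrow> \<gamma> \<in> roots h \<Longrightarrow> \<delta> \<in> roots h \<Longrightarrow> F (E \<beta>) (E \<gamma>) (E \<delta>) = 0"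
  shows "F x y z = 0"
proof -
  have zero: "F x y z = 0"
    if "\<And>H. H \<in> h \<Longrightarrow> F H y z = 0" "\<And>\<beta>. \<beta> \<in> roots h \<Longrightarrow> F (E \<beta>) y z = 0" for x y z
    by (rule zero_on_generators[of "\<lambda>x. F x y z"]) (simp_all add: add scale that)
  have hEz: "F H (E \<beta>) z = 0" if "H \<in> h" "\<beta> \<in> roots h" for H \<beta> z
  proof -
    have "F z H (E \<beta>) = 0"
      by (rule zero) (use that gen cyclic in metis)+
    then show ?thesis using cyclic by metis
  qed
  have EEz: "F (E \<beta>) (E \<gamma>) z = 0" if "\<beta> \<in> roots h" "\<gamma> \<in> roots h" for \<beta> \<gamma> z
  proof -
    have "F z (E \<beta>) (E \<gamma>) = 0"
      by (rule zero) (use that gen in auto)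
    then show ?thesis using cyclic by metis
  qed
  have hyz: "F H y z = 0" if "H \<in> h" for H y z
  proof -
    have "F y z H = 0"
      by (rule zero) (use that gen(1) hEz cyclic in metis)+
    then show ?thesis using cyclic by metis
  qed
  have Eyz: "F (E \<beta>) y z = 0" if "\<beta> \<in> roots h" for \<beta> y z
  proof -
    have "F y z (E \<beta>) = 0"
      by (rule zero) (use that hyz EEz cyclic in metis)+
    then show ?thesis using cyclic by metis
  qed
  show ?thesis by (rule zero) (use hyz Eyz in auto)
qed

text \<open>Pairs from \<open>h\<close> cancel; on opposite root vectors both components give
  \<open>(1 - (\<psi> \<beta>)\<^sup>2) / 4\<close>, by oddness.\<close>

lemma root_graph_isotropic: assumes odd: "odd_on_roots \<psi>" shows "isotropic (root_graph \<psi>)"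
proof -
  let ?A = "lower_op \<psi>" and ?B = "upper_op \<psi>"
  have "killing (?B u) (?B v) - killing (?A u) (?A v) = 0" for u v
  proof (rule bilinear_zero_on_generators[of "\<lambda>u v. killing (?B u) (?B v) - killing (?A u) (?A v)"])
    fix \<beta> \<gamma> assume *: "\<beta> \<in> roots h" "\<gamma> \<in> roots h"
    then show "killing (?B (E \<beta>)) (?B (E \<gamma>)) - killing (?A (E \<beta>)) (?A (E \<gamma>)) = 0"
      using odd by (auto simp: killing_scale_left killing_scale_right killing_E_E odd_on_roots_def field_simps)
  qed (simp_all add: scale_op_add scale_op_scale killing_bilinear killing_commute algebra_simps)
  then show ?thesis
    unfolding isotropic_def using root_graph_subspace
    by (auto simp: root_graph_def double_form_Pair)
qed

text \<open>The condition under which \<open>root_graph \<psi>\<close> is closed under the bracket. Expanded, it says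
  \<open>\<psi> \<beta> * \<psi> \<gamma> + \<psi> \<gamma> * \<psi> \<delta> + \<psi> \<delta> * \<psi> \<beta> + 1 = 0\<close> whenever
  \<open>\<beta> + \<gamma> + \<delta> = 0\<close> and \<open>[E \<beta>, E \<gamma>]\<close> does not vanish.\<close>

definition root_additive :: "(('g \<Rightarrow> complex) \<Rightarrow> complex) \<Rightarrow> bool"
  where "root_additive \<psi> \<longleftrightarrow> (\<forall>\<beta>\<in>roots h. \<forall>\<gamma>\<in>roots h. \<forall>\<delta>\<in>roots h.
    killing (lie (E \<beta>) (E \<gamma>)) (E \<delta>) \<noteq> 0 \<longrightarrow>
    (\<psi> \<beta> + 1) / 2 * ((\<psi> \<gamma> + 1) / 2) * ((\<psi> \<delta> + 1) / 2) = (\<psi> \<beta> - 1) / 2 * ((\<psi> \<gamma> - 1) / 2) * ((\<psi> \<delta> - 1) / 2))"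

text \<open>Since everything orthogonal to \<open>root_graph \<psi>\<close> lies in it, closure
  under the bracket amounts to the vanishing of a cyclic trilinear form. Oddness settles this on one
  element of \<open>h\<close> and two root vectors, \<open>root_additive\<close> on three root
  vectors.\<close>

theorem root_graph_lagrangian:
  assumes odd: "odd_on_roots \<psi>" and add: "root_additive \<psi>"
  shows "lagrangian_subalgebra (root_graph \<psi>)"
proof -
  let ?A = "lower_op \<psi>" and ?B = "upper_op \<psi>"
  let ?F = "\<lambda>u v w. killing (lie (?B u) (?B v)) (?B w) - killing (lie (?A u) (?A v)) (?A w)"
  have iso: "isotropic (root_graph \<psi>)" by (rule root_graph_isotropic[OF odd])
  have F: "?F u v w = 0" for u v w
  proof (rule trilinear_zero_on_generators[of ?F])
    fix H \<beta> \<gamma> assume *: "H \<in> h" "\<beta> \<in> roots h" "\<gamma> \<in> roots h"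
    then show "?F H (E \<beta>) (E \<gamma>) = 0"
      using odd by (auto simp: lie_bilinear killing_bilinear lie_E killing_E_E odd_on_roots_def field_simps)
  next
    fix \<beta> \<gamma> \<delta> assume *: "\<beta> \<in> roots h" "\<gamma> \<in> roots h" "\<delta> \<in> roots h"
    have EEE: "killing (lie (scale_op f (E \<beta>)) (scale_op f (E \<gamma>))) (scale_op f (E \<delta>))
        = f \<beta> * f \<gamma> * f \<delta> * killing (lie (E \<beta>) (E \<gamma>)) (E \<delta>)" for f
      using * by (simp add: lie_scaleC_left lie_scaleC_right killing_scale_left killing_scale_right mult_ac)
    have "killing (lie (E \<beta>) (E \<gamma>)) (E \<delta>) \<noteq> 0 \<Longrightarrow>
        (\<psi> \<beta> + 1) / 2 * ((\<psi> \<gamma> + 1) / 2) * ((\<psi> \<delta> + 1) / 2) = (\<psi> \<beta> - 1) / 2 * ((\<psi> \<gamma> - 1) / 2) * ((\<psi> \<delta> - 1) / 2)"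
      using add * unfolding root_additive_def by blast
    then show "?F (E \<beta>) (E \<gamma>) (E \<delta>) = 0"
      unfolding EEE left_diff_distrib[symmetric] by (metis mult_eq_0_iff right_minus_eq)
  next
    fix u v w
    show "?F u v w = ?F v w u"
      unfolding killing_invariant using killing_lie_cyclic by metis
  qed (simp_all add: scale_op_add scale_op_scale lie_bilinear killing_bilinear h_commute algebra_simps)
  have closed: "lie p q \<in> root_graph \<psi>" if pq: "p \<in> root_graph \<psi>" "q \<in> root_graph \<psi>" for p q
  proof (rule root_graph_maximal[OF odd])
    obtain u v where uv: "p = (?A u, ?B u)" "q = (?A v, ?B v)" using pq by (auto simp: root_graph_def)
    fix r assume "r \<in> root_graph \<psi>"
    then obtain w where "r = (?A w, ?B w)" by (auto simp: root_graph_def)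
    then show "double_form r (lie p q) = 0"
      using F[of u v w] by (simp add: uv double_form_Pair killing_commute[of _ "lie _ _"])
  qed
  have "M = root_graph \<psi>" if M: "isotropic M" "root_graph \<psi> \<subseteq> M" for M
  proof (rule antisym[OF subsetI M(2)])
    fix m assume "m \<in> M"
    then show "m \<in> root_graph \<psi>"
      using M by (intro root_graph_maximal[OF odd]) (auto simp: isotropic_def)
  qed
  with iso closed root_graph_subspace show ?thesis
    by (auto simp: lagrangian_subalgebra_def lie_subalgebra_def)
qed

end

lemma double_form_commute: "double_form p q = double_form q p"
  by (simp add: double_form_def killing_commute)

lemma double_form_add_left: "double_form (p + p') q = double_form p q + double_form p' q"
  and double_form_scale_left: "double_form (c *\<^sub>C p) q = c * double_form p q"
  by (simp_all add: double_form_def killing_bilinear algebra_simps)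

lemma double_form_add_right: "double_form q (p + p') = double_form q p + double_form q p'"
  and double_form_scale_right: "double_form q (c *\<^sub>C p) = c * double_form q p"
  by (metis double_form_commute double_form_add_left, metis double_form_commute double_form_scale_left)

text \<open>Adding the line through \<open>m\<close> to \<open>L\<close> keeps it isotropic, so
  maximality applies.\<close>

lemma lagrangian_memI:
  assumes L: "lagrangian_subalgebra L" and m: "double_form m m = 0" "\<And>q. q \<in> L \<Longrightarrow> double_form m q = 0"
  shows "m \<in> L"
proof -
  define M where "M = {q + c *\<^sub>C m | q c. q \<in> L}"
  have sub: "cvs.subspace L" and iso: "\<And>p q. p \<in> L \<Longrightarrow> q \<in> L \<Longrightarrow> double_form p q = 0"
    using L by (auto simp: lagrangian_subalgebra_def isotropic_def)
  have MI: "q + c *\<^sub>C m \<in> M" if "q \<in> L" for q c using that unfolding M_def by blast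
  have "cvs.subspace M"
  proof (rule cvs.subspaceI)
    show "0 \<in> M" using MI[OF cvs.subspace_0[OF sub], of 0] by simp
    fix p p' assume "p \<in> M" "p' \<in> M"
    then obtain q c q' c' where *: "p = q + c *\<^sub>C m" "p' = q' + c' *\<^sub>C m" "q \<in> L" "q' \<in> L"
      by (auto simp: M_def)
    have "p + p' = (q + q') + (c + c') *\<^sub>C m" by (simp add: * scaleC_add_left algebra_simps)
    then show "p + p' \<in> M" using MI[OF cvs.subspace_add[OF sub *(3,4)]] by simp
    show "d *\<^sub>C p \<in> M" for d
      using MI[OF cvs.subspace_scale[OF sub *(3)], of d "d * c"] * by (simp add: scaleC_add_right scaleC_scaleC)
  qed
  moreover have "double_form p p' = 0" if pp: "p \<in> M" "p' \<in> M" for p p'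
  proof -
    obtain q c q' c' where *: "p = q + c *\<^sub>C m" "p' = q' + c' *\<^sub>C m" "q \<in> L" "q' \<in> L"
      using pp by (auto simp: M_def)
    have "double_form q m = 0" using m(2)[OF *(3)] by (simp only: double_form_commute[of q])
    then show ?thesis
      by (simp add: *(1,2) double_form_add_left double_form_add_right double_form_scale_left double_form_scale_right
          iso[OF *(3,4)] m(1) m(2)[OF *(4)])
  qed
  ultimately have "isotropic M" by (simp add: isotropic_def)
  moreover have "L \<subseteq> M" using MI[of _ 0] by auto
  ultimately have "M = L" using L by (auto simp: lagrangian_subalgebra_def)
  moreover have "m \<in> M" using MI[OF cvs.subspace_0[OF sub], of 1] by (simp add: scaleC_one)
  ultimately show ?thesis by simp
qed

lemma scaleC_half_twice: "(1/2) *\<^sub>C x + (1/2) *\<^sub>C x = (x :: 'g::complex_lie_algebra)"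
  by (simp add: scaleC_one flip: scaleC_add_left)

context root_data
begin

section \<open>Bivectors of weight zero\<close>

text \<open>For a bivector of weight zero, the value of \<open>T\<close> here is the scalar of its
  operator on the root space of \<open>- \<beta>\<close>; the minus sign converts it into the scalar
  at \<open>\<beta>\<close>.\<close>

definition root_coeff :: "'g tensor2 \<Rightarrow> ('g \<Rightarrow> complex) \<Rightarrow> complex"
  where "root_coeff T \<beta> = - T (killing_flat (E \<beta>)) (killing_flat (E (- \<beta>)))"

definition zero_weight :: "'g tensor2 \<Rightarrow> bool"
  where "zero_weight T \<longleftrightarrow> (\<forall>H\<in>h. ad_tensor2 H T = (\<lambda>\<xi> \<eta>. 0))"

lemma zero_weight_iff:
  assumes "tensorial T"
  shows "zero_weight T \<longleftrightarrow> (\<forall>H\<in>h. \<forall>y. lie H (bivector_op T y) = bivector_op T (lie H y))"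
proof
  assume z: "zero_weight T"
  show "\<forall>H\<in>h. \<forall>y. lie H (bivector_op T y) = bivector_op T (lie H y)"
  proof (intro ballI allI pairing_eqI)
    fix H y \<xi> assume "H \<in> h"
    then show "pairing \<xi> (lie H (bivector_op T y)) = pairing \<xi> (bivector_op T (lie H y))"
      using z ad_tensor2_eq[OF assms, of H \<xi> y] by (simp add: zero_weight_def)
  qed
next
  assume c: "\<forall>H\<in>h. \<forall>y. lie H (bivector_op T y) = bivector_op T (lie H y)"
  show "zero_weight T"
    unfolding zero_weight_def
  proof (intro ballI ext)
    fix H :: 'g and \<xi> \<eta> :: "'g ldual" assume "H \<in> h"
    obtain y :: 'g where "\<eta> = killing_flat y" using killing_flat_surj by blast
    with c \<open>H \<in> h\<close> show "ad_tensor2 H T \<xi> \<eta> = 0" by (simp add: ad_tensor2_eq[OF assms])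
  qed
qed

lemma zero_weight_op_h:
  assumes "tensorial T" "zero_weight T" "H \<in> h" shows "bivector_op T H \<in> h"
proof (rule h_self_centralizing)
  fix K assume "K \<in> h"
  then show "lie K (bivector_op T H) = 0"
    using assms h_commute[of K H] bivector_op_scale[of T 0 0] by (simp add: zero_weight_iff)
qed

lemma root_coeff_odd: "T \<in> bivectors \<Longrightarrow> odd_on_roots (root_coeff T)"
  unfolding odd_on_roots_def root_coeff_def
  by (metis bivector_antisymmetric minus_minus_root)

lemma zero_weight_op_E:
  assumes T: "T \<in> bivectors" "zero_weight T" and \<beta>: "\<beta> \<in> roots h"
  shows "bivector_op T (E \<beta>) = root_coeff T \<beta> *\<^sub>C E \<beta>"
proof -
  have ten: "tensorial T" by (rule bivector_tensorial[OF T(1)])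
  have "bivector_op T (E \<beta>) \<in> root_space h \<beta>"
    using T(2) \<beta> by (simp add: root_space_def zero_weight_iff[OF ten] lie_E bivector_op_scale[OF ten])
  moreover have "killing (bivector_op T (E \<beta>)) (E (- \<beta>)) = root_coeff T \<beta>"
    unfolding killing_commute[of "bivector_op T (E \<beta>)"] killing_bivector_op[OF ten] root_coeff_def
    by (rule bivector_antisymmetric[OF T(1)])
  ultimately show ?thesis using root_space_one_dimensional[OF \<beta>] by metis
qed

lemma root_coeff_root_tensor:
  assumes "odd_on_roots f" "\<beta> \<in> roots h" shows "root_coeff (root_tensor f) \<beta> = f \<beta>"
proof -
  have "root_coeff (root_tensor f) \<beta> = - killing (E \<beta>) (bivector_op (root_tensor f) (E (- \<beta>)))"
    by (simp add: root_coeff_def killing_bivector_op[OF root_tensor_tensorial])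
  also have "\<dots> = f \<beta>" using assms by (simp add: killing_scale_right killing_minus_right killing_E odd_on_roots_def)
  finally show ?thesis .
qed

lemma zero_weight_root_tensor:
  assumes f: "odd_on_roots f" shows "zero_weight (root_tensor f)"
  unfolding zero_weight_iff[OF root_tensor_tensorial]
proof (intro ballI allI pairing_eqI)
  fix H y \<xi> assume H: "H \<in> h"
  let ?R = "bivector_op (root_tensor f)"
  have "pairing \<xi> (lie H (?R y)) - pairing \<xi> (?R (lie H y)) = 0"
  proof (rule zero_on_generators[of "\<lambda>y. pairing \<xi> (lie H (?R y)) - pairing \<xi> (?R (lie H y))"])
    show "pairing \<xi> (lie H (?R K)) - pairing \<xi> (?R (lie H K)) = 0" if "K \<in> h" for K
      using that H f h_closed(1) by (simp add: h_commute)
    show "pairing \<xi> (lie H (?R (E \<beta>))) - pairing \<xi> (?R (lie H (E \<beta>))) = 0" if "\<beta> \<in> roots h" for \<beta>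
      using that H f
      by (simp add: lie_E lie_scaleC_right bivector_op_scale[OF root_tensor_tensorial] scaleC_scaleC mult.commute)
  qed (simp_all add: lie_bilinear bivector_op_add[OF root_tensor_tensorial]
      bivector_op_scale[OF root_tensor_tensorial] pairing_add pairing_scale algebra_simps)
  then show "pairing \<xi> (lie H (?R y)) = pairing \<xi> (?R (lie H y))" by simp
qed

lemma functional_of_eq: "functional_of p = killing_flat ((1/2) *\<^sub>C (snd p - fst p :: 'g))"
proof -
  have "(\<lambda>x. double_form (diagonal x) p) = killing ((1/2) *\<^sub>C (snd p - fst p))"
    by (simp add: fun_eq_iff double_form_def diagonal_def killing_bilinear killing_commute)
  then show ?thesis by (simp add: functional_of_def killing_flat_def)
qed

lemma killing_h_part: assumes "H \<in> h" shows "killing x H = killing (h_part x) H"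
proof -
  have "killing (h_part x + (\<Sum>\<beta>\<in>roots h. killing x (E (- \<beta>)) *\<^sub>C E \<beta>)) H = killing (h_part x) H"
    using assms by (simp add: killing_add_left killing_sum_left killing_scale_left)
  then show ?thesis by (simp only: root_expansion)
qed

lemma h_part_zero [simp]: "h_part 0 = 0"
  by (simp add: h_closed)

lemma h_part_minus: "h_part (- x) = - h_part x"
  using h_part_scale[of "-1" x] by (simp add: scaleC_one)

lemma h_part_diff: "h_part (x - y) = h_part x - h_part y"
  using h_part_add[of x "- y"] by (simp add: h_part_minus)

lemma bivector_op_zero: "tensorial T \<Longrightarrow> bivector_op T (0::'g) = 0"
  using bivector_op_scale[of T 0 0] by simp

lemma bivector_op_minus: "tensorial T \<Longrightarrow> bivector_op T (- x :: 'g) = - bivector_op T x"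
  using bivector_op_scale[of T "-1" x] by (simp add: scaleC_one)

lemma bivector_op_sub: "tensorial T \<Longrightarrow> bivector_op T (x - y :: 'g) = bivector_op T x - bivector_op T y"
  using bivector_op_add[of T x "- y"] by (simp add: bivector_op_minus)

lemma bivector_op_sum:
  "tensorial T \<Longrightarrow> bivector_op T (\<Sum>i\<in>I. f i :: 'g) = (\<Sum>i\<in>I. bivector_op T (f i))"
  by (induction I rule: infinite_finite_induct) (simp_all add: bivector_op_add bivector_op_zero)

lemma n_plus_op:
  assumes "x \<in> n_plus h \<alpha>"
  shows "h_part x = 0 \<and> bivector_op (r_zero h \<alpha> E) x = x"
  using assms unfolding n_plus_def
proof (induction rule: cvs.span_induct_alt)
  case (step c x y)
  then obtain \<beta> where \<beta>: "\<beta> \<in> \<Phi>pos" "x \<in> root_space h \<beta>" by blast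
  then have "x = killing x (E (- \<beta>)) *\<^sub>C E \<beta>" using root_space_one_dimensional positive_rootD by blast
  then obtain d where "x = d *\<^sub>C E \<beta>" by blast
  then show ?case
    using step \<beta>(1) positive_rootD[OF \<beta>(1)]
    by (simp add: h_part_add h_part_scale bivector_op_add[OF root_tensor_tensorial] r_zero_eq
        bivector_op_scale[OF root_tensor_tensorial] odd_root_sign root_sign_def scaleC_one)
qed (simp add: r_zero_eq bivector_op_zero[OF root_tensor_tensorial])

lemma n_minus_op:
  assumes "x \<in> n_minus h \<alpha>"
  shows "h_part x = 0 \<and> bivector_op (r_zero h \<alpha> E) x = - x"
  using assms unfolding n_minus_def
proof (induction rule: cvs.span_induct_alt)
  case (step c x y)
  then obtain \<beta> where \<beta>: "\<beta> \<in> \<Phi>pos" "x \<in> root_space h (- \<beta>)" by blast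
  then have "x = killing x (E (- (- \<beta>))) *\<^sub>C E (- \<beta>)"
    using root_space_one_dimensional positive_rootD uminus_root by blast
  then obtain d where "x = d *\<^sub>C E (- \<beta>)" by blast
  then show ?case
    using step uminus_positive_root[OF \<beta>(1)] positive_rootD[OF \<beta>(1)]
    by (simp add: h_part_add h_part_scale bivector_op_add[OF root_tensor_tensorial] r_zero_eq
        bivector_op_scale[OF root_tensor_tensorial] odd_root_sign root_sign_def scaleC_one)
qed (simp add: r_zero_eq bivector_op_zero[OF root_tensor_tensorial])

text \<open>Used with \<open>c\<close> equal to -1 and to 1. The operator meets only the root part
  of \<open>u\<close>, which is why the component of \<open>T\<close> in the second exterior power
  of \<open>h\<close> leaves the governed space unaffected.\<close>

lemma scale_op_half:
  assumes T: "T \<in> bivectors" "zero_weight T"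
  shows "scale_op (\<lambda>\<beta>. (root_coeff T \<beta> + c) / 2) u
    = h_part u + (1/2) *\<^sub>C (bivector_op T (u - h_part u) + c *\<^sub>C (u - h_part u))"
proof -
  have ten: "tensorial T" by (rule bivector_tensorial[OF T(1)])
  have u: "u - h_part u = (\<Sum>\<beta>\<in>roots h. killing u (E (- \<beta>)) *\<^sub>C E \<beta>)"
    by (simp add: h_part_def)
  have half: "(1/2) *\<^sub>C (a *\<^sub>C b *\<^sub>C e + c *\<^sub>C a *\<^sub>C e) = ((b + c) / 2 * a) *\<^sub>C e" for a b and e :: 'g
    by (simp only: scaleC_scaleC flip: scaleC_add_left) (simp add: field_simps)
  show ?thesis
    unfolding u bivector_op_sum[OF ten] scale_op_def cvs.scale_sum_right sum.distrib[symmetric]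
    by (intro arg_cong2[where f = "(+)"] sum.cong refl)
      (simp only: bivector_op_scale[OF ten] zero_weight_op_E[OF T] half)
qed

text \<open>The annihilator condition forces \<open>k = 0\<close>. As \<open>r_zero\<close> acts by
  1 on \<open>n_plus\<close> and by -1 on \<open>n_minus\<close>, subtracting it and adding the
  components of \<open>p\<close> produces exactly the shifts -1 and 1 in \<open>lower_op\<close> and
  \<open>upper_op\<close>.\<close>

theorem governed_space_eq:
  assumes T: "r l \<in> bivectors" "zero_weight (r l)"
  shows "governed_space h \<alpha> E r l = root_graph (root_coeff (r l))"
proof -
  let ?T = "r l" and ?\<tau> = "\<lambda>\<xi> \<eta>. r l \<xi> \<eta> - r_zero h \<alpha> E \<xi> \<eta>"
  have ten: "tensorial ?T" "tensorial (r_zero h \<alpha> E)"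
    by (simp_all add: bivector_tensorial T r_zero_eq root_tensor_tensorial)
  have \<tau>: "bivector_op ?\<tau> y = bivector_op ?T y - bivector_op (r_zero h \<alpha> E) y" for y
    by (rule killing_eqI)
      (simp add: killing_diff_right killing_bivector_op[OF tensorial_diff[OF ten]] killing_bivector_op[OF ten(1)]
        killing_bivector_op[OF ten(2)])
  have elem: "diagonal (X + sharp ?\<tau> (functional_of (Xm, Xp))) + (Xm, Xp)
      = (lower_op (root_coeff ?T) u, upper_op (root_coeff ?T) u)"
    if X: "X \<in> h" "Xm \<in> n_minus h \<alpha>" "Xp \<in> n_plus h \<alpha>" "u = X + (Xp - Xm)" for X Xm Xp u
  proof -
    note np = n_plus_op[OF X(3)] and nm = n_minus_op[OF X(2)]
    have hu: "h_part u = X" using X(1,4) np nm by (simp add: h_part_add h_part_diff)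
    have uY: "u - X = Xp - Xm" using X(4) by simp
    have s: "sharp ?\<tau> (functional_of (Xm, Xp)) = (1/2) *\<^sub>C (bivector_op ?T (Xp - Xm) - (Xp + Xm))"
      unfolding functional_of_eq bivector_op_def[symmetric] \<tau>
      using np nm by (simp add: bivector_op_scale[OF ten(1)] bivector_op_scale[OF ten(2)] bivector_op_sub[OF ten(2)]
          flip: cvs.scale_right_diff_distrib)
    have "X + (1/2) *\<^sub>C (bivector_op ?T (Xp - Xm) - (Xp + Xm)) + Xm
        = X + (1/2) *\<^sub>C (bivector_op ?T (Xp - Xm) + (- 1) *\<^sub>C (Xp - Xm))"
      using scaleC_half_twice[of Xm]
      by (simp add: scaleC_add_right cvs.scale_right_diff_distrib scaleC_one algebra_simps)
    moreover have "X + (1/2) *\<^sub>C (bivector_op ?T (Xp - Xm) - (Xp + Xm)) + Xp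
        = X + (1/2) *\<^sub>C (bivector_op ?T (Xp - Xm) + 1 *\<^sub>C (Xp - Xm))"
      using scaleC_half_twice[of Xp]
      by (simp add: scaleC_add_right cvs.scale_right_diff_distrib scaleC_one algebra_simps)
    ultimately show ?thesis
      using scale_op_half[OF T, of "- 1" u] scale_op_half[OF T, of 1 u]
      by (simp add: s diagonal_def hu uY del: add_diff_cancel_left')
  qed
  show ?thesis
  proof (intro antisym subsetI)
    fix w assume "w \<in> governed_space h \<alpha> E r l"
    then obtain X p where w: "w = diagonal (X + sharp ?\<tau> (functional_of p)) + p" "X \<in> h"
        "p \<in> dual_in_double h \<alpha>" "\<forall>H\<in>h. pairing (functional_of p) H = 0"
      by (auto simp: governed_space_def Let_def)
    from w(3) obtain Xm Xp k where p: "p = (Xm + k, Xp - k)" "Xm \<in> n_minus h \<alpha>" "Xp \<in> n_plus h \<alpha>" "k \<in> h"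
      by (auto simp: dual_in_double_def)
    have "k = 0"
    proof (rule killing_nondegenerate_on_h[OF p(4)])
      fix H assume H: "H \<in> h"
      have "killing Xp H = 0" "killing Xm H = 0"
        using killing_h_part[OF H, of Xp] killing_h_part[OF H, of Xm] n_plus_op[OF p(3)] n_minus_op[OF p(2)]
        by simp_all
      then show "killing k H = 0"
        using bspec[OF w(4) H] by (simp add: functional_of_eq p killing_bilinear)
    qed
    then have "w = (lower_op (root_coeff ?T) (X + (Xp - Xm)), upper_op (root_coeff ?T) (X + (Xp - Xm)))"
      using elem[OF w(2) p(2,3) refl] w(1) p(1) by simp
    then show "w \<in> root_graph (root_coeff ?T)" unfolding root_graph_def by blast
  next
    fix w assume "w \<in> root_graph (root_coeff ?T)"
    then obtain u where u: "w = (lower_op (root_coeff ?T) u, upper_op (root_coeff ?T) u)"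
      by (auto simp: root_graph_def)
    \<comment> \<open>The positive and negative root parts of \<open>u\<close>; the sign of
      \<open>Xm\<close> is due to the parameter being \<open>X + (Xp - Xm)\<close>.\<close>
    define Xp where "Xp = (\<Sum>\<beta>\<in>\<Phi>pos. killing u (E (- \<beta>)) *\<^sub>C E \<beta>)"
    define Xm where "Xm = - (\<Sum>\<beta>\<in>\<Phi>pos. killing u (E (- (- \<beta>))) *\<^sub>C E (- \<beta>))"
    have Xp: "Xp \<in> n_plus h \<alpha>"
      unfolding Xp_def n_plus_def
      by (intro cvs.span_sum cvs.span_scale cvs.span_base) (use E_in_root_space positive_rootD in blast)
    have Xm: "Xm \<in> n_minus h \<alpha>"
      unfolding Xm_def n_minus_def
      by (intro cvs.span_neg cvs.span_sum cvs.span_scale cvs.span_base)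
        (use E_in_root_space positive_rootD uminus_root in blast)
    have uX: "u = h_part u + (Xp - Xm)"
      using root_expansion[of u] by (simp add: sum_roots Xp_def Xm_def)
    have "w = diagonal (h_part u + sharp ?\<tau> (functional_of (Xm, Xp))) + (Xm, Xp)"
      unfolding elem[OF h_part_in_h Xm Xp uX] by (rule u)
    moreover have "(Xm, Xp) \<in> dual_in_double h \<alpha>"
      unfolding dual_in_double_def
      by (rule CollectI, rule exI[of _ Xm], rule exI[of _ Xp], rule exI[of _ 0]) (use Xm Xp h_closed in simp)
    moreover have "\<forall>H\<in>h. pairing (functional_of (Xm, Xp)) H = 0"
      using killing_h_part n_plus_op[OF Xp] n_minus_op[OF Xm]
      by (auto simp: functional_of_eq killing_bilinear)
    ultimately show "w \<in> governed_space h \<alpha> E r l"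
      unfolding governed_space_def Let_def using h_part_in_h by blast
  qed
qed

section \<open>Lagrangian subalgebras meeting the diagonal in the Cartan subalgebra\<close>

text \<open>\<open>W\<close> is stable under the diagonal of \<open>h\<close>, so it contains the
  weight components of each of its elements.\<close>

lemma root_components_in_subalgebra:
  assumes W: "lie_subalgebra W" "diagonal ` h \<subseteq> W" and xy: "(x, y) \<in> W" and \<beta>: "\<beta> \<in> roots h"
  shows "(killing x (E (- \<beta>)) *\<^sub>C E \<beta>, killing y (E (- \<beta>)) *\<^sub>C E \<beta>) \<in> W"
proof -
  \<comment> \<open>The zero functional labels the Cartan component. It is not a root, so
    \<open>Y\<close> treats it apart from the root vectors.\<close>
  let ?z = "\<lambda>_::'g. 0::complex"
  define Y where "Y \<phi> = (if \<phi> = ?z then (h_part x, h_part y)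
    else (killing x (E (- \<phi>)) *\<^sub>C E \<phi>, killing y (E (- \<phi>)) *\<^sub>C E \<phi>))" for \<phi>
  have nz: "?z \<notin> roots h" using rootD(2) by blast
  have z: "?z \<in> hstar h" by (simp add: hstar_def)
  have "(\<Sum>\<phi>\<in>roots h. Y \<phi>) = (\<Sum>\<phi>\<in>roots h. (killing x (E (- \<phi>)) *\<^sub>C E \<phi>, killing y (E (- \<phi>)) *\<^sub>C E \<phi>))"
    using nz by (intro sum.cong refl) (auto simp: Y_def)
  then have "(\<Sum>\<phi>\<in>insert ?z (roots h). Y \<phi>) = (x, y)"
    using nz finite_roots root_expansion[of x] root_expansion[of y]
    by (simp add: prod_eq_iff fst_sum snd_sum) (simp add: Y_def)
  then have sum: "(\<Sum>\<phi>\<in>insert ?z (roots h). Y \<phi>) \<in> W" using xy by simp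
  have "Y \<beta> \<in> W"
  proof (rule weight_components_in_stable_subspace[OF _ _ _ _ _ sum, of h diagonal "\<lambda>\<phi> H. \<phi> H"])
    show "finite (insert ?z (roots h))" using finite_roots by simp
    show "cvs.subspace W" using W(1) by (simp add: lie_subalgebra_def)
    show "lie (diagonal H) v \<in> W" if "H \<in> h" "v \<in> W" for H v
      using W that by (auto simp: lie_subalgebra_def)
    show "lie (diagonal H) (Y \<phi>) = \<phi> H *\<^sub>C Y \<phi>" if "\<phi> \<in> insert ?z (roots h)" "H \<in> h" for \<phi> H
      using that by (auto simp: Y_def diagonal_def h_commute lie_E lie_scaleC_right scaleC_scaleC mult.commute zero_prod_def)
    show "\<exists>H\<in>h. \<phi> H \<noteq> \<psi> H" if "\<phi> \<in> insert ?z (roots h)" "\<psi> \<in> insert ?z (roots h)" "\<phi> \<noteq> \<psi>" for \<phi> \<psi>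
      using that hstar_eqI[of \<phi> \<psi>] rootD(1) z by blast
    show "\<beta> \<in> insert ?z (roots h)" using \<beta> by simp
  qed
  moreover have "\<beta> \<noteq> ?z" using nz \<beta> by blast
  ultimately show ?thesis by (simp add: Y_def)
qed

lemma scaled_E_in_h: assumes "c *\<^sub>C E \<beta> \<in> h" "\<beta> \<in> roots h" shows "c = 0"
  using killing_h_E(1)[OF assms(1) uminus_root[OF assms(2)]] killing_E[OF assms(2)]
  by (simp add: killing_scale_left)

text \<open>If \<open>W\<close> had no nonzero vector with both components on the line of
  \<open>E \<beta>\<close>, the diagonal vector of \<open>E (- \<beta>)\<close> would be orthogonal
  to \<open>W\<close>, hence in it, against the hypothesis on the diagonal. Such a vector is not
  diagonal either, so its components can be normalized to differ by 1. Isotropy then yields oddness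
  and, combined with closure under the bracket, the addition law.\<close>

theorem lagrangian_is_root_graph:
  assumes W: "lagrangian_subalgebra W" and diag: "W \<inter> range diagonal = diagonal ` h"
  obtains \<psi> where "odd_on_roots \<psi>" "root_additive \<psi>" "W = root_graph \<psi>"
proof -
  have sub: "cvs.subspace W" and lie: "\<And>p q. p \<in> W \<Longrightarrow> q \<in> W \<Longrightarrow> lie p q \<in> W"
    and iso: "\<And>p q. p \<in> W \<Longrightarrow> q \<in> W \<Longrightarrow> double_form p q = 0" and alg: "lie_subalgebra W"
    using W by (auto simp: lagrangian_subalgebra_def isotropic_def lie_subalgebra_def)
  have diagD: "x \<in> h" if "(x, x) \<in> W" for x
    using that diag by (auto simp: diagonal_def set_eq_iff)
  have "\<exists>a. (a *\<^sub>C E \<beta>, (a + 1) *\<^sub>C E \<beta>) \<in> W" if \<beta>: "\<beta> \<in> roots h" for \<beta>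
  proof (cases "\<exists>x y. (x *\<^sub>C E \<beta>, y *\<^sub>C E \<beta>) \<in> W \<and> (x \<noteq> 0 \<or> y \<noteq> 0)")
    case True
    then obtain x y where xy: "(x *\<^sub>C E \<beta>, y *\<^sub>C E \<beta>) \<in> W" "x \<noteq> 0 \<or> y \<noteq> 0" by blast
    have ne: "x \<noteq> y" using xy diagD scaled_E_in_h[OF _ \<beta>] by blast
    have "inverse (y - x) *\<^sub>C (x *\<^sub>C E \<beta>, y *\<^sub>C E \<beta>) \<in> W"
      using xy(1) sub cvs.subspace_scale by blast
    moreover have "inverse (y - x) * y = inverse (y - x) * x + 1" using ne by (simp add: field_simps)
    ultimately have "((inverse (y - x) * x) *\<^sub>C E \<beta>, (inverse (y - x) * x + 1) *\<^sub>C E \<beta>) \<in> W"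
      by (simp add: scaleC_scaleC)
    then show ?thesis by blast
  next
    case False
    let ?m = "(E (- \<beta>), E (- \<beta>))"
    have "?m \<in> W"
    proof (rule lagrangian_memI[OF W])
      show "double_form ?m ?m = 0" by (simp add: double_form_Pair)
      fix q assume "q \<in> W"
      then obtain x y where q: "q = (x, y)" "(x, y) \<in> W" by (cases q) auto
      have "diagonal ` h \<subseteq> W" using diag by blast
      then have "killing x (E (- \<beta>)) = 0 \<and> killing y (E (- \<beta>)) = 0"
        using root_components_in_subalgebra[OF alg _ q(2) \<beta>] False by blast
      then show "double_form ?m q = 0"
        by (simp add: q(1) double_form_Pair killing_commute[of "E (- \<beta>)"])
    qed
    then have "1 *\<^sub>C E (- \<beta>) \<in> h" using diagD by (simp add: scaleC_one)
    then show ?thesis using scaled_E_in_h[of 1 "- \<beta>"] \<beta> by simp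
  qed
  then obtain a where a: "\<And>\<beta>. \<beta> \<in> roots h \<Longrightarrow> (a \<beta> *\<^sub>C E \<beta>, (a \<beta> + 1) *\<^sub>C E \<beta>) \<in> W"
    by metis
  define \<psi> where "\<psi> \<beta> = 2 * a \<beta> + 1" for \<beta>
  have \<psi>a: "(\<psi> \<beta> - 1) / 2 = a \<beta>" "(\<psi> \<beta> + 1) / 2 = a \<beta> + 1" for \<beta>
    by (simp_all add: \<psi>_def field_simps)
  have odd: "odd_on_roots \<psi>"
    unfolding odd_on_roots_def
  proof
    fix \<beta> assume \<beta>: "\<beta> \<in> roots h"
    have "(a \<beta> + 1) * (a (- \<beta>) + 1) - a \<beta> * a (- \<beta>) = 0"
      using iso[OF a[OF \<beta>] a[OF uminus_root[OF \<beta>]]]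
      by (simp add: double_form_Pair killing_scale_left killing_scale_right killing_E[OF \<beta>] mult_ac)
    then have "a \<beta> + a (- \<beta>) + 1 = 0" by (simp add: algebra_simps)
    then show "\<psi> (- \<beta>) = - \<psi> \<beta>" unfolding \<psi>_def by algebra
  qed
  have add: "root_additive \<psi>"
    unfolding root_additive_def \<psi>a
  proof (intro ballI impI)
    fix \<beta> \<gamma> \<delta> assume *: "\<beta> \<in> roots h" "\<gamma> \<in> roots h" "\<delta> \<in> roots h"
      and nz: "killing (lie (E \<beta>) (E \<gamma>)) (E \<delta>) \<noteq> 0"
    have "((a \<beta> + 1) * (a \<gamma> + 1) * (a \<delta> + 1) - a \<beta> * a \<gamma> * a \<delta>) * killing (lie (E \<beta>) (E \<gamma>)) (E \<delta>) = 0"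
      unfolding left_diff_distrib
      using iso[OF lie[OF a[OF *(1)] a[OF *(2)]] a[OF *(3)]]
      by (simp add: double_form_Pair lie_scaleC_left lie_scaleC_right killing_scale_left killing_scale_right mult_ac)
    with nz show "(a \<beta> + 1) * (a \<gamma> + 1) * (a \<delta> + 1) = a \<beta> * a \<gamma> * a \<delta>" by simp
  qed
  have "root_graph \<psi> \<subseteq> W"
  proof
    fix w assume "w \<in> root_graph \<psi>"
    then obtain u where u: "w = (scale_op (\<lambda>\<beta>. a \<beta>) u, scale_op (\<lambda>\<beta>. a \<beta> + 1) u)"
      by (auto simp: root_graph_def \<psi>a)
    have "w = (h_part u, h_part u) + (\<Sum>\<beta>\<in>roots h. killing u (E (- \<beta>)) *\<^sub>C (a \<beta> *\<^sub>C E \<beta>, (a \<beta> + 1) *\<^sub>C E \<beta>))"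
      by (simp add: u prod_eq_iff fst_sum snd_sum scale_op_def scaleC_scaleC mult.commute)
    moreover have "(h_part u, h_part u) \<in> W" using diag h_part_in_h[of u] by (auto simp: diagonal_def)
    ultimately show "w \<in> W"
      by (auto intro!: cvs.subspace_add[OF sub] cvs.subspace_sum[OF sub] cvs.subspace_scale[OF sub] a simp del: scaleC_Pair)
  qed
  moreover have "isotropic W" using W by (simp add: lagrangian_subalgebra_def)
  \<comment> \<open>An isotropic \<open>W\<close> that contains the maximal isotropic
    \<open>root_graph \<psi>\<close> coincides with it.\<close>
  ultimately have "W = root_graph \<psi>"
    using root_graph_lagrangian[OF odd add] by (simp add: lagrangian_subalgebra_def)
  with odd add that show thesis by blast
qed

section \<open>The classical dynamical Yang-Baxter equation\<close>

abbreviation "pder \<equiv> partial_deriv h \<alpha> E"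

lemma alt_d_eq:
  assumes P: "\<And>i. tensorial (pder i r l)" "\<And>i \<xi> \<eta>. pder i r l \<eta> \<xi> = - pder i r l \<xi> \<eta>"
  shows "alt_d h \<alpha> E r l (killing_flat x) (killing_flat y) (killing_flat z) = (\<Sum>i\<in>UNIV.
    killing x (hv i) * pder i r l (killing_flat y) (killing_flat z)
    + killing y (hv i) * pder i r l (killing_flat z) (killing_flat x)
    + killing z (hv i) * pder i r l (killing_flat x) (killing_flat y))"
  unfolding alt_d_def wedge12_eq[OF P] by simp

definition satisfies_cdybe :: "(('g \<Rightarrow> complex) \<Rightarrow> 'g tensor2) \<Rightarrow> ('g \<Rightarrow> complex) \<Rightarrow> bool"
  where "satisfies_cdybe r l \<longleftrightarrow> (\<forall>\<xi> \<eta> \<zeta>. alt_d h \<alpha> E r l \<xi> \<eta> \<zeta> + 1/2 * schouten (r l) (r l) \<xi> \<eta> \<zeta>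
    = bracket_12_23 casimir casimir \<xi> \<eta> \<zeta>)"

text \<open>Evaluated at \<open>H\<close>, \<open>E \<beta>\<close> and
  \<open>E (- \<beta>)\<close>, the derivative terms survive only in the slot of \<open>H\<close>,
  and the two terms containing \<open>?R H\<close> cancel; so the component in the second exterior
  power of \<open>h\<close> drops out. Independence of the simple roots then separates the
  coordinate directions.\<close>

lemma cdybe_imp_riccati:
  assumes T: "r l \<in> bivectors" "zero_weight (r l)"
    and P: "\<And>i. tensorial (pder i r l)" "\<And>i \<xi> \<eta>. pder i r l \<eta> \<xi> = - pder i r l \<xi> \<eta>"
    and cdybe: "satisfies_cdybe r l" and \<beta>: "\<beta> \<in> roots h"
  shows "- pder i r l (killing_flat (E \<beta>)) (killing_flat (E (- \<beta>)))
    = hvd i (dual_vec \<beta>) * (1 - (root_coeff (r l) \<beta>)\<^sup>2)"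
proof -
  let ?\<psi> = "root_coeff (r l) \<beta>" and ?R = "bivector_op (r l)"
  let ?P = "\<lambda>i. pder i r l (killing_flat (E \<beta>)) (killing_flat (E (- \<beta>)))"
  have ten: "tensorial (r l)" by (rule bivector_tensorial[OF T(1)])
  have R: "?R (E \<beta>) = ?\<psi> *\<^sub>C E \<beta>" "?R (E (- \<beta>)) = (- ?\<psi>) *\<^sub>C E (- \<beta>)"
    using zero_weight_op_E[OF T] \<beta> root_coeff_odd[OF T(1)] by (simp_all add: odd_on_roots_def)
  have "(\<lambda>i. - ?P i) = (\<lambda>i. hvd i (dual_vec \<beta>) * (1 - ?\<psi>\<^sup>2))"
  proof (rule simple_roots_coeffs_unique)
    fix H assume H: "H \<in> h"
    have RH: "?R H \<in> h" by (rule zero_weight_op_h[OF ten T(2) H])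
    have HE: "killing H (lie (E \<beta>) (E (- \<beta>))) = \<beta> H"
      using killing_dual_vec[OF \<beta> H] by (simp add: dual_vec_def)
    have "killing (E \<beta>) (lie (E (- \<beta>)) (?R H)) = \<beta> (?R H)"
      unfolding killing_lie_swap[of _ "E (- \<beta>)"] using \<beta> RH
      by (simp add: lie_E_uminus_root killing_bilinear killing_E)
    moreover have "killing (E (- \<beta>)) (lie (?R H) (E \<beta>)) = \<beta> (?R H)"
      using \<beta> RH by (simp add: lie_E killing_bilinear killing_E')
    moreover have "alt_d h \<alpha> E r l (killing_flat H) (killing_flat (E \<beta>)) (killing_flat (E (- \<beta>)))
        + (killing H (lie (?R (E \<beta>)) (?R (E (- \<beta>)))) + killing (E \<beta>) (lie (?R (E (- \<beta>))) (?R H))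
          + killing (E (- \<beta>)) (lie (?R H) (?R (E \<beta>)))) = - killing H (lie (E \<beta>) (E (- \<beta>)))"
      using cdybe[unfolded satisfies_cdybe_def, rule_format, of "killing_flat H" "killing_flat (E \<beta>)" "killing_flat (E (- \<beta>))"]
      by (simp add: schouten_self[OF ten bivector_antisymmetric[OF T(1)]] bracket_casimir add_divide_distrib)
    moreover have "alt_d h \<alpha> E r l (killing_flat H) (killing_flat (E \<beta>)) (killing_flat (E (- \<beta>)))
        = (\<Sum>i\<in>UNIV. \<alpha> i H * ?P i)"
      unfolding alt_d_eq[OF P] using \<beta> H by (simp add: hvec_eq killing_dual_vec simple_root)
    ultimately have "(\<Sum>i\<in>UNIV. \<alpha> i H * ?P i) = - \<beta> H * (1 - ?\<psi>\<^sup>2)"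
      unfolding R lie_scaleC_left lie_scaleC_right killing_scale_left killing_scale_right HE
      by (simp add: algebra_simps power2_eq_square)
    then have "(\<Sum>i\<in>UNIV. - ?P i * \<alpha> i H) = \<beta> H * (1 - ?\<psi>\<^sup>2)"
      by (simp add: sum_negf mult.commute)
    also have "\<dots> = (\<Sum>i\<in>UNIV. hvd i (dual_vec \<beta>) * (1 - ?\<psi>\<^sup>2) * \<alpha> i H)"
      unfolding root_in_simple_roots[OF \<beta> H] sum_distrib_right by (simp add: mult_ac)
    finally show "(\<Sum>i\<in>UNIV. - ?P i * \<alpha> i H) = (\<Sum>i\<in>UNIV. hvd i (dual_vec \<beta>) * (1 - ?\<psi>\<^sup>2) * \<alpha> i H)" .
  qed
  from fun_cong[OF this, of i] show ?thesis .
qed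

lemma dual_vec_uminus: assumes "\<beta> \<in> roots h" shows "dual_vec (- \<beta>) = - dual_vec \<beta>"
  unfolding dual_vec_def minus_minus_root by (rule lie_anticommute)

lemma hstar_minus: "\<phi> \<in> hstar h \<Longrightarrow> x \<in> h \<Longrightarrow> \<phi> (- x) = - \<phi> x"
  using hstarD(2)[of \<phi> x "-1"] by (simp add: scaleC_one)

text \<open>The difference of the two sides is a cyclic trilinear form. With two arguments in
  \<open>h\<close> it vanishes because the operators kill \<open>h\<close>; with one, by the Riccati
  equation; on three root vectors by the addition law, the derivative terms being absent there
  because root vectors are orthogonal to \<open>h\<close>.\<close>

lemma riccati_imp_cdybe:
  assumes \<psi>: "odd_on_roots \<psi>" "root_additive \<psi>" and r: "r l = root_tensor \<psi>"
    and P: "\<And>i. pder i r l = root_tensor (\<lambda>\<beta>. hvd i (dual_vec \<beta>) * (1 - (\<psi> \<beta>)\<^sup>2))"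
  shows "satisfies_cdybe r l"
proof -
  let ?R = "bivector_op (root_tensor \<psi>)" and ?f = "\<lambda>i \<beta>. hvd i (dual_vec \<beta>) * (1 - (\<psi> \<beta>)\<^sup>2)"
  have f: "odd_on_roots (?f i)" for i
    using \<psi>(1) by (simp add: odd_on_roots_def dual_vec_uminus hstar_minus[OF hvec_dual(1)])
  have ten: "tensorial (root_tensor g)" "\<And>\<xi> \<eta>. root_tensor g \<eta> \<xi> = - root_tensor g \<xi> \<eta>" for g
    by (rule root_tensor_tensorial, rule bivector_antisymmetric[OF root_tensor_bivector])
  define Q where "Q i x y = root_tensor (?f i) (killing_flat x) (killing_flat y)" for i x y
  have Q: "Q i x y = killing x (bivector_op (root_tensor (?f i)) y)" for i x y
    by (simp add: Q_def killing_bivector_op[OF ten(1)])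
  have Qanti: "Q i y x = - Q i x y" for i x y unfolding Q_def by (rule ten(2))
  have Qh: "Q i x H = 0" "Q i H x = 0" if "H \<in> h" for i x H
    using that f Qanti[of i H x] by (simp_all add: Q)
  have Qadd: "Q i (x + y) z = Q i x z + Q i y z" "Q i z (x + y) = Q i z x + Q i z y"
    and Qscale: "Q i (c *\<^sub>C x) z = c * Q i x z" "Q i z (c *\<^sub>C x) = c * Q i z x" for i x y z c
    by (simp_all add: Q killing_bilinear bivector_op_add[OF ten(1)] bivector_op_scale[OF ten(1)])
  let ?F = "\<lambda>x y z. (\<Sum>i\<in>UNIV. killing x (hv i) * Q i y z + killing y (hv i) * Q i z x + killing z (hv i) * Q i x y)
    + (killing x (lie (?R y) (?R z)) + killing y (lie (?R z) (?R x)) + killing z (lie (?R x) (?R y)))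
    + killing x (lie y z)"
  have F: "?F x y z = 0" for x y z
  proof (rule trilinear_zero_on_generators[of ?F])
    fix x y z
    show "?F x y z = ?F y z x"
      by (simp add: killing_lie_cyclic[of x y z] add_ac)
  next
    fix H K z assume "H \<in> h" "K \<in> h"
    then show "?F H K z = 0"
      using \<psi>(1) by (simp add: Qh h_commute flip: killing_invariant)
  next
    fix H \<beta> \<gamma> assume *: "H \<in> h" "\<beta> \<in> roots h" "\<gamma> \<in> roots h"
    have HE: "killing H (lie (E \<beta>) (E \<gamma>)) = \<beta> H * killing (E \<beta>) (E \<gamma>)"
      using * by (simp add: lie_E killing_scale_left flip: killing_invariant)
    have "(\<Sum>i\<in>UNIV. killing H (hv i) * Q i (E \<beta>) (E \<gamma>)) = \<gamma> H * (1 - (\<psi> \<gamma>)\<^sup>2) * killing (E \<beta>) (E \<gamma>)"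
      using * f by (simp add: Q killing_scale_right root_in_simple_roots[of \<gamma> H] hvec_eq killing_dual_vec simple_root
          sum_distrib_left sum_distrib_right mult_ac)
    then have "?F H (E \<beta>) (E \<gamma>) = (\<gamma> H * (1 - (\<psi> \<gamma>)\<^sup>2) + \<psi> \<beta> * \<psi> \<gamma> * \<beta> H + \<beta> H) * killing (E \<beta>) (E \<gamma>)"
      using * \<psi>(1) by (simp add: lie_scaleC_left lie_scaleC_right killing_scale_right HE algebra_simps)
    also have "\<dots> = 0"
      using * \<psi>(1) by (auto simp: killing_E_E odd_on_roots_def algebra_simps power2_eq_square)
    finally show "?F H (E \<beta>) (E \<gamma>) = 0" .
  next
    fix \<beta> \<gamma> \<delta> assume *: "\<beta> \<in> roots h" "\<gamma> \<in> roots h" "\<delta> \<in> roots h"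
    let ?K = "killing (E \<beta>) (lie (E \<gamma>) (E \<delta>))"
    have K: "killing (E \<gamma>) (lie (E \<delta>) (E \<beta>)) = ?K" "killing (E \<delta>) (lie (E \<beta>) (E \<gamma>)) = ?K"
      using killing_lie_cyclic by metis+
    have "?F (E \<beta>) (E \<gamma>) (E \<delta>) = (\<psi> \<gamma> * \<psi> \<delta> + \<psi> \<delta> * \<psi> \<beta> + \<psi> \<beta> * \<psi> \<gamma> + 1) * ?K"
      using * \<psi>(1) by (simp add: lie_scaleC_left lie_scaleC_right killing_scale_right K algebra_simps)
    also have "\<dots> = 0"
    proof (cases "?K = 0")
      case False
      then have "(\<psi> \<beta> + 1) / 2 * ((\<psi> \<gamma> + 1) / 2) * ((\<psi> \<delta> + 1) / 2) = (\<psi> \<beta> - 1) / 2 * ((\<psi> \<gamma> - 1) / 2) * ((\<psi> \<delta> - 1) / 2)"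
        using \<psi>(2) * unfolding root_additive_def killing_invariant by blast
      then have "\<psi> \<gamma> * \<psi> \<delta> + \<psi> \<delta> * \<psi> \<beta> + \<psi> \<beta> * \<psi> \<gamma> + 1 = 0" by (simp add: field_simps) algebra
      then show ?thesis by simp
    qed simp
    finally show "?F (E \<beta>) (E \<gamma>) (E \<delta>) = 0" .
  qed (simp_all add: Qadd Qscale killing_bilinear lie_bilinear bivector_op_add[OF ten(1)] bivector_op_scale[OF ten(1)]
      sum.distrib sum_distrib_left algebra_simps)
  show ?thesis
    unfolding satisfies_cdybe_def
  proof (intro allI)
    fix \<xi> \<eta> \<zeta> :: "'g ldual"
    obtain x y z :: 'g where xyz: "\<xi> = killing_flat x" "\<eta> = killing_flat y" "\<zeta> = killing_flat z"
      using killing_flat_surj by metis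
    have alt: "alt_d h \<alpha> E r l (killing_flat x) (killing_flat y) (killing_flat z)
        = (\<Sum>i\<in>UNIV. killing x (hv i) * Q i y z + killing y (hv i) * Q i z x + killing z (hv i) * Q i x y)"
      unfolding Q_def P[symmetric] by (rule alt_d_eq) (simp only: P ten(1), simp only: P, rule ten(2))
    have "a + 1/2 * (2 * b) = - c" if "a + b + c = 0" for a b c :: complex
      using that by (simp add: eq_neg_iff_add_eq_0)
    from this[OF F[of x y z]]
    show "alt_d h \<alpha> E r l \<xi> \<eta> \<zeta> + 1/2 * schouten (r l) (r l) \<xi> \<eta> \<zeta> = bracket_12_23 casimir casimir \<xi> \<eta> \<zeta>"
      unfolding xyz r alt schouten_self[OF ten] bracket_casimir .
  qed
qed

section \<open>Solutions of the dynamical equation\<close>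

abbreviation "cimage \<equiv> coordinate_image h \<alpha> E"
abbreviation "locus \<equiv> holomorphic_locus h \<alpha> E"

lemma hstar_point_inject: "pt v = pt w \<Longrightarrow> v = w"
  by (metis hstar_point_hvec vec_eq_iff)

text \<open>Lets holomorphy be checked on open sets of coordinate vectors instead of open sets of
  functionals.\<close>

lemma locusI:
  assumes "open V" "v \<in> V" "V \<subseteq> cimage U" "\<And>\<xi> \<eta>. holomorphic_mv (\<lambda>v. r (pt v) \<xi> \<eta>) V"
  shows "pt v \<in> locus U r"
proof -
  have "cimage (pt ` V) = V" using hstar_point_inject by (auto simp: coordinate_image_def)
  then show ?thesis
    unfolding holomorphic_locus_def using assms
    by (intro CollectI conjI exI[of _ "pt ` V"]) (auto simp: coordinate_image_def open_in_hstar_def)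
qed

lemma locusE:
  assumes "l \<in> locus U r"
  obtains v V where "l = pt v" "open V" "v \<in> V" "V \<subseteq> cimage U" "\<And>\<xi> \<eta>. holomorphic_mv (\<lambda>v. r (pt v) \<xi> \<eta>) V"
proof -
  from assms obtain V where V: "l \<in> V" "V \<subseteq> U" "open_in_hstar h \<alpha> E V"
      "\<forall>\<xi> \<eta>. holomorphic_mv (\<lambda>v. r (pt v) \<xi> \<eta>) (cimage V)"
    unfolding holomorphic_locus_def by blast
  have l: "l = pt (\<chi> i. l (hv i))" using V(1,3) by (auto simp: open_in_hstar_def hstar_point_surj)
  show thesis
  proof (rule that[OF l])
    show "open (cimage V)" using V(3) by (simp add: open_in_hstar_def)
    show "(\<chi> i. l (hv i)) \<in> cimage V" using V(1) l by (simp add: coordinate_image_def)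
    show "cimage V \<subseteq> cimage U" using V(2) by (auto simp: coordinate_image_def)
  qed (use V(4) in blast)
qed

lemma partial_deriv_hstar_point:
  "pder i r (pt v) \<xi> \<eta> = deriv (\<lambda>t. r (pt (v + t *s axis i 1)) \<xi> \<eta>) 0"
  by (simp add: partial_deriv_def hstar_point_shift)

text \<open>Bilinearity and antisymmetry hold along the piece \<open>S\<close> of the coordinate
  line that stays in \<open>V\<close>, and differentiation preserves them.\<close>

lemma
  assumes biv: "\<And>l. l \<in> U \<Longrightarrow> r l \<in> bivectors"
    and V: "open V" "v \<in> V" "V \<subseteq> cimage U" "\<And>\<xi> \<eta>. holomorphic_mv (\<lambda>v. r (pt v) \<xi> \<eta>) V"
  shows has_field_derivative_partial_deriv:
      "((\<lambda>t. r (pt (v + t *s axis i 1)) \<xi> \<eta>) has_field_derivative pder i r (pt v) \<xi> \<eta>) (at 0)"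
    and partial_deriv_tensorial: "tensorial (pder i r (pt v))"
    and partial_deriv_antisymmetric: "pder i r (pt v) \<eta> \<xi> = - pder i r (pt v) \<xi> \<eta>"
proof -
  let ?g = "\<lambda>\<xi> \<eta> t. r (pt (v + t *s axis i 1)) \<xi> \<eta>"
  have D: "(?g \<xi> \<eta> has_field_derivative pder i r (pt v) \<xi> \<eta>) (at 0)" for \<xi> \<eta>
  proof -
    obtain D where D: "((\<lambda>v. r (pt v) \<xi> \<eta>) has_derivative D) (at v)" "\<And>c w. D (c *s w) = c * D w"
      using holomorphic_mvE[OF V(4) V(2)] by blast
    have "(?g \<xi> \<eta> has_field_derivative D (axis i 1)) (at 0)"
      by (rule has_field_derivative_along_line) (use D in auto)
    then show ?thesis by (simp add: partial_deriv_hstar_point DERIV_imp_deriv)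
  qed
  show "(?g \<xi> \<eta> has_field_derivative pder i r (pt v) \<xi> \<eta>) (at 0)" by (rule D)
  define S where "S = {t. v + t *s axis i 1 \<in> V}"
  have S: "open S" "0 \<in> S" using V(1,2) by (auto simp: S_def open_line_preimage)
  have bivS: "r (pt (v + t *s axis i 1)) \<in> bivectors" if "t \<in> S" for t
    using that V(3) biv by (auto simp: S_def coordinate_image_def)
  show "tensorial (pder i r (pt v))"
    unfolding tensorial_def
  proof (intro allI)
    fix \<xi> \<eta>
    let ?s = "\<lambda>t. \<Sum>b\<in>lie_basis. \<Sum>c\<in>lie_basis. ?g (coord b) (coord c) t * (pairing \<xi> b * pairing \<eta> c)"
    have "(?s has_field_derivative (\<Sum>b\<in>lie_basis. \<Sum>c\<in>lie_basis. coef (pder i r (pt v)) b c * (pairing \<xi> b * pairing \<eta> c))) (at 0)"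
      unfolding coef_def by (intro DERIV_sum DERIV_cmult_right D)
    moreover have "?s t = ?g \<xi> \<eta> t" if "t \<in> S" for t
      using tensorialD[OF bivector_tensorial[OF bivS[OF that]], of \<xi> \<eta>] by (simp add: coef_def)
    ultimately have "(?g \<xi> \<eta> has_field_derivative (\<Sum>b\<in>lie_basis. \<Sum>c\<in>lie_basis. coef (pder i r (pt v)) b c * (pairing \<xi> b * pairing \<eta> c))) (at 0)"
      by (rule has_field_derivative_transform_within_open[OF _ S])
    then show "pder i r (pt v) \<xi> \<eta> = (\<Sum>b\<in>lie_basis. \<Sum>c\<in>lie_basis. coef (pder i r (pt v)) b c * (pairing \<xi> b * pairing \<eta> c))"
      using D DERIV_unique by blast
  qed
  have "(?g \<eta> \<xi> has_field_derivative - pder i r (pt v) \<xi> \<eta>) (at 0)"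
    by (rule has_field_derivative_transform_within_open[OF DERIV_minus[OF D] S])
      (metis bivS bivector_antisymmetric)
  then show "pder i r (pt v) \<eta> \<xi> = - pder i r (pt v) \<xi> \<eta>"
    using D DERIV_unique by blast
qed

text \<open>The Riccati equation \<open>\<partial>\<psi> = 1 - \<psi>\<^sup>2\<close> is linearized by \<open>\<psi> = (b + a) / (b - a)\<close>, that is
  \<open>a = (\<psi> - 1) / 2\<close> and \<open>b = (\<psi> + 1) / 2\<close> up to a common factor, with
  \<open>\<partial>b = b\<close> and \<open>\<partial>a = -a\<close>.\<close>

definition flow_num :: "(('g \<Rightarrow> complex) \<Rightarrow> complex) \<Rightarrow> ('g \<Rightarrow> complex) \<Rightarrow> ('g \<Rightarrow> complex) \<Rightarrow> ('g \<Rightarrow> complex) \<Rightarrow> complex"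
  where "flow_num \<psi> \<mu> l \<beta> = (\<psi> \<beta> + 1) / 2 * exp (l (dual_vec \<beta>) - \<mu> (dual_vec \<beta>))
    + (\<psi> \<beta> - 1) / 2 * exp (- (l (dual_vec \<beta>) - \<mu> (dual_vec \<beta>)))"

definition flow_den :: "(('g \<Rightarrow> complex) \<Rightarrow> complex) \<Rightarrow> ('g \<Rightarrow> complex) \<Rightarrow> ('g \<Rightarrow> complex) \<Rightarrow> ('g \<Rightarrow> complex) \<Rightarrow> complex"
  where "flow_den \<psi> \<mu> l \<beta> = (\<psi> \<beta> + 1) / 2 * exp (l (dual_vec \<beta>) - \<mu> (dual_vec \<beta>))
    - (\<psi> \<beta> - 1) / 2 * exp (- (l (dual_vec \<beta>) - \<mu> (dual_vec \<beta>)))"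

definition flow :: "(('g \<Rightarrow> complex) \<Rightarrow> complex) \<Rightarrow> ('g \<Rightarrow> complex) \<Rightarrow> ('g \<Rightarrow> complex) \<Rightarrow> ('g \<Rightarrow> complex) \<Rightarrow> complex"
  where "flow \<psi> \<mu> l \<beta> = flow_num \<psi> \<mu> l \<beta> / flow_den \<psi> \<mu> l \<beta>"

lemma flow_start: "flow_num \<psi> \<mu> \<mu> \<beta> = \<psi> \<beta>" "flow_den \<psi> \<mu> \<mu> \<beta> = 1" "flow \<psi> \<mu> \<mu> \<beta> = \<psi> \<beta>"
  by (simp_all add: flow_def flow_num_def flow_den_def field_simps)

text \<open>Sum and difference isolate the two exponential terms, whose coefficients differ by 1. So
  a zero of the denominator is a true pole.\<close>

lemma flow_num_den_not_both_zero: "flow_num \<psi> \<mu> l \<beta> \<noteq> 0 \<or> flow_den \<psi> \<mu> l \<beta> \<noteq> 0"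
proof (rule ccontr)
  let ?x = "exp (l (dual_vec \<beta>) - \<mu> (dual_vec \<beta>))" and ?y = "exp (- (l (dual_vec \<beta>) - \<mu> (dual_vec \<beta>)))"
  assume "\<not> ?thesis"
  then have sum: "(\<psi> \<beta> + 1) / 2 * ?x + (\<psi> \<beta> - 1) / 2 * ?y = 0"
    and diff: "(\<psi> \<beta> + 1) / 2 * ?x - (\<psi> \<beta> - 1) / 2 * ?y = 0"
    unfolding flow_num_def flow_den_def by blast+
  have "P = 0 \<and> Q = 0" if "P + Q = 0" "P - Q = 0" for P Q :: complex using that by auto
  note zero = this[OF sum diff]
  have "\<psi> \<beta> + 1 = 0" using conjunct1[OF zero] by simp
  moreover have "\<psi> \<beta> - 1 = 0" using conjunct2[OF zero] by simp
  ultimately have "(\<psi> \<beta> + 1) - (\<psi> \<beta> - 1) = 0" by (simp only: diff_self)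
  then show False by simp
qed

lemma holomorphic_flow:
  "holomorphic_mv (\<lambda>v. flow_num \<psi> \<mu> (pt v) \<beta>) UNIV" "holomorphic_mv (\<lambda>v. flow_den \<psi> \<mu> (pt v) \<beta>) UNIV"
  unfolding flow_num_def flow_den_def hstar_point_def
  by (intro holomorphic_mv_add holomorphic_mv_diff holomorphic_mv_mult holomorphic_mv_const
      holomorphic_mv_exp holomorphic_mv_uminus holomorphic_mv_sum holomorphic_mv_component open_UNIV)+

text \<open>The equation with cleared denominators is an identity between meromorphic functions: it
  holds on \<open>W\<close>, hence at \<open>l\<close>, where both sides are continuous. A zero of
  the denominator there would also be a zero of the numerator.\<close>

lemma root_coeff_on_locus:
  assumes mer: "meromorphic_tensor h \<alpha> E U r" and conn: "connected (cimage U)"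
    and W: "open W" "W \<subseteq> cimage U" "W \<noteq> {}"
      "\<And>v. v \<in> W \<Longrightarrow> root_coeff (r (pt v)) \<beta> * flow_den \<psi> \<mu> (pt v) \<beta> = flow_num \<psi> \<mu> (pt v) \<beta>"
    and l: "l \<in> locus U r"
  shows "flow_den \<psi> \<mu> l \<beta> \<noteq> 0" "root_coeff (r l) \<beta> = flow \<psi> \<mu> l \<beta>"
proof -
  obtain v V where v: "l = pt v" "open V" "v \<in> V" "V \<subseteq> cimage U"
      "\<And>\<xi> \<eta>. holomorphic_mv (\<lambda>v. r (pt v) \<xi> \<eta>) V"
    using locusE[OF l] by blast
  let ?g = "\<lambda>v. r (pt v) (killing_flat (E \<beta>)) (killing_flat (E (- \<beta>)))"
  \<comment> \<open>The sign before the denominator makes up for the one in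
    \<open>root_coeff\<close>.\<close>
  let ?u = "\<lambda>v. ?g v * (- flow_den \<psi> \<mu> (pt v) \<beta>) - flow_num \<psi> \<mu> (pt v) \<beta>"
  have "?u v = 0"
  proof (rule meromorphic_mv_identity[OF _ conn W(1-3)])
    have "meromorphic_mv ?g (cimage U)" using mer by (simp add: meromorphic_tensor_def)
    then show "meromorphic_mv ?u (cimage U)"
      by (intro meromorphic_mv_affine holomorphic_mv_uminus holomorphic_flow)
    show "?u w = 0" if "w \<in> W" for w using W(4)[OF that] by (simp add: root_coeff_def)
    show "v \<in> cimage U" using v by blast
    have "holomorphic_mv ?u V"
      using holomorphic_flow holomorphic_mv_subset v(2)
      by (intro holomorphic_mv_diff holomorphic_mv_mult holomorphic_mv_uminus v(5)) blast+
    then show "isCont ?u v"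
      using holomorphic_mv_continuous_on v(2,3) continuous_on_eq_continuous_at by blast
  qed
  then have eq: "root_coeff (r l) \<beta> * flow_den \<psi> \<mu> l \<beta> = flow_num \<psi> \<mu> l \<beta>"
    by (simp add: root_coeff_def v(1))
  then show nz: "flow_den \<psi> \<mu> l \<beta> \<noteq> 0"
    using flow_num_den_not_both_zero[of \<psi> \<mu> l \<beta>] by auto
  with eq show "root_coeff (r l) \<beta> = flow \<psi> \<mu> l \<beta>"
    by (simp add: flow_def eq_divide_eq)
qed

text \<open>Near \<open>\<mu>\<close> the Riccati equation with this initial value determines the
  coefficient, and \<open>root_coeff_on_locus\<close> carries the result to the whole locus.\<close>

theorem dynamical_r_matrix_root_coeff:
  assumes dyn: "dynamical_r_matrix h \<alpha> E U r" and conn: "connected (cimage U)"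
    and \<mu>: "\<mu> \<in> locus U r" and l: "l \<in> locus U r" and \<beta>: "\<beta> \<in> roots h"
    and start: "\<psi> \<beta> = root_coeff (r \<mu>) \<beta>"
  shows "root_coeff (r l) \<beta> = flow \<psi> \<mu> l \<beta>"
proof -
  have biv: "r l \<in> bivectors" if "l \<in> U" for l
    using dyn that by (simp add: dynamical_r_matrix_def)
  obtain p V where p: "\<mu> = pt p" "open V" "p \<in> V" "V \<subseteq> cimage U"
      "\<And>\<xi> \<eta>. holomorphic_mv (\<lambda>v. r (pt v) \<xi> \<eta>) V"
    using locusE[OF \<mu>] by blast
  obtain e where e: "e > 0" "ball p e \<subseteq> V" using p(2,3) open_contains_ball by blast
  let ?f = "\<lambda>v. root_coeff (r (pt v)) \<beta>" and ?k = "\<lambda>i. hvd i (dual_vec \<beta>)"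
  have hol: "holomorphic_mv ?f (ball p e)"
    unfolding root_coeff_def using holomorphic_mv_subset[OF p(5) open_ball e(2)] by (rule holomorphic_mv_uminus)
  have ric: "deriv (\<lambda>t. ?f (v + t *s axis i 1)) 0 = ?k i * (1 - (?f v)\<^sup>2)" if v: "v \<in> ball p e" for v i
  proof -
    have vV: "v \<in> V" using v e(2) by blast
    note P = partial_deriv_tensorial[of U r V v] partial_deriv_antisymmetric[of U r V v]
      has_field_derivative_partial_deriv[of U r V v]
    have "pt v \<in> locus U r" by (rule locusI[OF p(2) vV p(4,5)])
    then have "zero_weight (r (pt v))" "satisfies_cdybe r (pt v)"
      using dyn by (auto simp: dynamical_r_matrix_def zero_weight_def satisfies_cdybe_def)
    moreover have "r (pt v) \<in> bivectors" using vV p(4) biv by (auto simp: coordinate_image_def)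
    moreover have "pt v \<in> U" using vV p(4) by (auto simp: coordinate_image_def)
    ultimately have "- pder i r (pt v) (killing_flat (E \<beta>)) (killing_flat (E (- \<beta>))) = ?k i * (1 - (?f v)\<^sup>2)"
      by (intro cdybe_imp_riccati \<beta> P biv p vV)
    moreover have "deriv (\<lambda>t. ?f (v + t *s axis i 1)) 0 = - pder i r (pt v) (killing_flat (E \<beta>)) (killing_flat (E (- \<beta>)))"
      unfolding root_coeff_def by (intro DERIV_imp_deriv DERIV_minus P biv p vV)
    ultimately show ?thesis by simp
  qed
  have "root_coeff (r (pt v)) \<beta> * flow_den \<psi> \<mu> (pt v) \<beta> = flow_num \<psi> \<mu> (pt v) \<beta>" if v: "v \<in> ball p e" for v
  proof -
    have L: "(\<Sum>i\<in>UNIV. ?k i * (v $ i - p $ i)) = pt v (dual_vec \<beta>) - \<mu> (dual_vec \<beta>)"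
      by (simp add: p(1) hstar_point_def left_diff_distrib right_diff_distrib sum_subtractf mult.commute)
    \<comment> \<open>Here \<open>b\<close> and \<open>a\<close> are the halves
      \<open>(\<psi> \<beta> + 1) / 2\<close> and \<open>(\<psi> \<beta> - 1) / 2\<close>, so that
      \<open>b - a\<close> is 1 and \<open>b + a\<close> is the initial value.\<close>
    have init: "?f p * ((\<psi> \<beta> + 1) / 2 - (\<psi> \<beta> - 1) / 2) = (\<psi> \<beta> + 1) / 2 + (\<psi> \<beta> - 1) / 2"
      by (simp add: start p(1) field_simps)
    show ?thesis
      using riccati_unique_solution[OF hol ric init v] unfolding L flow_num_def flow_den_def .
  qed
  then show ?thesis
    using dyn e p(4)
    by (intro root_coeff_on_locus(2)[of U r "ball p e"] conn l) (auto simp: dynamical_r_matrix_def)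
qed

text \<open>Passing to \<open>- \<beta>\<close> reverses the exponent and exchanges the two halves
  up to sign.\<close>

lemma flow_uminus:
  assumes \<psi>: "odd_on_roots \<psi>" and l: "l \<in> hstar h" "\<mu> \<in> hstar h" and \<beta>: "\<beta> \<in> roots h"
  shows "flow_den \<psi> \<mu> l (- \<beta>) = flow_den \<psi> \<mu> l \<beta>" "flow \<psi> \<mu> l (- \<beta>) = - flow \<psi> \<mu> l \<beta>"
proof -
  have x: "l (dual_vec (- \<beta>)) - \<mu> (dual_vec (- \<beta>)) = - (l (dual_vec \<beta>) - \<mu> (dual_vec \<beta>))"
    using \<beta> l by (simp add: dual_vec_uminus hstar_minus)
  have \<psi>\<beta>: "\<psi> (- \<beta>) = - \<psi> \<beta>" using \<psi> \<beta> by (simp add: odd_on_roots_def)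
  show den: "flow_den \<psi> \<mu> l (- \<beta>) = flow_den \<psi> \<mu> l \<beta>"
    unfolding flow_den_def x \<psi>\<beta> by (simp add: field_simps)
  have "flow_num \<psi> \<mu> l (- \<beta>) = - flow_num \<psi> \<mu> l \<beta>"
    unfolding flow_num_def x \<psi>\<beta> by (simp add: field_simps)
  with den show "flow \<psi> \<mu> l (- \<beta>) = - flow \<psi> \<mu> l \<beta>" by (simp add: flow_def)
qed

lemma odd_flow: "odd_on_roots \<psi> \<Longrightarrow> l \<in> hstar h \<Longrightarrow> \<mu> \<in> hstar h \<Longrightarrow> odd_on_roots (flow \<psi> \<mu> l)"
  by (simp add: odd_on_roots_def flow_uminus)

text \<open>Each half is a single exponential term over the denominator, which makes the flow
  multiplicative in the addition law.\<close>

lemma flow_half: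
  assumes "flow_den \<psi> \<mu> l \<beta> \<noteq> 0"
  shows "(flow \<psi> \<mu> l \<beta> + 1) / 2 = (\<psi> \<beta> + 1) / 2 * exp (l (dual_vec \<beta>) - \<mu> (dual_vec \<beta>)) / flow_den \<psi> \<mu> l \<beta>"
    and "(flow \<psi> \<mu> l \<beta> - 1) / 2 = (\<psi> \<beta> - 1) / 2 * exp (- (l (dual_vec \<beta>) - \<mu> (dual_vec \<beta>))) / flow_den \<psi> \<mu> l \<beta>"
proof -
  have "flow \<psi> \<mu> l \<beta> + 1 = (flow_num \<psi> \<mu> l \<beta> + flow_den \<psi> \<mu> l \<beta>) / flow_den \<psi> \<mu> l \<beta>"
    "flow \<psi> \<mu> l \<beta> - 1 = (flow_num \<psi> \<mu> l \<beta> - flow_den \<psi> \<mu> l \<beta>) / flow_den \<psi> \<mu> l \<beta>"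
    using assms by (simp_all add: flow_def field_simps)
  then show "(flow \<psi> \<mu> l \<beta> + 1) / 2 = (\<psi> \<beta> + 1) / 2 * exp (l (dual_vec \<beta>) - \<mu> (dual_vec \<beta>)) / flow_den \<psi> \<mu> l \<beta>"
    "(flow \<psi> \<mu> l \<beta> - 1) / 2 = (\<psi> \<beta> - 1) / 2 * exp (- (l (dual_vec \<beta>) - \<mu> (dual_vec \<beta>))) / flow_den \<psi> \<mu> l \<beta>"
    by (simp_all add: flow_num_def) (simp_all add: flow_den_def)
qed

text \<open>By invariance of the Killing form, a nonzero pairing forces the three weights to add up
  to zero on \<open>h\<close>.\<close>

lemma dual_vec_sum_zero:
  assumes *: "\<beta> \<in> roots h" "\<gamma> \<in> roots h" "\<delta> \<in> roots h" and nz: "killing (lie (E \<beta>) (E \<gamma>)) (E \<delta>) \<noteq> 0"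
  shows "dual_vec \<beta> + dual_vec \<gamma> + dual_vec \<delta> = 0"
proof (rule killing_nondegenerate_on_h)
  show "dual_vec \<beta> + dual_vec \<gamma> + dual_vec \<delta> \<in> h" using * by (simp add: h_closed)
  fix H assume H: "H \<in> h"
  have "lie H (lie (E \<beta>) (E \<gamma>)) = (\<beta> H + \<gamma> H) *\<^sub>C lie (E \<beta>) (E \<gamma>)"
    using lie_derivation[of H "E \<beta>" "E \<gamma>"] * H by (simp add: lie_E lie_bilinear scaleC_add_left)
  then have "(\<beta> H + \<gamma> H) + \<delta> H = 0"
    using killing_weights_orthogonal[OF _ lie_E[OF *(3) H]] nz by blast
  then show "killing (dual_vec \<beta> + dual_vec \<gamma> + dual_vec \<delta>) H = 0"
    using * H by (simp add: killing_commute[of _ H] killing_add_right killing_dual_vec)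
qed

text \<open>By \<open>flow_half\<close> both products acquire the same denominator, and their
  exponentials multiply to 1 because the three dual vectors add up to zero.\<close>

lemma additive_flow:
  assumes add: "root_additive \<psi>" and l: "l \<in> hstar h" "\<mu> \<in> hstar h"
    and den: "\<And>\<beta>. \<beta> \<in> roots h \<Longrightarrow> flow_den \<psi> \<mu> l \<beta> \<noteq> 0"
  shows "root_additive (flow \<psi> \<mu> l)"
  unfolding root_additive_def
proof (intro ballI impI)
  fix \<beta> \<gamma> \<delta> assume *: "\<beta> \<in> roots h" "\<gamma> \<in> roots h" "\<delta> \<in> roots h"
    and nz: "killing (lie (E \<beta>) (E \<gamma>)) (E \<delta>) \<noteq> 0"
  let ?x = "\<lambda>\<beta>. l (dual_vec \<beta>) - \<mu> (dual_vec \<beta>)"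
  have zero: "\<phi> (dual_vec \<beta>) + \<phi> (dual_vec \<gamma>) + \<phi> (dual_vec \<delta>) = 0" if "\<phi> \<in> hstar h" for \<phi>
    using dual_vec_sum_zero[OF * nz] hstarD[OF that] * h_closed hstarD(2)[OF that h_closed(1), of 0]
    by (metis dual_vec_in_h cvs.scale_zero_left mult_zero_left)
  have "?x \<beta> + ?x \<gamma> + ?x \<delta> = (l (dual_vec \<beta>) + l (dual_vec \<gamma>) + l (dual_vec \<delta>))
      - (\<mu> (dual_vec \<beta>) + \<mu> (dual_vec \<gamma>) + \<mu> (dual_vec \<delta>))" by simp
  then have sum: "?x \<beta> + ?x \<gamma> + ?x \<delta> = 0" by (simp only: zero[OF l(1)] zero[OF l(2)] diff_self)
  have "- ?x \<beta> + - ?x \<gamma> + - ?x \<delta> = - (?x \<beta> + ?x \<gamma> + ?x \<delta>)" by simp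
  then have sum': "- ?x \<beta> + - ?x \<gamma> + - ?x \<delta> = 0" by (simp only: sum minus_zero)
  have e: "exp (?x \<beta>) * exp (?x \<gamma>) * exp (?x \<delta>) = 1" "exp (- ?x \<beta>) * exp (- ?x \<gamma>) * exp (- ?x \<delta>) = 1"
    unfolding exp_add[symmetric] sum sum' by simp_all
  have rel: "(\<psi> \<beta> + 1) / 2 * ((\<psi> \<gamma> + 1) / 2) * ((\<psi> \<delta> + 1) / 2) = (\<psi> \<beta> - 1) / 2 * ((\<psi> \<gamma> - 1) / 2) * ((\<psi> \<delta> - 1) / 2)"
    using add * nz unfolding root_additive_def by blast
  have prod: "a * u / d * (a' * u' / d') * (a'' * u'' / d'') = a * a' * a'' * (u * u' * u'') / (d * d' * d'')"
    for a u d a' u' d' a'' u'' d'' :: complex by simp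
  show "(flow \<psi> \<mu> l \<beta> + 1) / 2 * ((flow \<psi> \<mu> l \<gamma> + 1) / 2) * ((flow \<psi> \<mu> l \<delta> + 1) / 2)
    = (flow \<psi> \<mu> l \<beta> - 1) / 2 * ((flow \<psi> \<mu> l \<gamma> - 1) / 2) * ((flow \<psi> \<mu> l \<delta> - 1) / 2)"
    unfolding flow_half[OF den[OF *(1)]] flow_half[OF den[OF *(2)]] flow_half[OF den[OF *(3)]] prod e rel ..
qed

text \<open>Up to the factor \<open>?k\<close>, differentiation exchanges numerator and denominator,
  as it does hyperbolic sine and cosine; the quotient rule then gives the Riccati equation.\<close>

lemma flow_has_derivative:
  assumes den: "flow_den \<psi> \<mu> l \<beta> \<noteq> 0"
  shows "((\<lambda>t. flow \<psi> \<mu> (\<lambda>x. l x + t * hvd i x) \<beta>) has_field_derivative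
    hvd i (dual_vec \<beta>) * (1 - (flow \<psi> \<mu> l \<beta>)\<^sup>2)) (at 0)"
proof -
  let ?k = "hvd i (dual_vec \<beta>)" and ?l = "\<lambda>t x. l x + t * hvd i x"
  \<comment> \<open>The sign \<open>s\<close> covers numerator and denominator at once.\<close>
  have gen: "((\<lambda>t. b * exp (x + t * k - m) + s * (a * exp (- (x + t * k - m)))) has_field_derivative
      k * (b * exp (x - m) - s * (a * exp (- (x - m))))) (at 0)" for a b x k m s :: complex
    by (auto intro!: derivative_eq_intros simp: algebra_simps)
  have num': "((\<lambda>t. flow_num \<psi> \<mu> (?l t) \<beta>) has_field_derivative ?k * flow_den \<psi> \<mu> l \<beta>) (at 0)"
    unfolding flow_num_def flow_den_def
    using gen[where s = "1" and b = "(\<psi> \<beta> + 1) / 2" and a = "(\<psi> \<beta> - 1) / 2" and x = "l (dual_vec \<beta>)"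
        and k = ?k and m = "\<mu> (dual_vec \<beta>)"] by simp
  have den': "((\<lambda>t. flow_den \<psi> \<mu> (?l t) \<beta>) has_field_derivative ?k * flow_num \<psi> \<mu> l \<beta>) (at 0)"
    unfolding flow_num_def flow_den_def
    using gen[where s = "- 1" and b = "(\<psi> \<beta> + 1) / 2" and a = "(\<psi> \<beta> - 1) / 2" and x = "l (dual_vec \<beta>)"
        and k = ?k and m = "\<mu> (dual_vec \<beta>)"] by simp
  have "((\<lambda>t. flow \<psi> \<mu> (?l t) \<beta>) has_field_derivative
      (?k * flow_den \<psi> \<mu> l \<beta> * flow_den \<psi> \<mu> l \<beta> - flow_num \<psi> \<mu> l \<beta> * (?k * flow_num \<psi> \<mu> l \<beta>))
        / (flow_den \<psi> \<mu> l \<beta> * flow_den \<psi> \<mu> l \<beta>)) (at 0)"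
    unfolding flow_def using DERIV_divide[OF num' den'] den by simp
  moreover have "(?k * flow_den \<psi> \<mu> l \<beta> * flow_den \<psi> \<mu> l \<beta> - flow_num \<psi> \<mu> l \<beta> * (?k * flow_num \<psi> \<mu> l \<beta>))
        / (flow_den \<psi> \<mu> l \<beta> * flow_den \<psi> \<mu> l \<beta>) = ?k * (1 - (flow \<psi> \<mu> l \<beta>)\<^sup>2)"
    using den by (simp add: flow_def field_simps power2_eq_square)
  ultimately show ?thesis by simp
qed

text \<open>The poles of the solution are not in its holomorphic locus, although division by zero
  makes it finite there: this is \<open>root_coeff_on_locus\<close> again.\<close>

theorem exists_dynamical_r_matrix:
  assumes U: "open (cimage U)" "connected (cimage U)" "U \<subseteq> hstar h" and \<mu>: "\<mu> \<in> U"
    and \<psi>: "odd_on_roots \<psi>" "root_additive \<psi>"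
  obtains r where "dynamical_r_matrix h \<alpha> E U r" "\<mu> \<in> locus U r"
    "\<And>\<beta>. \<beta> \<in> roots h \<Longrightarrow> root_coeff (r \<mu>) \<beta> = \<psi> \<beta>"
    "\<And>l. l \<in> locus U r \<Longrightarrow> lagrangian_subalgebra (governed_space h \<alpha> E r l)"
proof
  \<comment> \<open>The component in the second exterior power of \<open>h\<close> is taken to be
    zero.\<close>
  define r where "r l = root_tensor (flow \<psi> \<mu> l)" for l
  have \<mu>h: "\<mu> \<in> hstar h" using U(3) \<mu> by blast
  have biv: "r l \<in> bivectors" for l unfolding r_def by (rule root_tensor_bivector)
  obtain p where p: "\<mu> = pt p" using hstar_point_surj[OF \<mu>h] by metis
  \<comment> \<open>A common denominator; positive roots suffice because \<open>flow_den\<close>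
    takes the same value at \<open>\<beta>\<close> and \<open>- \<beta>\<close>.\<close>
  define B where "B v = (\<Prod>\<beta>\<in>\<Phi>pos. flow_den \<psi> \<mu> (pt v) \<beta>)" for v
  have B: "holomorphic_mv B UNIV" unfolding B_def by (intro holomorphic_mv_prod holomorphic_flow open_UNIV)
  have Bp: "B p = 1" unfolding B_def p[symmetric] by (simp add: flow_start)
  have pU: "p \<in> cimage U" using \<mu> by (simp add: coordinate_image_def p)
  define W where "W = {v \<in> cimage U. B v \<noteq> 0}"
  have W: "open W"
  proof -
    have "open (cimage U \<inter> B -` (- {0}))"
      using continuous_open_preimage[OF continuous_on_subset[OF holomorphic_mv_continuous_on[OF B]] U(1), of "- {0}"]
      by (simp add: open_Compl)
    moreover have "cimage U \<inter> B -` (- {0}) = W" by (auto simp: W_def)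
    ultimately show ?thesis by simp
  qed
  have pW: "p \<in> W" using pU Bp by (simp add: W_def)
  have WU: "W \<subseteq> cimage U" by (auto simp: W_def)
  have denB: "flow_den \<psi> \<mu> (pt v) \<beta> \<noteq> 0" if "B v \<noteq> 0" "\<beta> \<in> roots h" for v \<beta>
  proof -
    have pos: "flow_den \<psi> \<mu> (pt v) \<gamma> \<noteq> 0" if "\<gamma> \<in> \<Phi>pos" for \<gamma>
      using \<open>B v \<noteq> 0\<close> finite_positive_roots that by (simp add: B_def)
    then show ?thesis
      using \<open>\<beta> \<in> roots h\<close> flow_uminus(1)[OF \<psi>(1) hstar_point_in_hstar \<mu>h positive_rootD]
      unfolding roots_eq by fastforce
  qed
  have mer: "meromorphic_tensor h \<alpha> E U r"
    unfolding meromorphic_tensor_def meromorphic_mv_def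
  proof (intro allI ballI)
    fix \<xi> \<eta> q assume q: "q \<in> cimage U"
    \<comment> \<open>One global quotient \<open>A / B\<close> serves at every point
      \<open>q\<close>; its denominator is not identically zero because
      \<open>B p = 1\<close>.\<close>
    define A where "A v = (\<Sum>\<beta>\<in>\<Phi>pos. flow_num \<psi> \<mu> (pt v) \<beta> * (\<Prod>\<gamma>\<in>\<Phi>pos - {\<beta>}. flow_den \<psi> \<mu> (pt v) \<gamma>)
      * wedge2 (E \<beta>) (E (- \<beta>)) \<xi> \<eta>)" for v
    have "holomorphic_mv A UNIV"
      unfolding A_def
      by (intro holomorphic_mv_sum holomorphic_mv_mult holomorphic_mv_prod holomorphic_flow holomorphic_mv_const open_UNIV)
    then have hol: "holomorphic_mv A (cimage U)" "holomorphic_mv B (cimage U)"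
      using B U(1) holomorphic_mv_subset by blast+
    have "r (pt v) \<xi> \<eta> = A v / B v" if "B v \<noteq> 0" for v
      unfolding r_def root_tensor_def A_def sum_divide_distrib
    proof (intro sum.cong refl)
      fix \<beta> assume \<beta>: "\<beta> \<in> \<Phi>pos"
      have "B v = flow_den \<psi> \<mu> (pt v) \<beta> * (\<Prod>\<gamma>\<in>\<Phi>pos - {\<beta>}. flow_den \<psi> \<mu> (pt v) \<gamma>)"
        unfolding B_def by (rule prod.remove[OF finite_positive_roots \<beta>])
      with that show "flow \<psi> \<mu> (pt v) \<beta> * wedge2 (E \<beta>) (E (- \<beta>)) \<xi> \<eta>
          = flow_num \<psi> \<mu> (pt v) \<beta> * (\<Prod>\<gamma>\<in>\<Phi>pos - {\<beta>}. flow_den \<psi> \<mu> (pt v) \<gamma>) * wedge2 (E \<beta>) (E (- \<beta>)) \<xi> \<eta> / B v"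
        by (simp add: flow_def)
    qed
    moreover have "\<exists>v\<in>cimage U. B v \<noteq> 0" using pU Bp by (metis zero_neq_one)
    ultimately show "\<exists>V a b. q \<in> V \<and> V \<subseteq> cimage U \<and> connected V \<and> holomorphic_mv a V \<and> holomorphic_mv b V \<and>
      (\<exists>v\<in>V. b v \<noteq> 0) \<and> (\<forall>v\<in>V. b v \<noteq> 0 \<longrightarrow> r (pt v) \<xi> \<eta> = a v / b v)"
      by (rule_tac exI[of _ "cimage U"], rule_tac exI[of _ A], rule_tac exI[of _ B]) (use hol U(2) q in auto)
  qed
  have coeff: "root_coeff (r l) \<beta> = flow \<psi> \<mu> l \<beta>" if "l \<in> hstar h" "\<beta> \<in> roots h" for l \<beta>
    unfolding r_def by (rule root_coeff_root_tensor[OF odd_flow[OF \<psi>(1) that(1) \<mu>h] that(2)])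
  have den: "flow_den \<psi> \<mu> l \<beta> \<noteq> 0" if l: "l \<in> locus U r" and \<beta>: "\<beta> \<in> roots h" for l \<beta>
  proof (rule root_coeff_on_locus(1)[OF mer U(2) W WU _ _ l])
    show "W \<noteq> {}" using pW by blast
    fix v assume "v \<in> W"
    then have "flow_den \<psi> \<mu> (pt v) \<beta> \<noteq> 0" using denB \<beta> by (simp add: W_def)
    then show "root_coeff (r (pt v)) \<beta> * flow_den \<psi> \<mu> (pt v) \<beta> = flow_num \<psi> \<mu> (pt v) \<beta>"
      using coeff[OF hstar_point_in_hstar \<beta>] by (simp add: flow_def)
  qed
  have locus_U: "l \<in> U" if "l \<in> locus U r" for l using that by (auto simp: holomorphic_locus_def)
  have odd: "odd_on_roots (flow \<psi> \<mu> l)" and add: "root_additive (flow \<psi> \<mu> l)" if l: "l \<in> locus U r" for l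
    using l locus_U U(3) \<mu>h \<psi> den by (blast intro: odd_flow, blast intro: additive_flow)
  have zw: "zero_weight (r l)" if "l \<in> locus U r" for l
    unfolding r_def by (rule zero_weight_root_tensor[OF odd[OF that]])
  have cdybe: "satisfies_cdybe r l" if l: "l \<in> locus U r" for l
  proof (rule riccati_imp_cdybe[OF odd[OF l] add[OF l]])
    show "r l = root_tensor (flow \<psi> \<mu> l)" by (simp add: r_def)
    show "pder i r l = root_tensor (\<lambda>\<beta>. hvd i (dual_vec \<beta>) * (1 - (flow \<psi> \<mu> l \<beta>)\<^sup>2))" for i
      unfolding partial_deriv_def r_def root_tensor_def
      by (intro ext DERIV_imp_deriv DERIV_sum DERIV_cmult_right flow_has_derivative den l positive_rootD)
  qed
  show "dynamical_r_matrix h \<alpha> E U r"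
    unfolding dynamical_r_matrix_def
    using biv mer zw[unfolded zero_weight_def] cdybe[unfolded satisfies_cdybe_def] by blast
  show "\<mu> \<in> locus U r"
    unfolding p
  proof (rule locusI[OF W pW WU])
    fix \<xi> \<eta>
    show "holomorphic_mv (\<lambda>v. r (pt v) \<xi> \<eta>) W"
      unfolding r_def root_tensor_def flow_def
      by (intro holomorphic_mv_sum holomorphic_mv_mult holomorphic_mv_divide holomorphic_mv_const W
          holomorphic_mv_subset[OF holomorphic_flow(1)] holomorphic_mv_subset[OF holomorphic_flow(2)] subset_UNIV)
        (use denB positive_rootD in \<open>auto simp: W_def\<close>)
  qed
  show "root_coeff (r \<mu>) \<beta> = \<psi> \<beta>" if "\<beta> \<in> roots h" for \<beta>
    using coeff[OF \<mu>h that] by (simp add: flow_start)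
  show "lagrangian_subalgebra (governed_space h \<alpha> E r l)" if l: "l \<in> locus U r" for l
  proof -
    have "governed_space h \<alpha> E r l = root_graph (flow \<psi> \<mu> l)"
      unfolding governed_space_eq[where r = r and l = l, OF biv zw[OF l]]
      by (rule root_graph_cong) (use coeff locus_U[OF l] U(3) in blast)
    then show ?thesis using root_graph_lagrangian[OF odd[OF l] add[OF l]] by simp
  qed
qed

text \<open>The value found does not involve the governing r-matrix, so two families with the same
  value at \<open>\<mu>\<close> agree on their common domain.\<close>

lemma governed_family_value:
  assumes W: "governed_family h \<alpha> E U W" "W \<mu> = Some (root_graph \<psi>)" and conn: "connected (cimage U)"
    and l: "l \<in> dom W"
  shows "W l = Some (root_graph (flow \<psi> \<mu> l))"
proof -
  obtain r where dyn: "dynamical_r_matrix h \<alpha> E U r"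
    and Weq: "W = (\<lambda>l. if l \<in> locus U r then Some (governed_space h \<alpha> E r l) else None)"
    using W(1) by (auto simp: governed_family_def)
  have graph: "governed_space h \<alpha> E r l = root_graph (root_coeff (r l))" if "l \<in> locus U r" for l
  proof (rule governed_space_eq)
    have "l \<in> U" using that by (auto simp: holomorphic_locus_def)
    then show "r l \<in> bivectors" "zero_weight (r l)"
      using dyn that by (auto simp: dynamical_r_matrix_def zero_weight_def)
  qed
  have \<mu>: "\<mu> \<in> locus U r" and l': "l \<in> locus U r"
    using W(2) l by (auto simp: Weq split: if_splits)
  have "root_graph (root_coeff (r \<mu>)) = root_graph \<psi>"
    using W(2) graph[OF \<mu>] by (simp add: Weq \<mu>)
  then have "root_coeff (r \<mu>) \<beta> = \<psi> \<beta>" if "\<beta> \<in> roots h" for \<beta>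
    using root_graph_inject that by blast
  then have "root_coeff (r l) \<beta> = flow \<psi> \<mu> l \<beta>" if "\<beta> \<in> roots h" for \<beta>
    using dynamical_r_matrix_root_coeff[OF dyn conn \<mu> l' that] that by simp
  then have "root_graph (root_coeff (r l)) = root_graph (flow \<psi> \<mu> l)" by (rule root_graph_cong)
  with graph[OF l'] show ?thesis by (simp add: Weq l')
qed

end

text \<open>Uniqueness refers to the common domain because two governing r-matrices may differ in
  the second exterior power of \<open>h\<close> and then be holomorphic on different sets.\<close>

theorem corollary5p6:
  fixes h :: "'g::complex_lie_algebra set"
    and \<alpha> :: "'n::finite \<Rightarrow> 'g \<Rightarrow> complex"
    and E :: "('g \<Rightarrow> complex) \<Rightarrow> 'g"
    and U :: "('g \<Rightarrow> complex) set"
    and \<mu> :: "'g \<Rightarrow> complex"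
    and W0 :: "('g \<times> 'g) set"
  assumes "simple_lie_algebra TYPE('g)"
    and "cartan_subalgebra h"
    and "simple_roots h \<alpha>"
    and "root_vectors h E"
    and "open_in_hstar h \<alpha> E U"
    and "connected_in_hstar h \<alpha> E U"
    and "\<mu> \<in> U"
    and "lagrangian_subalgebra W0"
    and "W0 \<inter> range diagonal = diagonal ` h"
  shows "(\<exists>W. governed_family h \<alpha> E U W \<and> W \<mu> = Some W0) \<and>
    (\<forall>W W'. governed_family h \<alpha> E U W \<and> W \<mu> = Some W0 \<and>
        governed_family h \<alpha> E U W' \<and> W' \<mu> = Some W0 \<longrightarrow>
      (\<forall>l \<in> dom W \<inter> dom W'. W l = W' l))"
proof -
  interpret root_data h \<alpha> E using assms(1-4) by unfold_locales
  have U: "open (cimage U)" "connected (cimage U)" "U \<subseteq> hstar h"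
    using assms(5,6) by (auto simp: open_in_hstar_def connected_in_hstar_def)
  obtain \<psi> where \<psi>: "odd_on_roots \<psi>" "root_additive \<psi>" "W0 = root_graph \<psi>"
    using lagrangian_is_root_graph[OF assms(8,9)] by blast
  obtain r where r: "dynamical_r_matrix h \<alpha> E U r" "\<mu> \<in> locus U r"
      "\<And>\<beta>. \<beta> \<in> roots h \<Longrightarrow> root_coeff (r \<mu>) \<beta> = \<psi> \<beta>"
      "\<And>l. l \<in> locus U r \<Longrightarrow> lagrangian_subalgebra (governed_space h \<alpha> E r l)"
    by (rule exists_dynamical_r_matrix[OF U assms(7) \<psi>(1,2)]) (rule that, assumption+)
  define W where "W = (\<lambda>l. if l \<in> locus U r then Some (governed_space h \<alpha> E r l) else None)"
  have "governed_family h \<alpha> E U W"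
    unfolding governed_family_def
  proof
    show "\<forall>L\<in>ran W. lagrangian_subalgebra L"
      using r(4) by (auto simp: W_def ran_def split: if_splits)
    show "\<exists>r. dynamical_r_matrix h \<alpha> E U r \<and> W = (\<lambda>l. if l \<in> locus U r then Some (governed_space h \<alpha> E r l) else None)"
      using r(1) W_def by blast
  qed
  moreover have "W \<mu> = Some W0"
  proof -
    have "r \<mu> \<in> bivectors" "zero_weight (r \<mu>)"
      using r(1,2) assms(7) by (auto simp: dynamical_r_matrix_def zero_weight_def)
    then have "governed_space h \<alpha> E r \<mu> = root_graph (root_coeff (r \<mu>))" by (rule governed_space_eq)
    also have "\<dots> = W0" unfolding \<psi>(3) by (rule root_graph_cong) (rule r(3))
    finally show ?thesis by (simp add: W_def r(2))
  qed
  moreover have "W l = W' l"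
    if "governed_family h \<alpha> E U W" "W \<mu> = Some W0" "governed_family h \<alpha> E U W'" "W' \<mu> = Some W0"
      "l \<in> dom W \<inter> dom W'" for W W' l
    using governed_family_value[of U W \<mu> \<psi> l] governed_family_value[of U W' \<mu> \<psi> l] that \<psi>(3) U(2) by simp
  ultimately show ?thesis by blast
qed

end
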